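(* Let $H$ be a separable real Hilbert space and $B:H\to H$ a bounded, symmetric, coercive linear operator. Let $\alpha>0$, and consider $$u''(t)+u'(t)+|B^{1/2}u(t)|^{2\alpha}Bu(t)=0,\qquad u(0)=u_0,\ u'(0)=u_1.$$ Then: (1) For every $(u_0,u_1)\in H\times H$ the problem has a unique global solution $u\in C^2([0,\infty),H)$. (2) Every nonzero solution is of exactly one of the following two types: - slow: there exist constants $C_1,C_2>0$ with $C_1(1+t)^{-1/(2\alpha)}\le|u(t)|\le C_2(1+t)^{-1/(2\alpha)}$ (for all sufficiently large $t$); - fast: there exists $v_0\in H\setminus\{0\}$ such that $\lim_{t\to\infty}\left(|u'(t)+v_0e^{-t}|+|u(t)-v_0e^{-t}|\right)e^{\gamma t}=0$ for every $\gamma<1+2\alpha$. (3) There is a nonempty open set $\mathcal S\subseteq H\times H$ of initial data producing slow solutions. (4) For every $v_0\in H$ with $v_0\ne0$ and $|v_0|$ small enough, there exists at least one solution satisfying the fast asymptotics in (2) with this $v_0$.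
   Context: $|\cdot|$ denotes the norm of $H$. $B$ is coercive, meaning that $\langle Bu,u\rangle\ge c|u|^2$ for some $c>0$.
   Formalization: The Hilbert space H is assumed to be nonzero; for H = {0} the only solution is zero, so there are no slow solutions and claim (3) fails. *)

theory Defs
  imports "HOL-Analysis.Analysis"
begin

definition sym_op :: "('a::real_inner \<Rightarrow> 'a) \<Rightarrow> bool" where
  "sym_op B \<longleftrightarrow> (\<forall>x y. B x \<bullet> y = x \<bullet> B y)"

definition coercive_op :: "('a::real_inner \<Rightarrow> 'a) \<Rightarrow> bool" where
  "coercive_op B \<longleftrightarrow> (\<exists>c>0. \<forall>u. B u \<bullet> u \<ge> c * (norm u)\<^sup>2)"

definition nonneg_op :: "('a::real_inner \<Rightarrow> 'a) \<Rightarrow> bool" where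
  "nonneg_op S \<longleftrightarrow> (\<forall>u. S u \<bullet> u \<ge> 0)"

definition op_sqrt :: "('a::real_inner \<Rightarrow> 'a) \<Rightarrow> 'a \<Rightarrow> 'a" where
  "op_sqrt B = (THE S. bounded_linear S \<and> sym_op S \<and> nonneg_op S \<and> S \<circ> S = B)"

text \<open>u is a C^2([0,\<infinity>),H) solution of
  u'' + u' + |B^(1/2) u|^(2 alpha) B u = 0, u(0)=u0, u'(0)=u1
  (derivatives one-sided at 0; values for t<0 are irrelevant).\<close>
definition is_solution ::
  "('a::real_inner \<Rightarrow> 'a) \<Rightarrow> real \<Rightarrow> 'a \<Rightarrow> 'a \<Rightarrow> (real \<Rightarrow> 'a) \<Rightarrow> bool" where
  "is_solution B \<alpha> u0 u1 u \<longleftrightarrow>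
     (\<exists>u' u''.
        (\<forall>t\<ge>0. (u has_vector_derivative u' t) (at t within {0..})) \<and>
        (\<forall>t\<ge>0. (u' has_vector_derivative u'' t) (at t within {0..})) \<and>
        continuous_on {0..} u'' \<and>
        u 0 = u0 \<and> u' 0 = u1 \<and>
        (\<forall>t\<ge>0. u'' t + u' t + (norm (op_sqrt B (u t)) powr (2 * \<alpha>)) *\<^sub>R B (u t) = 0))"

definition dt :: "(real \<Rightarrow> 'a::real_normed_vector) \<Rightarrow> real \<Rightarrow> 'a" where
  "dt u t = vector_derivative u (at t within {0..})"

definition slow_solution :: "real \<Rightarrow> (real \<Rightarrow> 'a::real_normed_vector) \<Rightarrow> bool" where
  "slow_solution \<alpha> u \<longleftrightarrow>
     (\<exists>C1>0. \<exists>C2>0. \<forall>\<^sub>F t in at_top.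
        C1 * (1 + t) powr (- 1 / (2 * \<alpha>)) \<le> norm (u t) \<and>
        norm (u t) \<le> C2 * (1 + t) powr (- 1 / (2 * \<alpha>)))"

definition fast_with :: "real \<Rightarrow> 'a::real_normed_vector \<Rightarrow> (real \<Rightarrow> 'a) \<Rightarrow> bool" where
  "fast_with \<alpha> v0 u \<longleftrightarrow>
     (\<forall>\<gamma><1 + 2 * \<alpha>.
        ((\<lambda>t. (norm (dt u t + exp (- t) *\<^sub>R v0) + norm (u t - exp (- t) *\<^sub>R v0)) * exp (\<gamma> * t))
           \<longlongrightarrow> 0) at_top)"

definition fast_solution :: "real \<Rightarrow> (real \<Rightarrow> 'a::real_normed_vector) \<Rightarrow> bool" where
  "fast_solution \<alpha> u \<longleftrightarrow> (\<exists>v0. v0 \<noteq> 0 \<and> fast_with \<alpha> v0 u)"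

end

theory Submission
  imports Defs
begin

text \<open>
  Put \<open>z = u'\<close>, \<open>p = u + z\<close> and \<open>f(u) = |B\<^sup>1\<^sup>/\<^sup>2 u|\<^sup>2\<^sup>\<alpha> B u\<close>, so that \<open>p' = - f(u)\<close> and
  \<open>z' = - z - f(u)\<close>. The energy is a Lyapunov function which bounds solutions, whence global existence,
  and a multiplier argument shows that it decays like \<open>1/t\<close>. Once \<open>u\<close> is small,
  \<open>e\<^sup>t (|p|\<^sup>2 - |z|\<^sup>2)\<close> is nondecreasing. If \<open>|p| > |z|\<close> at one late time, this persists, \<open>z\<close> becomes
  negligible against \<open>p\<close>, and \<open>p' = - f(u)\<close> forces \<open>|p|\<^sup>-\<^sup>2\<^sup>\<alpha>\<close> to grow linearly: the solution is
  slow. Since this is an open condition on small data, there is an open set of slow data. If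
  \<open>|p| \<le> |z|\<close> forever, then \<open>z = O(e\<^sup>-\<^sup>t)\<close>, and integrating the equations for \<open>p\<close> and \<open>e\<^sup>t z\<close> gives the
  fast asymptotics. Conversely, in the variable \<open>r = e\<^sup>-\<^sup>2\<^sup>\<alpha>\<^sup>t\<close> the function \<open>X = e\<^sup>t u\<close> of a fast solution
  solves a fixed point equation on \<open>[0, 1]\<close> with \<open>X(0) = v\<^sub>0\<close>, which is a contraction for small \<open>v\<^sub>0\<close>.
\<close>

section \<open>The square root of a coercive operator\<close>

text \<open>The linear part u'' + u' = 0 has a constant mode, for which p is conserved, and a mode
  decaying like exp(-t), which z measures. Comparing |p| with |z| asks which of them wins; the
  superlinear \<open>f\<close>, of degree 2\<alpha> + 1, perturbs both. B enters only through its
  square root and two-sided norm bounds on that root. Three obstacles shape the proof. B^(1/2) is a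
  definite description, so existence and uniqueness of the root come first. \<open>f\<close> is only
  locally Lipschitz, and for small \<alpha> its scalar factor |S u|^(2\<alpha>) is not even that at
  0, so the power is truncated as a vector field and the energy shows that the truncation is never
  felt. Finally, a fast solution needs a nonzero limit of exp(t) z, which calls for a lower bound on
  |z| of the exact order exp(-t). The variable r compactifies the half line and turns behaviour at
  infinity into a value at r = 0; the homogeneity of \<open>f\<close> supplies the factor
  exp(-2\<alpha> t) that dr requires.\<close>

lemma sqrt_iteration_radius:
  fixes q :: real
  assumes "0 \<le> q" "q < 1"
  obtains r where "0 \<le> r" "r < 1" "(q + r\<^sup>2) / 2 = r"
proof
  show "0 \<le> 1 - sqrt (1 - q)" using assms by simp
  show "1 - sqrt (1 - q) < 1" using assms by simp
  have "(sqrt (1 - q))\<^sup>2 = 1 - q" using assms by simp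
  then show "(q + (1 - sqrt (1 - q))\<^sup>2) / 2 = 1 - sqrt (1 - q)"
    by (simp add: power2_diff field_simps)
qed

text \<open>The Cauchy-Schwarz inequality for the form <A x, y>, taken at y = A u, gives |A u|^4 <=
  <A u, u> <A (A u), A u> <= q^2 |u|^2 |A u|^2. A bound on the quadratic form thus becomes an
  operator norm bound with the same constant.\<close>

lemma sym_op_norm_le:
  fixes A :: "'a::real_inner \<Rightarrow> 'a"
  assumes A: "bounded_linear A" and sym: "sym_op A"
    and pos: "\<And>u. 0 \<le> A u \<bullet> u" and le: "\<And>u. A u \<bullet> u \<le> q * (norm u)\<^sup>2"
  shows "norm (A u) \<le> q * norm u"
proof -
  interpret bounded_linear A by fact
  \<comment> \<open>Cauchy--Schwarz for the semi-inner product \<open>\<langle>A x, y\<rangle>\<close>.\<close>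
  have cs: "(A x \<bullet> y)\<^sup>2 \<le> (A x \<bullet> x) * (A y \<bullet> y)" for x y
  proof -
    have "0 \<le> A (x + t *\<^sub>R y) \<bullet> (x + t *\<^sub>R y)" for t
      by (rule pos)
    moreover have "A (x + t *\<^sub>R y) \<bullet> (x + t *\<^sub>R y) = (A y \<bullet> y) * t\<^sup>2 + 2 * (A x \<bullet> y) * t + A x \<bullet> x" for t
      using sym by (simp add: add scaleR inner_add_left inner_add_right sym_op_def inner_commute
          power2_eq_square algebra_simps)
    ultimately have *: "0 \<le> (A y \<bullet> y) * t\<^sup>2 + 2 * (A x \<bullet> y) * t + A x \<bullet> x" for t
      by metis
    show ?thesis
    proof (cases "A y \<bullet> y = 0")
      case True
      have "A x \<bullet> y = 0"
      proof (rule ccontr)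
        assume n: "A x \<bullet> y \<noteq> 0"
        \<comment> \<open>At this t the linear polynomial takes the value -1.\<close>
        show False
          using *[of "- (A x \<bullet> x + 1) / (2 * (A x \<bullet> y))"] n True by (simp add: field_simps)
      qed
      then show ?thesis using True by simp
    next
      case False
      then have p: "A y \<bullet> y > 0" using pos[of y] by simp
      have "(A y \<bullet> y) * (- (A x \<bullet> y) / (A y \<bullet> y))\<^sup>2 + 2 * (A x \<bullet> y) * (- (A x \<bullet> y) / (A y \<bullet> y))
          = - ((A x \<bullet> y)\<^sup>2 / (A y \<bullet> y))"
        using p by (simp add: field_simps power2_eq_square)
      then have "(A x \<bullet> y)\<^sup>2 / (A y \<bullet> y) \<le> A x \<bullet> x"
        using *[of "- (A x \<bullet> y) / (A y \<bullet> y)"] by simp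
      then show ?thesis using p by (simp add: field_simps)
    qed
  qed
  have q: "0 \<le> q * norm u"
  proof (cases "u = 0")
    case False
    have "0 \<le> q * (norm u)\<^sup>2" using pos[of u] le[of u] by linarith
    then show ?thesis using False by (simp add: zero_le_mult_iff)
  qed simp
  have "(norm (A u))\<^sup>2 * (norm (A u))\<^sup>2 = (A u \<bullet> A u)\<^sup>2"
    by (simp only: power2_norm_eq_inner power2_eq_square[of "A u \<bullet> A u"])
  also have "\<dots> \<le> (A u \<bullet> u) * (A (A u) \<bullet> A u)" by (rule cs)
  also have "\<dots> \<le> (q * (norm u)\<^sup>2) * (q * (norm (A u))\<^sup>2)"
    by (intro mult_mono le pos) (use pos[of u] le[of u] in linarith)
  finally have "(norm (A u))\<^sup>2 * (norm (A u))\<^sup>2 \<le> (q * norm u)\<^sup>2 * (norm (A u))\<^sup>2"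
    by (simp add: power2_eq_square mult_ac)
  then have "A u = 0 \<or> (norm (A u))\<^sup>2 \<le> (q * norm u)\<^sup>2"
    by (metis mult_le_cancel_right_pos zero_less_norm_iff zero_less_power)
  then show ?thesis using q by (auto intro: power2_le_imp_le)
qed

text \<open>Write B = M (I - A) with 0 <= A <= q < 1. Then (sqrt M (I - Y))^2 = B exactly when Y =
  (A + Y^2) / 2, and this fixed point is found by contraction in the operator norm. The bound |Y| <=
  r < 1 makes S coercive. The final clause on operators commuting with B prepares the uniqueness of
  the root.\<close>

lemma coercive_sqrt_exists:
  fixes B :: "'a::{real_inner, banach} \<Rightarrow> 'a"
  assumes bl: "bounded_linear B" and sym: "sym_op B" and coer: "coercive_op B"
  shows "\<exists>S. bounded_linear S \<and> sym_op S \<and> S \<circ> S = B \<and> (\<exists>d>0. \<forall>u. d * (norm u)\<^sup>2 \<le> S u \<bullet> u)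
    \<and> (\<forall>T. bounded_linear T \<longrightarrow> T \<circ> B = B \<circ> T \<longrightarrow> T \<circ> S = S \<circ> T)"
proof -
  obtain c where c: "c > 0" "\<And>u. c * (norm u)\<^sup>2 \<le> B u \<bullet> u"
    using coer unfolding coercive_op_def by auto
  obtain M0 where M0: "\<And>u. norm (B u) \<le> norm u * M0" "M0 > 0"
    using bounded_linear.pos_bounded[OF bl] by auto
  \<comment> \<open>The maximum ensures c <= M, hence q >= 0, also on the zero space, where M0 may
    be smaller than c.\<close>
  define M where "M = max M0 c"
  have "norm u * M0 \<le> M * norm u" for u :: 'a
    by (subst mult.commute, rule mult_right_mono) (auto simp: M_def)
  then have M: "M > 0" "c \<le> M" "norm (B u) \<le> M * norm u" for u
    using M0 c(1) order_trans by (auto simp: M_def) blast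
  define q where "q = 1 - c / M"
  have q: "0 \<le> q" "q < 1" using M c by (auto simp: q_def field_simps)
  \<comment> \<open>r is a fixed point of the scalar map that majorizes \<open>\<Phi>\<close> in
    norm. It is both the radius of an invariant ball and the contraction factor.\<close>
  obtain r where r: "0 \<le> r" "r < 1" "(q + r\<^sup>2) / 2 = r"
    using sqrt_iteration_radius[OF q] by metis
  define A0 where "A0 = (\<lambda>u. u - (1 / M) *\<^sub>R B u)"
  have blA: "bounded_linear A0"
    unfolding A0_def by (intro bounded_linear_sub bounded_linear_ident bounded_linear_const_scaleR bl)
  have symA: "sym_op A0"
    using sym by (simp add: sym_op_def A0_def inner_diff_left inner_diff_right)
  have A_ge: "0 \<le> A0 u \<bullet> u" for u
  proof -
    have "B u \<bullet> u \<le> norm (B u) * norm u" by (rule norm_cauchy_schwarz)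
    also have "\<dots> \<le> M * norm u * norm u" by (intro mult_right_mono M) simp
    finally have "B u \<bullet> u / M \<le> u \<bullet> u"
      using M(1) by (simp add: field_simps power2_norm_eq_inner[symmetric] power2_eq_square)
    then show ?thesis by (simp add: A0_def inner_diff_left)
  qed
  have A_le: "A0 u \<bullet> u \<le> q * (norm u)\<^sup>2" for u
    using c(2)[of u] M(1)
    by (simp add: A0_def inner_diff_left q_def field_simps power2_norm_eq_inner)
  define A where "A = Blinfun A0"
  have A: "blinfun_apply A = A0"
    unfolding A_def by (rule bounded_linear_Blinfun_apply[OF blA])
  have nA: "norm A \<le> q"
    by (rule norm_blinfun_bound[OF q(1)]) (simp add: A sym_op_norm_le[OF blA symA A_ge A_le])
  define \<Phi> where "\<Phi> Y = (1/2) *\<^sub>R (A + (Y o\<^sub>L Y))" for Y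
  \<comment> \<open>Symmetry and commutation are built into the domain as closed conditions
    preserved by \<open>\<Phi>\<close>, so the fixed point inherits them directly.\<close>
  define K where "K = cball 0 r \<inter> {Y :: 'a \<Rightarrow>\<^sub>L 'a. \<forall>x y. Y x \<bullet> y = x \<bullet> Y y}
    \<inter> {Y. \<forall>T :: 'a \<Rightarrow>\<^sub>L 'a. T o\<^sub>L A = A o\<^sub>L T \<longrightarrow> T o\<^sub>L Y = Y o\<^sub>L T}"
  have K_norm: "norm Y \<le> r" if "Y \<in> K" for Y
    using that unfolding K_def by (simp only: Int_iff mem_cball dist_0_norm)
  have K_sym: "Y x \<bullet> y = x \<bullet> Y y" if "Y \<in> K" for Y x y
    using that unfolding K_def by blast
  have K_com: "T o\<^sub>L Y = Y o\<^sub>L T" if "Y \<in> K" "T o\<^sub>L A = A o\<^sub>L T" for Y T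
    using that unfolding K_def by blast
  have "closed K"
    unfolding K_def Collect_all_eq Collect_imp_eq
    by (intro closed_Int closed_cball closed_INT ballI closed_Un closed_Collect_eq
        continuous_intros open_Collect_const)
  moreover have "complete (UNIV :: ('a \<Rightarrow>\<^sub>L 'a) set)" by (rule complete_UNIV)
  ultimately have "complete K" by (simp add: complete_eq_closed)
  moreover have "0 \<in> K" using r by (simp add: K_def)
  moreover have "\<Phi> ` K \<subseteq> K"
  proof
    fix Z assume "Z \<in> \<Phi> ` K"
    then obtain Y where Y: "Y \<in> K" "Z = \<Phi> Y" by auto
    have "norm (Y o\<^sub>L Y) \<le> r * r"
      by (rule order_trans[OF norm_blinfun_compose]) (intro mult_mono K_norm Y r norm_ge_zero)
    then have "norm (A + (Y o\<^sub>L Y)) \<le> q + r\<^sup>2"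
      using norm_triangle_ineq[of A "Y o\<^sub>L Y"] nA by (simp add: power2_eq_square)
    then have 1: "norm Z \<le> r" using Y(2) r(3) by (simp add: \<Phi>_def)
    have 2: "Z x \<bullet> y = x \<bullet> Z y" for x y
      using symA by (simp add: Y(2) K_sym[OF Y(1)] \<Phi>_def A sym_op_def blinfun.scaleR_left blinfun.add_left
          inner_add_left inner_add_right)
    have 3: "T o\<^sub>L Z = Z o\<^sub>L T" if T: "T o\<^sub>L A = A o\<^sub>L T" for T :: "'a \<Rightarrow>\<^sub>L 'a"
    proof -
      from arg_cong[OF K_com[OF Y(1) T], of "\<lambda>X. blinfun_apply X x" for x]
      have TY: "T (Y x) = Y (T x)" for x by simp
      have TA: "T (A x) = A (T x)" for x
        using arg_cong[OF T, of "\<lambda>X. blinfun_apply X x"] by simp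
      show ?thesis
        by (rule blinfun_eqI)
          (simp add: Y(2) \<Phi>_def blinfun.scaleR_left blinfun.add_left blinfun.scaleR_right blinfun.add_right TY TA)
    qed
    show "Z \<in> K" unfolding K_def using 1 2 3 by (intro IntI CollectI) auto
  qed
  moreover have "dist (\<Phi> Y) (\<Phi> Z) \<le> r * dist Y Z" if "Y \<in> K" "Z \<in> K" for Y Z
  proof -
    have "norm ((Y o\<^sub>L Y) - (Z o\<^sub>L Z)) = norm ((Y o\<^sub>L (Y - Z)) + ((Y - Z) o\<^sub>L Z))"
      by (rule arg_cong[of _ _ norm], rule blinfun_eqI)
        (simp add: blinfun.diff_left blinfun.diff_right blinfun.add_left)
    also have "\<dots> \<le> norm Y * norm (Y - Z) + norm (Y - Z) * norm Z"
      by (intro norm_triangle_mono norm_blinfun_compose)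
    also have "\<dots> \<le> r * norm (Y - Z) + norm (Y - Z) * r"
      using that by (intro add_mono mult_right_mono mult_left_mono K_norm norm_ge_zero)
    finally have "norm ((Y o\<^sub>L Y) - (Z o\<^sub>L Z)) \<le> 2 * (r * norm (Y - Z))" by simp
    moreover have "\<Phi> Y - \<Phi> Z = (1/2) *\<^sub>R ((Y o\<^sub>L Y) - (Z o\<^sub>L Z))"
      by (simp add: \<Phi>_def algebra_simps)
    ultimately show ?thesis by (simp add: dist_norm)
  qed
  ultimately have "\<exists>!Y. Y \<in> K \<and> \<Phi> Y = Y"
    using Banach_fix[of K r \<Phi>] r by blast
  then obtain Y where Y: "Y \<in> K" "\<Phi> Y = Y" by auto
  have YY: "Y (Y x) = 2 *\<^sub>R Y x - A0 x" for x
  proof -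
    have "(1/2) *\<^sub>R (A0 x + Y (Y x)) = Y x"
      using arg_cong[OF Y(2), of "\<lambda>Y. blinfun_apply Y x"]
      by (simp add: \<Phi>_def blinfun.scaleR_left blinfun.add_left A)
    then have "2 *\<^sub>R ((1/2) *\<^sub>R (A0 x + Y (Y x))) = 2 *\<^sub>R Y x" by (simp only:)
    then have "A0 x + Y (Y x) = 2 *\<^sub>R Y x" by simp
    then show ?thesis by (simp add: eq_diff_eq add.commute)
  qed
  define S where "S = (\<lambda>x. sqrt M *\<^sub>R (x - Y x))"
  have "bounded_linear S"
    unfolding S_def by (intro bounded_linear_const_scaleR bounded_linear_sub bounded_linear_ident
        blinfun.bounded_linear_right)
  moreover have "sym_op S"
    by (simp add: K_sym[OF Y(1)] S_def sym_op_def inner_diff_left inner_diff_right)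
  moreover have "S \<circ> S = B"
  proof
    fix x
    have "S (S x) = sqrt M *\<^sub>R sqrt M *\<^sub>R (x - Y x - (Y x - Y (Y x)))"
      by (simp only: S_def blinfun.scaleR_right blinfun.diff_right scaleR_diff_right)
    also have "\<dots> = M *\<^sub>R (x - Y x - (Y x - Y (Y x)))" using M(1) by simp
    also have "x - Y x - (Y x - Y (Y x)) = (1 / M) *\<^sub>R B x"
      by (simp add: YY A0_def scaleR_2)
    also have "M *\<^sub>R \<dots> = B x" using M(1) by simp
    finally show "(S \<circ> S) x = B x" by simp
  qed
  moreover have "\<exists>d>0. \<forall>u. d * (norm u)\<^sup>2 \<le> S u \<bullet> u"
  proof (intro exI[of _ "sqrt M * (1 - r)"] conjI allI)
    show "sqrt M * (1 - r) > 0" using M(1) r by simp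
    fix u :: 'a
    have "Y u \<bullet> u \<le> norm (Y u) * norm u" by (rule norm_cauchy_schwarz)
    also have "\<dots> \<le> (norm Y * norm u) * norm u" by (intro mult_right_mono norm_blinfun) simp
    also have "\<dots> \<le> (r * norm u) * norm u" by (intro mult_right_mono K_norm Y(1) norm_ge_zero)
    finally have "(1 - r) * (norm u)\<^sup>2 \<le> (u - Y u) \<bullet> u"
      by (simp add: inner_diff_left power2_norm_eq_inner[symmetric] power2_eq_square algebra_simps)
    then show "sqrt M * (1 - r) * (norm u)\<^sup>2 \<le> S u \<bullet> u"
      using M(1) by (simp add: S_def mult.assoc)
  qed
  moreover have "T \<circ> S = S \<circ> T" if T: "bounded_linear T" "T \<circ> B = B \<circ> T" for T
  proof -
    interpret T: bounded_linear T by (rule T)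
    have bT: "blinfun_apply (Blinfun T) = T" by (rule bounded_linear_Blinfun_apply[OF T(1)])
    have TB: "T (B x) = B (T x)" for x using fun_cong[OF T(2), of x] by simp
    have "Blinfun T o\<^sub>L A = A o\<^sub>L Blinfun T"
      by (rule blinfun_eqI) (simp add: bT A A0_def T.diff T.scaleR TB)
    from arg_cong[OF K_com[OF Y(1) this], of "\<lambda>X. blinfun_apply X x" for x]
    have "T (Y x) = Y (T x)" for x by (simp add: bT)
    then show ?thesis by (auto simp: S_def fun_eq_iff T.diff T.scaleR)
  qed
  ultimately show ?thesis by blast
qed

text \<open>For uniqueness, a root T commutes with T o T = B, hence with S. With y = S x - T x this
  gives (S + T) y = S^2 x - T^2 x = 0, so <S y, y> + <T y, y> = 0, and coercivity of S forces y =
  0.\<close>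

lemma op_sqrt_ex1:
  fixes B :: "'a::{real_inner, banach} \<Rightarrow> 'a"
  assumes bl: "bounded_linear B" and sym: "sym_op B" and coer: "coercive_op B"
  shows "\<exists>!S. bounded_linear S \<and> sym_op S \<and> nonneg_op S \<and> S \<circ> S = B"
proof -
  obtain S d where S: "bounded_linear S" "sym_op S" "S \<circ> S = B"
    and d: "d > 0" "\<And>u. d * (norm u)\<^sup>2 \<le> S u \<bullet> u"
    and com: "\<And>T. bounded_linear T \<Longrightarrow> T \<circ> B = B \<circ> T \<Longrightarrow> T \<circ> S = S \<circ> T"
    using coercive_sqrt_exists[OF assms] by metis
  interpret S: bounded_linear S by (rule S)
  have "nonneg_op S"
    unfolding nonneg_op_def
  proof
    fix u :: 'a
    have "0 \<le> d * (norm u)\<^sup>2" using d(1) by simp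
    then show "0 \<le> S u \<bullet> u" using d(2)[of u] by linarith
  qed
  moreover have "T = S" if T: "bounded_linear T" "sym_op T" "nonneg_op T" "T \<circ> T = B" for T
  proof
    fix x
    interpret T: bounded_linear T by (rule T)
    have "T \<circ> S = S \<circ> T" by (rule com[OF T(1)]) (simp only: T(4)[symmetric] o_assoc)
    then have TS: "T (S y) = S (T y)" for y by (metis comp_apply)
    have TT: "T (T y) = S (S y)" for y by (metis S(3) T(4) comp_apply)
    define y where "y = S x - T x"
    have "S y + T y = 0" by (simp add: y_def S.diff T.diff TS TT)
    then have "S y \<bullet> y + T y \<bullet> y = 0" by (metis inner_add_left inner_zero_left)
    then have "d * (norm y)\<^sup>2 \<le> 0" using d(2)[of y] T(3) unfolding nonneg_op_def by (smt (verit))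
    then have "y = 0" using d(1) by (simp add: mult_le_0_iff)
    then show "T x = S x" by (simp add: y_def)
  qed
  ultimately show ?thesis using S by blast
qed

lemma op_sqrt_properties:
  fixes B :: "'a::{real_inner, banach} \<Rightarrow> 'a"
  assumes "bounded_linear B" "sym_op B" "coercive_op B"
  shows "bounded_linear (op_sqrt B)" "sym_op (op_sqrt B)" "nonneg_op (op_sqrt B)"
    "op_sqrt B \<circ> op_sqrt B = B"
  using theI'[OF op_sqrt_ex1[OF assms]] unfolding op_sqrt_def by auto

section \<open>Calculus on the half line\<close>

lemma has_real_derivative_nonneg_imp_le:
  fixes g :: "real \<Rightarrow> real"
  assumes "a \<le> b" "0 \<le> a"
    and der: "\<And>t. a \<le> t \<Longrightarrow> t \<le> b \<Longrightarrow> (g has_real_derivative g' t) (at t within {0..})"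
    and nonneg: "\<And>t. a \<le> t \<Longrightarrow> t \<le> b \<Longrightarrow> 0 \<le> g' t"
  shows "g a \<le> g b"
proof -
  have "\<exists>x\<in>{a..b}. g b - g a = g' x * (b - a)"
  proof (rule mvt_very_simple[OF \<open>a \<le> b\<close>])
    fix x assume "a \<le> x" "x \<le> b"
    then show "(g has_derivative (*) (g' x)) (at x within {a..b})"
      using der[of x] has_derivative_subset[of g "(*) (g' x)" x "{0..}" "{a..b}"] \<open>0 \<le> a\<close>
      by (auto simp: has_field_derivative_def)
  qed
  then obtain x where "x \<in> {a..b}" "g b - g a = g' x * (b - a)" by auto
  then show ?thesis using nonneg[of x] \<open>a \<le> b\<close> by (smt (verit) atLeastAtMost_iff mult_nonneg_nonneg)
qed

lemma has_real_derivative_nonpos_imp_ge: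
  fixes g :: "real \<Rightarrow> real"
  assumes "a \<le> b" "0 \<le> a"
    and "\<And>t. a \<le> t \<Longrightarrow> t \<le> b \<Longrightarrow> (g has_real_derivative g' t) (at t within {0..})"
    and "\<And>t. a \<le> t \<Longrightarrow> t \<le> b \<Longrightarrow> g' t \<le> 0"
  shows "g b \<le> g a"
  using has_real_derivative_nonneg_imp_le[of a b "\<lambda>t. - g t" "\<lambda>t. - g' t"] assms
  by (auto intro: DERIV_minus)

text \<open>g(t) exp(-K t) is nonincreasing. K may have either sign: positive values serve
  uniqueness, negative ones give decay rates.\<close>

lemma has_real_derivative_Gronwall_le:
  fixes g :: "real \<Rightarrow> real"
  assumes "a \<le> b" "0 \<le> a"
    and der: "\<And>t. a \<le> t \<Longrightarrow> t \<le> b \<Longrightarrow> (g has_real_derivative g' t) (at t within {0..})"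
    and le: "\<And>t. a \<le> t \<Longrightarrow> t \<le> b \<Longrightarrow> g' t \<le> K * g t"
  shows "g b \<le> g a * exp (K * (b - a))"
proof -
  have "g b * exp (- K * b) \<le> g a * exp (- K * a)"
  proof (rule has_real_derivative_nonpos_imp_ge[OF assms(1,2)])
    fix t assume t: "a \<le> t" "t \<le> b"
    show "((\<lambda>t. g t * exp (- K * t)) has_real_derivative (g' t - K * g t) * exp (- K * t)) (at t within {0..})"
      by (auto intro!: derivative_eq_intros der t simp: algebra_simps)
    show "(g' t - K * g t) * exp (- K * t) \<le> 0"
      using le[OF t] by (simp add: mult_nonpos_nonneg)
  qed
  then have "g b * exp (- K * b) * exp (K * b) \<le> g a * exp (- K * a) * exp (K * b)"
    by (rule mult_right_mono) simp
  then show ?thesis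
    by (simp add: mult.assoc algebra_simps flip: exp_add)
qed

lemma has_real_derivative_Gronwall_ge:
  fixes g :: "real \<Rightarrow> real"
  assumes "a \<le> b" "0 \<le> a"
    and "\<And>t. a \<le> t \<Longrightarrow> t \<le> b \<Longrightarrow> (g has_real_derivative g' t) (at t within {0..})"
    and "\<And>t. a \<le> t \<Longrightarrow> t \<le> b \<Longrightarrow> K * g t \<le> g' t"
  shows "g a * exp (K * (b - a)) \<le> g b"
  using has_real_derivative_Gronwall_le[of a b "\<lambda>t. - g t" "\<lambda>t. - g' t" K] assms
  by (auto intro: DERIV_minus)

lemma exp_neg_tendsto_0:
  fixes k :: real
  assumes "0 < k"
  shows "((\<lambda>t. C * exp (- k * t)) \<longlongrightarrow> 0) at_top"
proof -
  have "LIM t at_top. (- k) * t :> at_bot"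
    using assms by (intro filterlim_tendsto_neg_mult_at_bot[OF tendsto_const] filterlim_ident) auto
  then have "((\<lambda>t. exp (- k * t)) \<longlongrightarrow> 0) at_top"
    by (rule filterlim_compose[OF exp_at_bot])
  then show ?thesis by (rule tendsto_mult_right_zero)
qed

text \<open>Increments of g are dominated by those of the convergent function -C/k exp(-k t), whose
  tail is the rate. For fast solutions this is applied to u + z and to exp(t) z.\<close>

lemma exp_decay_has_limit:
  fixes g :: "real \<Rightarrow> 'a::{real_normed_vector, complete_space}"
  assumes "0 \<le> a" "0 < k"
    and der: "\<And>t. a \<le> t \<Longrightarrow> (g has_vector_derivative g' t) (at t within {0..})"
    and le: "\<And>t. a \<le> t \<Longrightarrow> norm (g' t) \<le> C * exp (- k * t)"
  obtains l where "(g \<longlongrightarrow> l) at_top" "\<And>t. a \<le> t \<Longrightarrow> norm (g t - l) \<le> C / k * exp (- k * t)"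
proof -
  have C: "0 \<le> C"
  proof -
    have "0 \<le> C * exp (- k * a)" using le[of a] norm_ge_zero[of "g' a"] by linarith
    then show ?thesis by (simp add: zero_le_mult_iff)
  qed
  have diff: "norm (g s - g t) \<le> C / k * exp (- k * t)" if ts: "a \<le> t" "t \<le> s" for s t
  proof (cases "t = s")
    case False
    then have ts': "t < s" using ts by simp
    have "norm (g s - g t) \<le> (- C / k * exp (- k * s)) - (- C / k * exp (- k * t))"
    proof (rule differentiable_bound_general[OF ts'])
      show "continuous_on {t..s} g"
        unfolding continuous_on_eq_continuous_within
      proof
        fix x assume x: "x \<in> {t..s}"
        then have "continuous (at x within {0..}) g"
          using der[of x] ts by (auto intro: has_vector_derivative_continuous)
        then show "continuous (at x within {t..s}) g"
          by (rule continuous_within_subset) (use ts \<open>0 \<le> a\<close> in auto)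
      qed
      show "continuous_on {t..s} (\<lambda>s. - C / k * exp (- k * s))"
        by (intro continuous_intros)
      fix x assume x: "t < x" "x < s"
      then have "at x within {0..} = at x"
        by (intro at_within_interior) (use ts \<open>0 \<le> a\<close> in auto)
      then show "(g has_vector_derivative g' x) (at x)"
        using der[of x] x ts by simp
      show "((\<lambda>s. - C / k * exp (- k * s)) has_vector_derivative C * exp (- k * x)) (at x)"
        unfolding has_real_derivative_iff_has_vector_derivative[symmetric]
        using \<open>0 < k\<close> by (auto intro!: derivative_eq_intros)
      show "norm (g' x) \<le> C * exp (- k * x)" using le x ts by simp
    qed
    also have "\<dots> \<le> C / k * exp (- k * t)" using C \<open>0 < k\<close> by simp
    finally show ?thesis .
  qed (use C \<open>0 < k\<close> in simp)
  have lim0: "((\<lambda>t. C / k * exp (- k * t)) \<longlongrightarrow> 0) at_top"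
    by (rule exp_neg_tendsto_0[OF \<open>0 < k\<close>])
  have "Cauchy (\<lambda>n. g (a + real n))"
  proof (rule metric_CauchyI)
    fix e :: real assume "0 < e"
    then have "\<forall>\<^sub>F t in at_top. C / k * exp (- k * t) < e"
      using order_tendstoD(2)[OF lim0] by blast
    then obtain T where T: "\<And>t. T \<le> t \<Longrightarrow> C / k * exp (- k * t) < e"
      unfolding eventually_at_top_linorder by blast
    obtain N :: nat where N: "T - a \<le> real N" using real_arch_simple by blast
    have *: "dist (g (a + real m)) (g (a + real n)) < e" if "N \<le> n" "n \<le> m" for m n
      using diff[of "a + real n" "a + real m"] T[of "a + real n"] that N by (simp add: dist_norm)
    show "\<exists>M. \<forall>m\<ge>M. \<forall>n\<ge>M. dist (g (a + real m)) (g (a + real n)) < e"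
      by (rule exI[of _ N]) (metis * dist_commute linorder_le_cases)
  qed
  then obtain l where l: "(\<lambda>n. g (a + real n)) \<longlonglongrightarrow> l"
    using Cauchy_convergent_iff convergent_def by blast
  have rate: "norm (g t - l) \<le> C / k * exp (- k * t)" if t: "a \<le> t" for t
  proof (rule tendsto_upperbound)
    show "(\<lambda>n. norm (g t - g (a + real n))) \<longlonglongrightarrow> norm (g t - l)"
      by (intro tendsto_intros l)
    obtain N :: nat where N: "t - a \<le> real N" using real_arch_simple by blast
    show "\<forall>\<^sub>F n in sequentially. norm (g t - g (a + real n)) \<le> C / k * exp (- k * t)"
      using eventually_ge_at_top[of N]
      by eventually_elim (subst norm_minus_commute, rule diff, use t N in auto)
  qed simp
  moreover have "(g \<longlongrightarrow> l) at_top"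
  proof (rule Lim_null[THEN iffD2], rule Lim_null_comparison[OF _ lim0])
    show "\<forall>\<^sub>F t in at_top. norm (g t - l) \<le> C / k * exp (- k * t)"
      using eventually_ge_at_top[of a] by eventually_elim (rule rate)
  qed
  ultimately show thesis by (rule that[rotated])
qed

text \<open>For p > 1 the power stays differentiable at 0, because the difference quotient is at
  most |h|^(p - 1) in modulus. This allows the energy to be differentiated at times when u
  vanishes.\<close>

lemma has_real_derivative_abs_powr:
  fixes p :: real
  assumes "1 < p"
  shows "((\<lambda>x. \<bar>x\<bar> powr p) has_real_derivative p * \<bar>x\<bar> powr (p - 1) * sgn x) (at x within S)"
proof (rule has_field_derivative_at_within)
  consider "x > 0" | "x < 0" | "x = 0" by linarith
  then show "((\<lambda>x. \<bar>x\<bar> powr p) has_real_derivative p * \<bar>x\<bar> powr (p - 1) * sgn x) (at x)"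
  proof cases
    case 1
    have "((\<lambda>x. x powr p) has_real_derivative p * \<bar>x\<bar> powr (p - 1) * sgn x) (at x)"
      using 1 by (auto intro!: derivative_eq_intros)
    then show ?thesis
      by (rule has_field_derivative_transform_within_open[of _ _ _ "{0<..}"]) (use 1 in auto)
  next
    case 2
    have "((\<lambda>x. (- x) powr p) has_real_derivative p * \<bar>x\<bar> powr (p - 1) * sgn x) (at x)"
      using 2 by (auto intro!: derivative_eq_intros)
    then show ?thesis
      by (rule has_field_derivative_transform_within_open[of _ _ _ "{..<0}"]) (use 2 in auto)
  next
    case 3
    have "((\<lambda>h. \<bar>h\<bar> powr (p - 1)) \<longlongrightarrow> 0) (at (0::real))"
    proof -
      have "((\<lambda>h. \<bar>h\<bar> powr (p - 1)) \<longlongrightarrow> \<bar>0::real\<bar> powr (p - 1)) (at (0::real))"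
        using assms by (intro tendsto_powr' tendsto_intros) auto
      then show ?thesis by simp
    qed
    then have "((\<lambda>h. \<bar>h\<bar> powr p / h) \<longlongrightarrow> 0) (at (0::real))"
    proof (rule Lim_null_comparison[rotated])
      show "\<forall>\<^sub>F h in at (0::real). norm (\<bar>h\<bar> powr p / h) \<le> \<bar>h\<bar> powr (p - 1)"
        by (rule always_eventually) (auto simp: powr_diff divide_simps)
    qed
    then show ?thesis using 3 assms by (simp add: DERIV_def)
  qed
qed

section \<open>Global Lipschitz equations\<close>

lemma Lipschitz_ode_exists:
  fixes F :: "'b::banach \<Rightarrow> 'b"
  assumes lip: "\<And>x y. norm (F x - F y) \<le> L * norm (x - y)" and "0 < L"
  shows "\<exists>x. x 0 = x0 \<and> (\<forall>t\<ge>0. (x has_vector_derivative F (x t)) (at t within {0..}))"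
proof -
  \<comment> \<open>With the weight \<open>exp (2 L t)\<close> the Picard map is a contraction on the whole half line.\<close>
  have lipF: "continuous_on UNIV F"
    by (rule lipschitz_on_continuous_on[of L])
      (use lip \<open>0 < L\<close> in \<open>auto simp: lipschitz_on_def dist_norm\<close>)
  \<comment> \<open>The unknown is w(t) = exp(-2 L t) x(t), which stays bounded; \<open>G w\<close>
    is F along the unweighted curve.\<close>
  define G :: "(real \<Rightarrow>\<^sub>C 'b) \<Rightarrow> real \<Rightarrow> 'b" where "G w s = F (exp (2 * L * s) *\<^sub>R w s)" for w s
  \<comment> \<open>\<open>max 0 t\<close> freezes the value at negative times, so that the map acts
    on bounded continuous functions on the whole line.\<close>
  define \<Psi> where "\<Psi> w t = exp (- 2 * L * max 0 t) *\<^sub>R (x0 + integral {0..max 0 t} (G w))" for w t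
  have contG: "continuous_on A (G w)" for A w
    unfolding G_def by (rule continuous_on_compose2[OF lipF]) (auto intro!: continuous_intros)
  have intG: "G w integrable_on {0..t}" for w t
    by (rule integrable_continuous_real[OF contG])
  \<comment> \<open>The weight with 2 L instead of L is what produces the contraction factor
    1/2.\<close>
  have int_exp: "((\<lambda>s. L * exp (2 * L * s)) has_integral (exp (2 * L * t) - 1) / 2) {0..t}" if "0 \<le> t" for t
  proof -
    have "((\<lambda>s. L * exp (2 * L * s)) has_integral exp (2 * L * t) / 2 - exp (2 * L * 0) / 2) {0..t}"
      by (rule fundamental_theorem_of_calculus[OF that])
        (auto intro!: derivative_eq_intros simp flip: has_real_derivative_iff_has_vector_derivative)
    then show ?thesis by (simp add: diff_divide_distrib)
  qed
  have G_diff: "norm (G w s - G v s) \<le> L * exp (2 * L * s) * dist w v" for w v s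
  proof -
    have "norm (G w s - G v s) \<le> L * norm (exp (2 * L * s) *\<^sub>R (w s - v s))"
      using lip[of "exp (2 * L * s) *\<^sub>R w s" "exp (2 * L * s) *\<^sub>R v s"]
      by (simp add: G_def scaleR_diff_right)
    also have "\<dots> = L * exp (2 * L * s) * dist (w s) (v s)" by (simp add: dist_norm)
    also have "\<dots> \<le> L * exp (2 * L * s) * dist w v"
      using \<open>0 < L\<close> by (intro mult_left_mono dist_bounded) auto
    finally show ?thesis .
  qed
  have diff: "norm (\<Psi> w t - \<Psi> v t) \<le> (1/2) * dist w v" for w v t
  proof -
    define s where "s = max 0 t"
    have s: "0 \<le> s" by (simp add: s_def)
    have "norm (integral {0..s} (G w) - integral {0..s} (G v)) = norm (integral {0..s} (\<lambda>r. G w r - G v r))"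
      by (simp add: Henstock_Kurzweil_Integration.integral_diff[OF intG intG])
    also have "\<dots> \<le> integral {0..s} (\<lambda>r. L * exp (2 * L * r) * dist w v)"
      by (intro integral_norm_bound_integral integrable_diff intG G_diff
          integrable_continuous_real continuous_intros)
    also have "\<dots> = (exp (2 * L * s) - 1) / 2 * dist w v"
      by (rule integral_unique, rule has_integral_mult_left, rule int_exp[OF s])
    also have "\<dots> \<le> exp (2 * L * s) / 2 * dist w v"
      by (intro mult_right_mono) auto
    finally have *: "norm (integral {0..s} (G w) - integral {0..s} (G v)) \<le> exp (2 * L * s) / 2 * dist w v" .
    have "norm (\<Psi> w t - \<Psi> v t) = exp (- 2 * L * s) * norm (integral {0..s} (G w) - integral {0..s} (G v))"
      by (simp add: \<Psi>_def s_def[symmetric] flip: scaleR_diff_right)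
    also have "\<dots> \<le> exp (- 2 * L * s) * (exp (2 * L * s) / 2 * dist w v)"
      by (intro mult_left_mono *) simp
    also have "\<dots> = (1/2) * dist w v" by (simp add: exp_minus field_simps)
    finally show ?thesis .
  qed
  have cont\<Psi>: "continuous_on UNIV (\<Psi> w)" for w
  proof -
    have "continuous_on UNIV (\<lambda>t. integral {0..max 0 t} (G w))"
    proof (rule continuous_at_imp_continuous_on, rule ballI)
      fix t :: real
      have "continuous_on {0..\<bar>t\<bar> + 1} (\<lambda>t. integral {0..t} (G w))"
        by (rule indefinite_integral_continuous_1[OF intG])
      then have "continuous_on {..\<bar>t\<bar> + 1} (\<lambda>t. integral {0..max 0 t} (G w))"
        by (rule continuous_on_compose2) (auto intro!: continuous_intros)
      then show "continuous (at t) (\<lambda>t. integral {0..max 0 t} (G w))"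
        by (rule continuous_on_interior) auto
    qed
    then show ?thesis unfolding \<Psi>_def by (intro continuous_intros)
  qed
  have bdd: "\<exists>b. \<forall>t. norm (\<Psi> w t) \<le> b" for w
  proof (intro exI allI)
    fix t :: real
    define s where "s = max 0 t"
    have s: "0 \<le> s" by (simp add: s_def)
    have e: "exp (- 2 * L * s) \<le> 1" using s \<open>0 < L\<close> by simp
    \<comment> \<open>Boundedness is checked by hand only at w = 0, where the integrand is the
      constant F 0 and the weight beats linear growth; \<open>diff\<close> carries it over to every
      w.\<close>
    have G0: "G 0 r = F 0" for r by (simp add: G_def)
    have "2 * L * s \<le> exp (2 * L * s)"
      using exp_ge_add_one_self[of "2 * L * s"] by linarith
    then have es: "exp (- 2 * L * s) * s \<le> 1 / (2 * L)"
      using \<open>0 < L\<close> by (simp add: exp_minus field_simps)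
    have "norm (\<Psi> 0 t) = exp (- 2 * L * s) * norm (x0 + s *\<^sub>R F 0)"
      using s by (simp add: \<Psi>_def s_def[symmetric] G0[abs_def])
    also have "\<dots> \<le> exp (- 2 * L * s) * (norm x0 + s * norm (F 0))"
      by (intro mult_left_mono order_trans[OF norm_triangle_ineq]) (use s in auto)
    also have "\<dots> = exp (- 2 * L * s) * norm x0 + (exp (- 2 * L * s) * s) * norm (F 0)"
      by (simp add: algebra_simps)
    also have "\<dots> \<le> 1 * norm x0 + 1 / (2 * L) * norm (F 0)"
      by (intro add_mono mult_right_mono e es) auto
    finally show "norm (\<Psi> w t) \<le> (1/2) * dist w 0 + (norm x0 + 1 / (2 * L) * norm (F 0))"
      using diff[of w t 0] norm_triangle_sub[of "\<Psi> w t" "\<Psi> 0 t"] by linarith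
  qed
  define \<Phi> where "\<Phi> w = Bcontfun (\<Psi> w)" for w
  have \<Phi>: "apply_bcontfun (\<Phi> w) = \<Psi> w" for w
    unfolding \<Phi>_def using bdd[of w] cont\<Psi>[of w]
    by (intro Bcontfun_inverse) (auto intro: bcontfun_normI)
  have "\<exists>!w. \<Phi> w = w"
  proof (rule banach_fix_type[of "1/2"])
    show "\<forall>w v. dist (\<Phi> w) (\<Phi> v) \<le> 1 / 2 * dist w v"
      by (intro allI dist_bound) (simp only: \<Phi> dist_norm[where 'a='b] diff)
  qed auto
  then obtain w where "\<Phi> w = w" by auto
  then have w: "w t = \<Psi> w t" for t using \<Phi>[of w] by simp
  define x where "x t = x0 + integral {0..t} (G w)" for t
  have Gx: "G w t = F (x t)" if "0 \<le> t" for t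
    unfolding G_def by (subst w) (use that in \<open>simp add: \<Psi>_def x_def exp_minus\<close>)
  have "(x has_vector_derivative F (x t)) (at t within {0..})" if t: "0 \<le> t" for t
  proof -
    have "((\<lambda>t. integral {0..t} (G w)) has_vector_derivative G w t) (at t within {0..t+1})"
      by (rule integral_has_vector_derivative[OF contG]) (use t in auto)
    moreover have "at t within {0..t+1} = at t within {0..}"
      by (rule at_within_nhd[of _ "{..<t+1}"]) auto
    ultimately show ?thesis
      unfolding Gx[OF t, symmetric] unfolding x_def[abs_def] by (auto intro!: derivative_eq_intros)
  qed
  then show ?thesis by (intro exI[of _ x]) (simp add: x_def)
qed

section \<open>The nonlinearity and the energy\<close>

lemma inner_has_real_derivative:
  fixes a b :: "real \<Rightarrow> 'a::real_inner"
  assumes "(a has_vector_derivative a') (at t within A)" "(b has_vector_derivative b') (at t within A)"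
  shows "((\<lambda>t. a t \<bullet> b t) has_real_derivative a t \<bullet> b' + a' \<bullet> b t) (at t within A)"
  unfolding has_real_derivative_iff_has_vector_derivative
  by (rule bounded_bilinear.has_vector_derivative[OF bounded_bilinear_inner assms])

lemma norm_sq_has_real_derivative:
  fixes a :: "real \<Rightarrow> 'a::real_inner"
  assumes "(a has_vector_derivative a') (at t within A)"
  shows "((\<lambda>t. (norm (a t))\<^sup>2) has_real_derivative 2 * (a t \<bullet> a')) (at t within A)"
  using inner_has_real_derivative[OF assms assms]
  by (simp add: power2_norm_eq_inner inner_commute)

section \<open>Truncation of the power nonlinearity\<close>

lemma powr_double: "0 \<le> (n::real) \<Longrightarrow> n powr (2 * b) = (n\<^sup>2) powr b"
  by (cases "n = 0") (auto simp: powr_powr simp flip: powr_numeral)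

text \<open>For y > 0 and r = y / x this is (1 - r^p) r <= p (1 - r), which follows from 1 + s <=
  exp s and ln s <= s - 1. The factor y compensates the blow-up at 0 of the derivative of the power
  when p < 1.\<close>

lemma powr_diff_mult_le:
  fixes x y p :: real
  assumes "0 \<le> y" "y \<le> x" "0 < p"
  shows "(x powr p - y powr p) * y \<le> p * x powr p * (x - y)"
proof (cases "y = 0")
  case False
  then have y: "0 < y" "0 < x" using assms by auto
  define r where "r = y / x"
  have r: "0 < r" "y = r * x" using y by (auto simp: r_def)
  have "1 - r powr p = 1 - exp (p * ln r)" using r by (simp add: powr_def)
  also have "\<dots> \<le> p * ln (1 / r)"
  proof -
    have "p * ln (1 / r) = - (p * ln r)" using r by (simp add: ln_div)
    then show ?thesis using exp_ge_add_one_self[of "p * ln r"] by linarith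
  qed
  also have "\<dots> \<le> p * (1 / r - 1)"
    using ln_le_minus_one[of "1 / r"] r \<open>0 < p\<close> by (intro mult_left_mono) auto
  finally have "(1 - r powr p) * r \<le> p * (1 / r - 1) * r"
    using r by (intro mult_right_mono) auto
  also have "\<dots> = p * (1 - r)" using r by (simp add: field_simps)
  finally have "x powr p * x * ((1 - r powr p) * r) \<le> x powr p * x * (p * (1 - r))"
    using y by (intro mult_left_mono) auto
  then show ?thesis using r y by (simp add: powr_mult algebra_simps)
qed (use assms in auto)

text \<open>Only the scalar factor is cut off: the field is |x|^p x inside the ball of radius R and
  R^p x outside, hence globally Lipschitz.\<close>

definition trunc_power :: "real \<Rightarrow> real \<Rightarrow> 'a::real_normed_vector \<Rightarrow> 'a" where
  "trunc_power R p x = (min (norm x) R) powr p *\<^sub>R x"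

text \<open>Let X >= Y be the truncated norms. The difference is X^p (x - y) + (X^p - Y^p) y. The
  first term costs R^p; the second costs p R^p by \<open>powr_diff_mult_le\<close>, and it vanishes
  when |y| >= R.\<close>

lemma trunc_power_Lipschitz:
  fixes x y :: "'a::real_normed_vector"
  assumes "0 < R" "0 < p"
  shows "norm (trunc_power R p x - trunc_power R p y) \<le> (1 + p) * R powr p * norm (x - y)"
proof -
  have *: "norm (trunc_power R p x - trunc_power R p y) \<le> (1 + p) * R powr p * norm (x - y)"
    if xy: "norm y \<le> norm x" for x y :: 'a
  proof -
    define X Y where "X = min (norm x) R" and "Y = min (norm y) R"
    have XY: "0 \<le> Y" "Y \<le> X" "X \<le> R" using xy assms by (auto simp: X_def Y_def)
    have XR: "X powr p \<le> R powr p" using XY assms by (intro powr_mono2) auto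
    have YX: "Y powr p \<le> X powr p" using XY assms by (intro powr_mono2) auto
    have "(X powr p - Y powr p) * norm y \<le> p * R powr p * norm (x - y)"
    proof (cases "R \<le> norm y")
      case True
      then show ?thesis using xy assms by (simp add: X_def Y_def)
    next
      case False
      then have Y: "Y = norm y" by (simp add: Y_def)
      have "(X powr p - Y powr p) * Y \<le> p * X powr p * (X - Y)"
        by (rule powr_diff_mult_le) (use XY assms in auto)
      also have "\<dots> \<le> p * R powr p * norm (x - y)"
      proof (intro mult_mono XR)
        have "X - Y \<le> norm x - norm y" by (simp add: Y X_def)
        also have "\<dots> \<le> norm (x - y)" by (rule norm_triangle_ineq2)
        finally show "X - Y \<le> norm (x - y)" .
      qed (use assms XY in auto)
      finally show ?thesis by (simp add: Y)
    qed
    moreover have "trunc_power R p x - trunc_power R p y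
        = X powr p *\<^sub>R (x - y) + (X powr p - Y powr p) *\<^sub>R y"
      by (simp add: trunc_power_def X_def Y_def algebra_simps)
    then have "norm (trunc_power R p x - trunc_power R p y)
        \<le> X powr p * norm (x - y) + (X powr p - Y powr p) * norm y"
      using YX norm_triangle_ineq[of "X powr p *\<^sub>R (x - y)" "(X powr p - Y powr p) *\<^sub>R y"] by simp
    moreover have "X powr p * norm (x - y) \<le> R powr p * norm (x - y)"
      by (intro mult_right_mono XR) simp
    ultimately show ?thesis by (simp add: algebra_simps)
  qed
  show ?thesis
    using *[of x y] *[of y x] by (cases "norm y \<le> norm x") (auto simp: norm_minus_commute)
qed

lemma inner_le_mean_squares: "x \<bullet> y \<le> ((norm x)\<^sup>2 + (norm y)\<^sup>2) / 2"
proof -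
  have "0 \<le> (norm (x - y))\<^sup>2" by simp
  then show ?thesis by (simp add: power2_norm_eq_inner inner_diff_left inner_diff_right inner_commute)
qed

text \<open>\<open>S\<close> stands for B^(1/2), so S o S is the operator of the equation.
  \<open>coer_S\<close> is the coercivity of B, with c the square root of its constant, since |S
  x|^2 = <B x, x>.\<close>

locale damped_wave =
  fixes S :: "'a::{real_inner, banach} \<Rightarrow> 'a" and \<alpha> c M :: real
  assumes bl_S: "bounded_linear S"
    and sym_S: "S x \<bullet> y = x \<bullet> S y"
    and c_pos: "0 < c" and coer_S: "c * norm x \<le> norm (S x)"
    and M_pos: "0 < M" and bound_S: "norm (S x) \<le> M * norm x"
    and \<alpha>_pos: "0 < \<alpha>"
begin

sublocale S: bounded_linear S by (rule bl_S)

definition f :: "'a \<Rightarrow> 'a" where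
  "f u = norm (S u) powr (2 * \<alpha>) *\<^sub>R S (S u)"

text \<open>The truncation sits between the two copies of S, so it is inactive exactly where |S u|
  <= R, and |S u| is the quantity that the energy controls.\<close>

definition f_trunc :: "real \<Rightarrow> 'a \<Rightarrow> 'a" where
  "f_trunc R u = S (trunc_power R (2 * \<alpha>) (S u))"

definition Lip :: "real \<Rightarrow> real" where
  "Lip R = M\<^sup>2 * ((1 + 2 * \<alpha>) * R powr (2 * \<alpha>))"

lemma Lip_nonneg: "0 \<le> Lip R"
  using \<alpha>_pos by (simp add: Lip_def)

lemma f_trunc_Lipschitz: "0 < R \<Longrightarrow> norm (f_trunc R u - f_trunc R v) \<le> Lip R * norm (u - v)"
proof -
  assume R: "0 < R"
  let ?h = "trunc_power R (2 * \<alpha>)"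
  have "norm (f_trunc R u - f_trunc R v) = norm (S (?h (S u) - ?h (S v)))"
    by (simp add: f_trunc_def S.diff)
  also have "\<dots> \<le> M * norm (?h (S u) - ?h (S v))" by (rule bound_S)
  also have "\<dots> \<le> M * ((1 + 2 * \<alpha>) * R powr (2 * \<alpha>) * norm (S u - S v))"
    using trunc_power_Lipschitz[OF R, of "2 * \<alpha>" "S u" "S v"] \<alpha>_pos M_pos by (intro mult_left_mono) auto
  also have "\<dots> \<le> M * ((1 + 2 * \<alpha>) * R powr (2 * \<alpha>) * (M * norm (u - v)))"
    using bound_S[of "u - v"] \<alpha>_pos M_pos by (intro mult_left_mono) (auto simp: S.diff)
  finally show ?thesis by (simp add: Lip_def power2_eq_square algebra_simps)
qed

lemma f_trunc_eq: "norm (S u) \<le> R \<Longrightarrow> f_trunc R u = f u"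
  by (simp add: f_trunc_def f_def trunc_power_def S.scaleR)

lemma f_Lipschitz:
  "0 < R \<Longrightarrow> norm (S u) \<le> R \<Longrightarrow> norm (S v) \<le> R \<Longrightarrow> norm (f u - f v) \<le> Lip R * norm (u - v)"
  using f_trunc_Lipschitz[of R u v] by (simp add: f_trunc_eq)

lemma f_0 [simp]: "f 0 = 0" by (simp add: f_def S.zero)

lemma f_scaleR: "0 \<le> k \<Longrightarrow> f (k *\<^sub>R u) = k powr (2 * \<alpha> + 1) *\<^sub>R f u"
  by (cases "k = 0") (auto simp: f_def S.scaleR powr_mult powr_add S.zero)

lemma inner_f: "f u \<bullet> v = norm (S u) powr (2 * \<alpha>) * (S u \<bullet> S v)"
  by (simp add: f_def sym_S)

lemma inner_f_self: "u \<bullet> f u = norm (S u) powr (2 * \<alpha> + 2)"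
  by (cases "S u = 0")
    (auto simp: inner_commute[of u] inner_f powr_add power2_norm_eq_inner[symmetric])

lemma norm_f_le: "norm (f u) \<le> norm (S u) powr (2 * \<alpha>) * M\<^sup>2 * norm u"
proof -
  have "norm (S (S u)) \<le> M * (M * norm u)"
    using bound_S[of "S u"] bound_S[of u] M_pos by (meson mult_left_mono less_imp_le order_trans)
  then have "norm (S u) powr (2 * \<alpha>) * norm (S (S u)) \<le> norm (S u) powr (2 * \<alpha>) * (M * (M * norm u))"
    by (intro mult_left_mono) auto
  then show ?thesis by (simp add: f_def power2_eq_square mult_ac)
qed

lemma continuous_on_f: "continuous_on A f"
proof -
  have "continuous_on A (\<lambda>u. norm (S u) powr (2 * \<alpha>))"
    using \<alpha>_pos by (intro continuous_on_powr' continuous_intros S.continuous_on) auto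
  then show ?thesis
    unfolding f_def[abs_def] by (intro continuous_on_scaleR S.continuous_on continuous_on_id)
qed

text \<open>The second summand is the potential whose gradient is \<open>f\<close>.\<close>

definition E :: "'a \<Rightarrow> 'a \<Rightarrow> real" where
  "E u z = (norm z)\<^sup>2 / 2 + norm (S u) powr (2 * \<alpha> + 2) / (2 * \<alpha> + 2)"

definition sol :: "(real \<Rightarrow> 'a) \<Rightarrow> (real \<Rightarrow> 'a) \<Rightarrow> bool" where
  "sol u z \<longleftrightarrow> (\<forall>t\<ge>0. (u has_vector_derivative z t) (at t within {0..}) \<and>
     (z has_vector_derivative - z t - f (u t)) (at t within {0..}))"

lemma solD:
  assumes "sol u z" "0 \<le> t"
  shows "(u has_vector_derivative z t) (at t within {0..})"
    "(z has_vector_derivative - z t - f (u t)) (at t within {0..})"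
  using assms by (auto simp: sol_def)

text \<open>Reading |S u|^(2\<alpha> + 2) as the power \<alpha> + 1 > 1 of the differentiable |S
  u|^2 covers zeros of S u as well. z' is left free so that the formula also serves the truncated
  equation.\<close>

lemma energy_has_real_derivative:
  assumes u: "(u has_vector_derivative z t) (at t within {0..})"
    and z: "(z has_vector_derivative z') (at t within {0..})"
  shows "((\<lambda>t. E (u t) (z t)) has_real_derivative z t \<bullet> z' + f (u t) \<bullet> z t) (at t within {0..})"
proof -
  have Su: "((\<lambda>t. S (u t)) has_vector_derivative S (z t)) (at t within {0..})"
    by (rule bounded_linear.has_vector_derivative[OF bl_S u])
  let ?q = "\<lambda>t. (norm (S (u t)))\<^sup>2"
  have 1: "((\<lambda>t. \<bar>?q t\<bar> powr (\<alpha> + 1)) has_real_derivative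
      (\<alpha> + 1) * \<bar>?q t\<bar> powr (\<alpha> + 1 - 1) * sgn (?q t) * (2 * (S (u t) \<bullet> S (z t)))) (at t within {0..})"
    by (rule DERIV_chain2[OF has_real_derivative_abs_powr norm_sq_has_real_derivative[OF Su]])
      (use \<alpha>_pos in auto)
  have 2: "\<bar>?q t\<bar> powr (\<alpha> + 1) = norm (S (u t)) powr (2 * \<alpha> + 2)" for t
    using powr_double[of "norm (S (u t))" "\<alpha> + 1"] by simp
  have 3: "\<bar>?q t\<bar> powr (\<alpha> + 1 - 1) * sgn (?q t) = norm (S (u t)) powr (2 * \<alpha>)"
    using powr_double[of "norm (S (u t))" "\<alpha>"] by (cases "S (u t) = 0") auto
  from 1 have "((\<lambda>t. norm (S (u t)) powr (2 * \<alpha> + 2)) has_real_derivative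
      (\<alpha> + 1) * norm (S (u t)) powr (2 * \<alpha>) * (2 * (S (u t) \<bullet> S (z t)))) (at t within {0..})"
    unfolding 2 mult.assoc[of "\<alpha> + 1"] 3 .
  then have "((\<lambda>t. E (u t) (z t)) has_real_derivative 2 * (z t \<bullet> z') / 2 +
      (\<alpha> + 1) * norm (S (u t)) powr (2 * \<alpha>) * (2 * (S (u t) \<bullet> S (z t))) / (2 * \<alpha> + 2)) (at t within {0..})"
    unfolding E_def by (intro DERIV_add DERIV_cdivide norm_sq_has_real_derivative[OF z])
  moreover have "(\<alpha> + 1) * norm (S (u t)) powr (2 * \<alpha>) * (2 * (S (u t) \<bullet> S (z t))) / (2 * \<alpha> + 2)
      = f (u t) \<bullet> z t"
    using \<alpha>_pos by (simp add: inner_f field_simps)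
  ultimately show ?thesis by simp
qed

lemma sol_energy_derivative:
  assumes "sol u z" "0 \<le> t"
  shows "((\<lambda>t. E (u t) (z t)) has_real_derivative - (norm (z t))\<^sup>2) (at t within {0..})"
  using energy_has_real_derivative[OF solD[OF assms]]
  by (simp add: inner_diff_right power2_norm_eq_inner inner_commute)

lemma sol_energy_decreasing:
  assumes "sol u z" "0 \<le> s" "s \<le> t"
  shows "E (u t) (z t) \<le> E (u s) (z s)"
  by (rule has_real_derivative_nonpos_imp_ge[OF assms(3,2) sol_energy_derivative[OF assms(1)]])
    (use assms in auto)

lemma potential_le_E: "norm (S u) powr (2 * \<alpha> + 2) \<le> (2 * \<alpha> + 2) * E u z"
  using \<alpha>_pos by (simp add: E_def field_simps)

lemma kinetic_le_E: "(norm z)\<^sup>2 \<le> 2 * E u z"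
  using \<alpha>_pos by (simp add: E_def)

lemma E_nonneg: "0 \<le> E u z"
  using \<alpha>_pos by (simp add: E_def)

lemma potential_less_imp: "norm (S u) powr (2 * \<alpha> + 2) < R powr (2 * \<alpha> + 2) \<Longrightarrow> 0 < R \<Longrightarrow> norm (S u) < R"
  using powr_mono2[of "2 * \<alpha> + 2" R "norm (S u)"] \<alpha>_pos by (meson add_nonneg_nonneg linorder_not_less
      less_imp_le mult_nonneg_nonneg zero_le_numeral)

section \<open>A priori bounds, global existence and uniqueness\<close>

lemma radius_exists: "\<exists>R>0. (2 * \<alpha> + 2) * e < R powr (2 * \<alpha> + 2)"
proof -
  define m where "m = (2 * \<alpha> + 2) * \<bar>e\<bar> + 1"
  have m: "0 < m" using \<alpha>_pos by (simp add: m_def add_nonneg_pos)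
  have "(m powr (1 / (2 * \<alpha> + 2))) powr (2 * \<alpha> + 2) = m"
    using m \<alpha>_pos by (simp add: powr_powr)
  moreover have "(2 * \<alpha> + 2) * e < m"
  proof -
    have "(2 * \<alpha> + 2) * e \<le> (2 * \<alpha> + 2) * \<bar>e\<bar>" using \<alpha>_pos by (intro mult_left_mono) auto
    then show ?thesis by (simp add: m_def)
  qed
  ultimately show ?thesis using m by (intro exI[of _ "m powr (1 / (2 * \<alpha> + 2))"]) auto
qed

lemma sol_bounded:
  assumes "sol u z"
  shows "\<exists>R>0. \<forall>t\<ge>0. norm (S (u t)) \<le> R"
proof -
  obtain R where R: "R > 0" "(2 * \<alpha> + 2) * E (u 0) (z 0) < R powr (2 * \<alpha> + 2)"
    using radius_exists by blast
  have "norm (S (u t)) < R" if "0 \<le> t" for t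
  proof (rule potential_less_imp[OF _ R(1)])
    have "norm (S (u t)) powr (2 * \<alpha> + 2) \<le> (2 * \<alpha> + 2) * E (u t) (z t)" by (rule potential_le_E)
    also have "\<dots> \<le> (2 * \<alpha> + 2) * E (u 0) (z 0)"
      using sol_energy_decreasing[OF assms, of 0 t] that \<alpha>_pos by (intro mult_left_mono) auto
    finally show "norm (S (u t)) powr (2 * \<alpha> + 2) < R powr (2 * \<alpha> + 2)" using R(2) by simp
  qed
  then show ?thesis using R(1) less_imp_le by blast
qed

text \<open>R is chosen so that the initial energy lies strictly below the potential on |S u| = R.
  While |S u| <= R the truncated equation is the true one, so the energy does not increase and |S u|
  stays strictly below R. The barrier is therefore never reached.\<close>

lemma sol_exists: "\<exists>u z. sol u z \<and> u 0 = u0 \<and> z 0 = u1"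
proof -
  obtain R where R: "R > 0" "(2 * \<alpha> + 2) * E u0 u1 < R powr (2 * \<alpha> + 2)"
    using radius_exists by blast
  define F where "F x = (snd x, - snd x - f_trunc R (fst x))" for x :: "'a \<times> 'a"
  have "norm (F x - F y) \<le> (2 + Lip R) * norm (x - y)" for x y
  proof -
    have "norm (F x - F y) = norm (snd (x - y), - snd (x - y) - (f_trunc R (fst x) - f_trunc R (fst y)))"
      by (simp add: F_def algebra_simps)
    also have "\<dots> \<le> norm (snd (x - y)) + norm (- snd (x - y) - (f_trunc R (fst x) - f_trunc R (fst y)))"
      by (rule norm_Pair_le)
    also have "\<dots> \<le> norm (snd (x - y)) + (norm (- snd (x - y)) + norm (f_trunc R (fst x) - f_trunc R (fst y)))"
      by (intro add_left_mono norm_triangle_ineq4)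
    also have "\<dots> \<le> norm (x - y) + (norm (x - y) + Lip R * norm (x - y))"
    proof (intro add_mono)
      show "norm (snd (x - y)) \<le> norm (x - y)" by (cases "x - y") (simp add: norm_snd_le)
      then show "norm (- snd (x - y)) \<le> norm (x - y)" by (simp only: norm_minus_cancel)
      have "norm (fst (x - y)) \<le> norm (x - y)" by (cases "x - y") (simp add: norm_fst_le)
      from mult_left_mono[OF this Lip_nonneg[of R]]
      show "norm (f_trunc R (fst x) - f_trunc R (fst y)) \<le> Lip R * norm (x - y)"
        using f_trunc_Lipschitz[OF R(1), of "fst x" "fst y"] by simp
    qed
    finally show ?thesis by (simp add: algebra_simps)
  qed
  moreover have "0 < 2 + Lip R" using Lip_nonneg[of R] by simp
  ultimately obtain x where x: "x 0 = (u0, u1)"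
    "\<And>t. 0 \<le> t \<Longrightarrow> (x has_vector_derivative F (x t)) (at t within {0..})"
    using Lipschitz_ode_exists[of F "2 + Lip R" "(u0, u1)"] by blast
  define u z where "u t = fst (x t)" and "z t = snd (x t)" for t
  have u: "(u has_vector_derivative z t) (at t within {0..})"
    and z: "(z has_vector_derivative - z t - f_trunc R (u t)) (at t within {0..})" if "0 \<le> t" for t
    using bounded_linear.has_vector_derivative[OF bounded_linear_fst x(2)[OF that]]
      bounded_linear.has_vector_derivative[OF bounded_linear_snd x(2)[OF that]]
    by (simp_all add: u_def[abs_def] z_def[abs_def] F_def)
  have init: "u 0 = u0" "z 0 = u1" by (simp_all add: u_def z_def x)
  define n where "n t = norm (S (u t))" for t
  have cont_n: "continuous_on {0..} n"
    unfolding n_def[abs_def]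
    by (intro continuous_intros S.continuous_on continuous_on_vector_derivative) (use u in auto)
  have below: "n t < R" if E: "\<And>s. 0 \<le> s \<Longrightarrow> s \<le> t \<Longrightarrow> n s \<le> R" and "0 \<le> t" for t
    unfolding n_def
  proof (rule potential_less_imp[OF _ R(1)])
    have "E (u t) (z t) \<le> E (u 0) (z 0)"
    proof (rule has_real_derivative_nonpos_imp_ge[OF \<open>0 \<le> t\<close>])
      fix s assume s: "0 \<le> s" "s \<le> t"
      show "((\<lambda>t. E (u t) (z t)) has_real_derivative - (norm (z s))\<^sup>2) (at s within {0..})"
        using energy_has_real_derivative[OF u z, OF s(1) s(1)] f_trunc_eq[of "u s" R] E[OF s]
        by (simp add: inner_diff_right power2_norm_eq_inner inner_commute n_def)
    qed auto
    then have "(2 * \<alpha> + 2) * E (u t) (z t) \<le> (2 * \<alpha> + 2) * E u0 u1"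
      using \<alpha>_pos by (intro mult_left_mono) (auto simp: init)
    then show "norm (S (u t)) powr (2 * \<alpha> + 2) < R powr (2 * \<alpha> + 2)"
      using potential_le_E[of "u t" "z t"] R(2) by linarith
  qed
  have n0: "n 0 < R"
    unfolding n_def init
    by (rule potential_less_imp[OF order_le_less_trans[OF potential_le_E R(2)] R(1)])
  have "n t \<le> R" if "0 \<le> t" for t
  proof (rule ccontr)
    assume "\<not> n t \<le> R"
    then have nt: "R < n t" by simp
    have cont: "continuous_on {0..s} n" for s by (rule continuous_on_subset[OF cont_n]) auto
    \<comment> \<open>A crossing would give a least time s with |S u| = R. Up to s the barrier is
      respected, by the intermediate value theorem and minimality, and then \<open>below\<close>
      yields n s < R.\<close>
    define A where "A = {0..t} \<inter> n -` {R}"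
    have A_iff: "r \<in> A \<longleftrightarrow> 0 \<le> r \<and> r \<le> t \<and> n r = R" for r by (simp add: A_def)
    have "closed A"
      unfolding A_def by (rule continuous_closed_preimage[OF cont closed_atLeastAtMost closed_singleton])
    then have "compact ({0..t} \<inter> A)" by (rule compact_Int_closed[OF compact_Icc])
    moreover have "{0..t} \<inter> A = A" by (auto simp: A_iff)
    ultimately have "compact A" by simp
    moreover have "\<exists>r\<ge>0. r \<le> t \<and> n r = R"
      by (rule IVT'[OF less_imp_le[OF n0] less_imp_le[OF nt] \<open>0 \<le> t\<close> cont])
    then have "A \<noteq> {}" using A_iff by blast
    ultimately obtain s where s: "s \<in> A" "\<forall>r\<in>A. s \<le> r"
      by (rule compact_attains_inf[THEN bexE])
    have "n s < R"
    proof (rule below)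
      show "0 \<le> s" using s(1) by (simp add: A_iff)
      fix r assume r: "0 \<le> r" "r \<le> s"
      show "n r \<le> R"
      proof (rule ccontr)
        assume "\<not> n r \<le> R"
        then have nr: "R \<le> n r" by simp
        have "\<exists>r'\<ge>0. r' \<le> r \<and> n r' = R"
          by (rule IVT'[OF less_imp_le[OF n0] nr r(1) cont])
        then obtain r' where r': "0 \<le> r'" "r' \<le> r" "n r' = R" by blast
        moreover have "s \<le> t" using s(1) by (simp add: A_iff)
        ultimately have "r' \<in> A" using r by (simp add: A_iff)
        then have "r' = r" using s(2)[rule_format, of r'] r r' by linarith
        then show False using r' \<open>\<not> n r \<le> R\<close> by simp
      qed
    qed
    then show False using s(1) by (simp add: A_iff)
  qed
  then have "f_trunc R (u t) = f (u t)" if "0 \<le> t" for t using that by (simp add: f_trunc_eq n_def)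
  then have "sol u z" using u z by (simp add: sol_def)
  then show ?thesis using init by blast
qed

text \<open>The squared distance D in phase space satisfies |D'| <= (3 + L) D, where L is the
  Lipschitz constant on a region containing both trajectories, so a zero of D spreads in both time
  directions. The backward direction later turns vanishing at one late time into vanishing from time
  0 on.\<close>

lemma sol_unique:
  assumes uz: "sol u z" and vw: "sol v w" and T: "0 \<le> T" "u T = v T" "z T = w T" and "0 \<le> t"
  shows "u t = v t \<and> z t = w t"
proof -
  obtain R1 R2 where "R1 > 0" "R2 > 0"
    and R12: "\<And>t. 0 \<le> t \<Longrightarrow> norm (S (u t)) \<le> R1" "\<And>t. 0 \<le> t \<Longrightarrow> norm (S (v t)) \<le> R2"
    using sol_bounded[OF uz] sol_bounded[OF vw] by blast
  define R where "R = max R1 R2"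
  have R: "R > 0" "\<And>t. 0 \<le> t \<Longrightarrow> norm (S (u t)) \<le> R" "\<And>t. 0 \<le> t \<Longrightarrow> norm (S (v t)) \<le> R"
    using \<open>R1 > 0\<close> R12 by (auto simp: R_def le_max_iff_disj)
  define L where "L = Lip R"
  have L: "0 \<le> L" "\<And>t. 0 \<le> t \<Longrightarrow> norm (f (u t) - f (v t)) \<le> L * norm (u t - v t)"
    using Lip_nonneg f_Lipschitz[OF R(1) R(2,3)] by (auto simp: L_def)
  define a b where "a t = u t - v t" and "b t = z t - w t" for t
  define D where "D t = (norm (a t))\<^sup>2 + (norm (b t))\<^sup>2" for t
  define D' where "D' t = 2 * (a t \<bullet> b t) + 2 * (b t \<bullet> (- b t - (f (u t) - f (v t))))" for t
  have der: "(D has_real_derivative D' t) (at t within {0..})" if t: "0 \<le> t" for t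
  proof -
    have "(a has_vector_derivative b t) (at t within {0..})"
      unfolding a_def[abs_def] b_def using solD(1)[OF uz t] solD(1)[OF vw t] by (rule has_vector_derivative_diff)
    moreover have "(b has_vector_derivative (- z t - f (u t)) - (- w t - f (v t))) (at t within {0..})"
      unfolding b_def[abs_def] using solD(2)[OF uz t] solD(2)[OF vw t] by (rule has_vector_derivative_diff)
    then have "(b has_vector_derivative - b t - (f (u t) - f (v t))) (at t within {0..})"
      by (simp add: b_def algebra_simps)
    ultimately show ?thesis
      unfolding D_def[abs_def] D'_def by (intro DERIV_add norm_sq_has_real_derivative)
  qed
  have bnd: "\<bar>D' t\<bar> \<le> (3 + L) * D t" if t: "0 \<le> t" for t
  proof -
    have ab: "2 * (norm (a t) * norm (b t)) \<le> D t"
      unfolding D_def using sum_squares_bound[of "norm (a t)" "norm (b t)"] by simp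
    have 1: "\<bar>2 * (a t \<bullet> b t)\<bar> \<le> D t"
      using Cauchy_Schwarz_ineq2[of "a t" "b t"] ab by simp
    have 2: "\<bar>b t \<bullet> b t\<bar> \<le> D t" by (simp add: D_def power2_norm_eq_inner)
    have "\<bar>b t \<bullet> (f (u t) - f (v t))\<bar> \<le> norm (b t) * norm (f (u t) - f (v t))"
      by (rule Cauchy_Schwarz_ineq2)
    also have "\<dots> \<le> norm (b t) * (L * norm (a t))"
      using L(2)[OF t] by (intro mult_left_mono) (auto simp: a_def)
    finally have "\<bar>2 * (b t \<bullet> (f (u t) - f (v t)))\<bar> \<le> L * (2 * (norm (a t) * norm (b t)))"
      by (simp add: abs_mult mult_ac)
    also have "\<dots> \<le> L * D t" using ab L(1) by (rule mult_left_mono)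
    finally have 3: "\<bar>2 * (b t \<bullet> (f (u t) - f (v t)))\<bar> \<le> L * D t" .
    have "D' t = 2 * (a t \<bullet> b t) - 2 * (b t \<bullet> b t) - 2 * (b t \<bullet> (f (u t) - f (v t)))"
      by (simp add: D'_def inner_diff_right)
    then have "\<bar>D' t\<bar> \<le> D t + 2 * D t + L * D t" using 1 2 3 by linarith
    then show ?thesis by (simp add: algebra_simps)
  qed
  have DT: "D T = 0" by (simp add: D_def a_def b_def T)
  have "D t \<le> 0"
  proof (cases "T \<le> t")
    case True
    have "D t \<le> D T * exp ((3 + L) * (t - T))"
    proof (rule has_real_derivative_Gronwall_le[OF True T(1)])
      fix r assume r: "T \<le> r" "r \<le> t"
      show "(D has_real_derivative D' r) (at r within {0..})" using der r T by simp
      show "D' r \<le> (3 + L) * D r" using bnd[of r] r T by simp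
    qed
    then show ?thesis by (simp add: DT)
  next
    case False
    then have tT: "t \<le> T" by simp
    have "D t * exp (- (3 + L) * (T - t)) \<le> D T"
    proof (rule has_real_derivative_Gronwall_ge[OF tT \<open>0 \<le> t\<close>])
      fix r assume r: "t \<le> r" "r \<le> T"
      show "(D has_real_derivative D' r) (at r within {0..})" using der r \<open>0 \<le> t\<close> by simp
      show "- (3 + L) * D r \<le> D' r" using bnd[of r] r \<open>0 \<le> t\<close> unfolding mult_minus_left by linarith
    qed
    then show ?thesis by (simp add: DT mult_le_0_iff)
  qed
  then have "(norm (a t))\<^sup>2 = 0" "(norm (b t))\<^sup>2 = 0"
    unfolding D_def by (smt (verit) zero_le_power2)+
  then show ?thesis by (simp add: a_def b_def)
qed

text \<open>The multiplier H = <u, z> + |u|^2 / 2 satisfies H' = |z|^2 - |S u|^(2\<alpha> + 2),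
  which supplies the missing dissipation of the potential. In (t + 2) E + H the extra 2 E absorbs
  the kinetic terms of the derivative and offsets H >= -E, leaving (1 + t) E below the initial
  value.\<close>

lemma sol_energy_rate:
  assumes uz: "sol u z"
  shows "\<exists>K. \<forall>t\<ge>0. E (u t) (z t) \<le> K / (1 + t)"
proof -
  define H where "H t = u t \<bullet> z t + (norm (u t))\<^sup>2 / 2" for t
  define \<Psi> where "\<Psi> t = t * E (u t) (z t) + 2 * E (u t) (z t) + H t" for t
  have "E (u t) (z t) \<le> \<Psi> 0 / (1 + t)" if t: "0 \<le> t" for t
  proof -
    have "\<Psi> t \<le> \<Psi> 0"
    proof (rule has_real_derivative_nonpos_imp_ge[OF t])
      fix s :: real assume s: "0 \<le> s" "s \<le> t"
      have "(H has_real_derivative (u s \<bullet> (- z s - f (u s)) + z s \<bullet> z s) + 2 * (u s \<bullet> z s) / 2) (at s within {0..})"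
        unfolding H_def[abs_def]
        by (intro DERIV_add DERIV_cdivide norm_sq_has_real_derivative inner_has_real_derivative solD[OF uz s(1)])
      then have H: "(H has_real_derivative (norm (z s))\<^sup>2 - norm (S (u s)) powr (2 * \<alpha> + 2)) (at s within {0..})"
        by (simp add: inner_diff_right inner_f_self power2_norm_eq_inner)
      show "(\<Psi> has_real_derivative (E (u s) (z s) + s * (- (norm (z s))\<^sup>2)) + 2 * (- (norm (z s))\<^sup>2)
          + ((norm (z s))\<^sup>2 - norm (S (u s)) powr (2 * \<alpha> + 2))) (at s within {0..})"
        unfolding \<Psi>_def[abs_def]
        by (auto intro!: derivative_eq_intros sol_energy_derivative[OF uz s(1)] H)
      have "norm (S (u s)) powr (2 * \<alpha> + 2) / (2 * \<alpha> + 2) \<le> norm (S (u s)) powr (2 * \<alpha> + 2)"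
        using \<alpha>_pos by (simp add: divide_le_eq_1 mult_le_cancel_left1 field_simps)
      moreover have "0 \<le> s * (norm (z s))\<^sup>2" using s by simp
      ultimately show "(E (u s) (z s) + s * (- (norm (z s))\<^sup>2)) + 2 * (- (norm (z s))\<^sup>2)
          + ((norm (z s))\<^sup>2 - norm (S (u s)) powr (2 * \<alpha> + 2)) \<le> 0"
        unfolding E_def mult_minus_right using zero_le_power2[of "norm (z s)"] by linarith
    qed simp
    moreover have "- E (u t) (z t) \<le> H t"
    proof -
      have "(- u t) \<bullet> z t \<le> ((norm (u t))\<^sup>2 + (norm (z t))\<^sup>2) / 2"
        using inner_le_mean_squares[of "- u t" "z t"] by simp
      then show ?thesis using kinetic_le_E[of "z t" "u t"] by (simp add: H_def)
    qed
    ultimately have "(1 + t) * E (u t) (z t) \<le> \<Psi> 0" by (simp add: \<Psi>_def algebra_simps)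
    then show ?thesis using t by (simp add: field_simps)
  qed
  then show ?thesis by blast
qed

lemma sol_tendsto_0:
  assumes uz: "sol u z"
  shows "((\<lambda>t. norm (S (u t))) \<longlongrightarrow> 0) at_top" "(z \<longlongrightarrow> 0) at_top" "(u \<longlongrightarrow> 0) at_top"
proof -
  obtain K where K: "\<And>t. 0 \<le> t \<Longrightarrow> E (u t) (z t) \<le> K / (1 + t)"
    using sol_energy_rate[OF uz] by blast
  have "((\<lambda>t. K / (1 + t)) \<longlongrightarrow> 0) at_top"
    by (intro tendsto_divide_0[OF tendsto_const] filterlim_at_top_imp_at_infinity
        filterlim_tendsto_add_at_top[OF tendsto_const] filterlim_ident)
  then have E0: "((\<lambda>t. E (u t) (z t)) \<longlongrightarrow> 0) at_top"
    by (rule Lim_null_comparison[rotated], intro eventually_mono[OF eventually_ge_at_top[of 0]])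
      (use K E_nonneg in auto)
  have "((\<lambda>t. sqrt (2 * E (u t) (z t))) \<longlongrightarrow> 0) at_top"
    using tendsto_real_sqrt[OF tendsto_mult_right_zero[OF E0, of 2]] by simp
  then show "(z \<longlongrightarrow> 0) at_top"
    by (rule Lim_null_comparison[rotated])
      (intro always_eventually allI real_le_rsqrt kinetic_le_E)
  define p where "p = 2 * \<alpha> + 2"
  have p: "0 < p" using \<alpha>_pos by (simp add: p_def)
  have "((\<lambda>t. (p * E (u t) (z t)) powr (1 / p)) \<longlongrightarrow> 0) at_top"
    by (rule tendsto_zero_powrI[OF tendsto_mult_right_zero[OF E0] tendsto_const])
      (use p E_nonneg in auto)
  moreover have "norm (S (u t)) \<le> (p * E (u t) (z t)) powr (1 / p)" for t
  proof -
    have "norm (S (u t)) = (norm (S (u t)) powr p) powr (1 / p)" using p by (simp add: powr_powr)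
    also have "\<dots> \<le> (p * E (u t) (z t)) powr (1 / p)"
      using p potential_le_E[of "u t" "z t"] by (intro powr_mono2) (auto simp: p_def)
    finally show ?thesis .
  qed
  ultimately show n: "((\<lambda>t. norm (S (u t))) \<longlongrightarrow> 0) at_top"
    by (intro Lim_null_comparison[of "\<lambda>t. norm (S (u t))"]) (auto intro: always_eventually)
  have "((\<lambda>t. norm (S (u t)) / c) \<longlongrightarrow> 0) at_top" using tendsto_divide_zero[OF n] .
  then show "(u \<longlongrightarrow> 0) at_top"
    by (rule Lim_null_comparison[rotated])
      (use coer_S c_pos in \<open>auto intro!: always_eventually simp: field_simps\<close>)
qed

end

section \<open>Slow and fast solutions\<close>

lemma dt_eq:
  assumes "(u has_vector_derivative u') (at t within {0..})" "0 \<le> t"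
  shows "dt u t = u'"
proof -
  have "at t within {0..} \<noteq> bot"
    using at_le[of "{t<..}" "{0..}" t] assms(2) trivial_limit_at_right_real[of t] le_bot by force
  then show ?thesis unfolding dt_def by (rule vector_derivative_within[OF _ assms(1)])
qed

text \<open>A bound at the critical exponent 1 + 2\<alpha> yields the limit for every smaller
  \<gamma>.\<close>

lemma fast_withI:
  fixes u :: "real \<Rightarrow> 'a::real_normed_vector"
  assumes u: "\<And>t. 0 \<le> t \<Longrightarrow> (u has_vector_derivative z t) (at t within {0..})"
    and le: "\<And>t. T \<le> t \<Longrightarrow> norm (z t + exp (- t) *\<^sub>R v0) + norm (u t - exp (- t) *\<^sub>R v0)
      \<le> C * exp (- (1 + 2 * \<alpha>) * t)"
  shows "fast_with \<alpha> v0 u"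
  unfolding fast_with_def
proof (intro allI impI)
  fix \<gamma> :: real assume \<gamma>: "\<gamma> < 1 + 2 * \<alpha>"
  have dt: "dt u t = z t" if "0 \<le> t" for t
    by (rule dt_eq[OF u[OF that] that])
  show "((\<lambda>t. (norm (dt u t + exp (- t) *\<^sub>R v0) + norm (u t - exp (- t) *\<^sub>R v0)) * exp (\<gamma> * t)) \<longlongrightarrow> 0) at_top"
  proof (rule Lim_null_comparison[OF _ exp_neg_tendsto_0[of "1 + 2 * \<alpha> - \<gamma>" C]])
    show "\<forall>\<^sub>F t in at_top. norm ((norm (dt u t + exp (- t) *\<^sub>R v0) + norm (u t - exp (- t) *\<^sub>R v0)) * exp (\<gamma> * t))
      \<le> C * exp (- (1 + 2 * \<alpha> - \<gamma>) * t)"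
      using eventually_ge_at_top[of "max 0 T"]
    proof eventually_elim
      case (elim t)
      have "(norm (dt u t + exp (- t) *\<^sub>R v0) + norm (u t - exp (- t) *\<^sub>R v0)) * exp (\<gamma> * t)
          \<le> C * exp (- (1 + 2 * \<alpha>) * t) * exp (\<gamma> * t)"
        using elim le[of t] by (intro mult_right_mono) (auto simp: dt)
      also have "\<dots> = C * exp (- (1 + 2 * \<alpha> - \<gamma>) * t)"
        by (simp add: algebra_simps flip: exp_add)
      finally show ?case by simp
    qed
  qed (use \<gamma> in simp)
qed

lemma norm_diff_sq_le:
  fixes x y :: "'a::real_inner"
  shows "(norm (x - y))\<^sup>2 \<le> 2 * (norm x)\<^sup>2 + 2 * (norm y)\<^sup>2"
proof -
  have "(norm (x - y))\<^sup>2 + (norm (x + y))\<^sup>2 = 2 * (norm x)\<^sup>2 + 2 * (norm y)\<^sup>2"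
    by (simp add: power2_norm_eq_inner inner_simps)
  then show ?thesis using zero_le_power2[of "norm (x + y)"] by linarith
qed

lemma powr_le_exp:
  fixes m :: real
  assumes "0 < m"
  shows "\<exists>K>0. \<forall>t\<ge>0. (1 + t) powr m \<le> K * exp (t / 4)"
proof (intro exI conjI allI impI)
  \<comment> \<open>Chosen so that ln y <= y - 1 at y = \<delta> (1 + t), multiplied by m, has slope
    1/4 in t.\<close>
  define \<delta> where "\<delta> = 1 / (4 * m)"
  have \<delta>: "0 < \<delta>" "m * \<delta> = 1 / 4" using assms by (auto simp: \<delta>_def)
  show "0 < exp (1/4 - m * (1 + ln \<delta>))" by simp
  fix t :: real assume t: "0 \<le> t"
  have "ln \<delta> + ln (1 + t) \<le> \<delta> * (1 + t) - 1"
    using ln_le_minus_one[of "\<delta> * (1 + t)"] \<delta> t by (simp add: ln_mult)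
  then have "m * (ln \<delta> + ln (1 + t)) \<le> m * (\<delta> * (1 + t) - 1)" using assms by (intro mult_left_mono) auto
  also have "\<dots> = (m * \<delta>) * (1 + t) - m" by (simp add: algebra_simps)
  finally have "m * ln (1 + t) \<le> (1/4 - m * (1 + ln \<delta>)) + t / 4"
    unfolding \<delta>(2) by (simp add: algebra_simps)
  then have "exp (m * ln (1 + t)) \<le> exp ((1/4 - m * (1 + ln \<delta>)) + t / 4)" by simp
  then show "(1 + t) powr m \<le> exp (1/4 - m * (1 + ln \<delta>)) * exp (t / 4)"
    using t by (simp add: powr_def exp_add)
qed

text \<open>The fast condition at \<gamma> = 1/2, admissible for every \<alpha>, bounds |u| by
  o(exp(-t/2)) + exp(-t) |v0|. After multiplication by (1 + t)^(1/(2\<alpha>)) <= K exp(t/4) this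
  still tends to 0, whereas the slow lower bound keeps it above C1.\<close>

lemma not_slow_and_fast:
  assumes slow: "slow_solution \<alpha> u" and fast: "fast_solution \<alpha> u" and "0 < \<alpha>"
  shows False
proof -
  obtain v0 where v0: "fast_with \<alpha> v0 u" using fast by (auto simp: fast_solution_def)
  define \<phi> where "\<phi> t = (norm (dt u t + exp (- t) *\<^sub>R v0) + norm (u t - exp (- t) *\<^sub>R v0)) * exp ((1/2) * t)" for t
  have "(1::real) / 2 < 1 + 2 * \<alpha>" using \<open>0 < \<alpha>\<close> by simp
  then have \<phi>: "(\<phi> \<longlongrightarrow> 0) at_top"
    using v0 unfolding fast_with_def \<phi>_def[abs_def] by blast
  obtain C1 where C1: "0 < C1" "\<forall>\<^sub>F t in at_top. C1 * (1 + t) powr (- 1 / (2 * \<alpha>)) \<le> norm (u t)"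
    using slow unfolding slow_solution_def eventually_conj_iff by blast
  have "0 < 1 / (2 * \<alpha>)" using \<open>0 < \<alpha>\<close> by simp
  then obtain K where K: "0 < K" "\<And>t. 0 \<le> t \<Longrightarrow> (1 + t) powr (1 / (2 * \<alpha>)) \<le> K * exp (t / 4)"
    using powr_le_exp by blast
  have "((\<lambda>t. K * (\<phi> t * (1 * exp (- (1/4) * t)) + norm v0 * exp (- (3/4) * t))) \<longlongrightarrow> K * (0 * 0 + 0)) at_top"
    by (intro tendsto_mult tendsto_add tendsto_const \<phi> exp_neg_tendsto_0) auto
  moreover have "\<forall>\<^sub>F t in at_top. C1 \<le> K * (\<phi> t * (1 * exp (- (1/4) * t)) + norm v0 * exp (- (3/4) * t))"
    using C1(2) eventually_ge_at_top[of 0]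
  proof eventually_elim
    case (elim t)
    have e: "exp ((1/2) * t) * exp (- (1/2) * t) = 1" by (simp flip: exp_add)
    have "norm (u t - exp (- t) *\<^sub>R v0) * exp ((1/2) * t) \<le> \<phi> t"
      unfolding \<phi>_def by (intro mult_right_mono) auto
    from mult_right_mono[OF this, of "exp (- (1/2) * t)"]
    have "norm (u t - exp (- t) *\<^sub>R v0) \<le> \<phi> t * exp (- (1/2) * t)"
      unfolding mult.assoc e by simp
    moreover have "norm (u t) \<le> norm (u t - exp (- t) *\<^sub>R v0) + norm (exp (- t) *\<^sub>R v0)"
      using norm_triangle_ineq[of "u t - exp (- t) *\<^sub>R v0" "exp (- t) *\<^sub>R v0"] by simp
    ultimately have u: "norm (u t) \<le> \<phi> t * exp (- (1/2) * t) + exp (- t) * norm v0" by simp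
    have p: "(1 + t) powr (- 1 / (2 * \<alpha>)) * (1 + t) powr (1 / (2 * \<alpha>)) = 1"
      using elim by (simp flip: powr_add)
    have "C1 = (C1 * (1 + t) powr (- 1 / (2 * \<alpha>))) * (1 + t) powr (1 / (2 * \<alpha>))"
      unfolding mult.assoc p by simp
    also have "\<dots> \<le> (\<phi> t * exp (- (1/2) * t) + exp (- t) * norm v0) * (K * exp (t / 4))"
      using order_trans[OF elim(1) u] K(2)[OF elim(2)] order_trans[OF norm_ge_zero u]
      by (intro mult_mono) auto
    also have "\<dots> = K * (\<phi> t * (exp (- (1/2) * t) * exp (t / 4)) + norm v0 * (exp (- t) * exp (t / 4)))"
      by (simp add: algebra_simps)
    also have "exp (- (1/2) * t) * exp (t / 4) = 1 * exp (- (1/4) * t)" by (simp flip: exp_add)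
    also have "exp (- t) * exp (t / 4) = exp (- (3/4) * t)" by (simp flip: exp_add)
    finally show ?case .
  qed
  ultimately have "C1 \<le> K * (0 * 0 + 0)"
    by (rule tendsto_lowerbound) simp
  then show False using C1(1) by simp
qed

section \<open>The alternative between slow and fast solutions\<close>

context damped_wave
begin

lemma momentum_derivative:
  assumes "sol u z" "0 \<le> t"
  shows "((\<lambda>t. u t + z t) has_vector_derivative - f (u t)) (at t within {0..})"
  using has_vector_derivative_add[OF solD[OF assms]] by simp

text \<open>By \<open>norm_f_le\<close> this yields |f(u)| <= |u| / 4 from T on; with the value 1/4
  the estimate N' >= -N closes.\<close>

definition small_from :: "(real \<Rightarrow> 'a) \<Rightarrow> real \<Rightarrow> bool" where
  "small_from u T \<longleftrightarrow> (\<forall>t\<ge>T. norm (S (u t)) powr (2 * \<alpha>) * M\<^sup>2 \<le> 1/4)"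

definition N :: "(real \<Rightarrow> 'a) \<Rightarrow> (real \<Rightarrow> 'a) \<Rightarrow> real \<Rightarrow> real" where
  "N u z t = (norm (u t + z t))\<^sup>2 - (norm (z t))\<^sup>2"

lemma small_norm_f_le: "small_from u T \<Longrightarrow> T \<le> t \<Longrightarrow> norm (f (u t)) \<le> norm (u t) / 4"
proof -
  assume "small_from u T" "T \<le> t"
  then have "norm (S (u t)) powr (2 * \<alpha>) * M\<^sup>2 * norm (u t) \<le> 1/4 * norm (u t)"
    unfolding small_from_def by (intro mult_right_mono) auto
  then show ?thesis using norm_f_le[of "u t"] by simp
qed

lemma coefficient_tendsto_0:
  assumes "sol u z"
  shows "((\<lambda>t. norm (S (u t)) powr (2 * \<alpha>) * M\<^sup>2) \<longlongrightarrow> 0) at_top"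
  by (rule tendsto_mult_left_zero, rule tendsto_zero_powrI[OF sol_tendsto_0(1)[OF assms] tendsto_const])
    (use \<alpha>_pos in auto)

lemma small_from_exists:
  assumes "sol u z"
  shows "\<exists>T\<ge>0. small_from u T"
proof -
  have "\<forall>\<^sub>F t in at_top. norm (S (u t)) powr (2 * \<alpha>) * M\<^sup>2 < 1/4"
    by (rule order_tendstoD(2)[OF coefficient_tendsto_0[OF assms]]) simp
  then obtain T where "\<forall>t\<ge>T. norm (S (u t)) powr (2 * \<alpha>) * M\<^sup>2 < 1/4"
    unfolding eventually_at_top_linorder by blast
  then show ?thesis by (intro exI[of _ "max 0 T"]) (auto simp: small_from_def less_imp_le)
qed

lemma small_from_mono: "small_from u T \<Longrightarrow> T \<le> T' \<Longrightarrow> small_from u T'"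
  by (auto simp: small_from_def)

text \<open>With p = u + z, N' = 2 |z|^2 - 2 <u, f(u)>. Smallness and u = p - z give <u, f(u)> <=
  |u|^2 / 4 <= (|p|^2 + |z|^2) / 2, hence N' >= |z|^2 - |p|^2 = -N.\<close>

lemma N_positive:
  assumes uz: "sol u z" and T: "0 \<le> T" and small: "small_from u T" and pos: "0 < N u z T" and t: "T \<le> t"
  shows "0 < N u z t"
proof -
  have "N u z T * exp (- 1 * (t - T)) \<le> N u z t"
  proof (rule has_real_derivative_Gronwall_ge[OF t T])
    fix s assume s: "T \<le> s" "s \<le> t"
    then have s0: "0 \<le> s" using T by simp
    have "(N u z has_real_derivative 2 * ((u s + z s) \<bullet> - f (u s)) - 2 * (z s \<bullet> (- z s - f (u s)))) (at s within {0..})"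
      unfolding N_def[abs_def]
      by (intro DERIV_diff norm_sq_has_real_derivative momentum_derivative[OF uz s0] solD(2)[OF uz s0])
    moreover have "2 * ((u s + z s) \<bullet> - f (u s)) - 2 * (z s \<bullet> (- z s - f (u s))) = 2 * (norm (z s))\<^sup>2 - 2 * (u s \<bullet> f (u s))"
      by (simp add: inner_add_left inner_diff_right power2_norm_eq_inner)
    ultimately show "(N u z has_real_derivative 2 * (norm (z s))\<^sup>2 - 2 * (u s \<bullet> f (u s))) (at s within {0..})"
      by simp
    have "u s \<bullet> f (u s) \<le> norm (u s) * norm (f (u s))" by (rule norm_cauchy_schwarz)
    also have "\<dots> \<le> norm (u s) * (norm (u s) / 4)"
      by (intro mult_left_mono small_norm_f_le[OF small s(1)]) simp
    finally have 1: "u s \<bullet> f (u s) \<le> (norm (u s))\<^sup>2 / 4" by (simp add: power2_eq_square)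
    have arith: "- 1 * (P - Z) \<le> 2 * Z - 2 * X" if "U \<le> 2 * P + 2 * Z" "X \<le> U / 4" for P Z X U :: real
      using that by (simp add: algebra_simps)
    have "(norm (u s))\<^sup>2 \<le> 2 * (norm (u s + z s))\<^sup>2 + 2 * (norm (z s))\<^sup>2"
      using norm_diff_sq_le[of "u s + z s" "z s"] by simp
    then show "- 1 * N u z s \<le> 2 * (norm (z s))\<^sup>2 - 2 * (u s \<bullet> f (u s))"
      using arith[OF _ 1] unfolding N_def by blast
  qed
  moreover have "0 < N u z T * exp (- 1 * (t - T))" using pos by simp
  ultimately show ?thesis by linarith
qed

text \<open>Here |u| <= 2 |z|, so the equation for z closes. A crude rate exp(-t/2) for z makes the
  coefficient g exponentially small; then Y = |z|^2 satisfies Y' = -2 Y up to an integrable relative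
  error, so it is bounded above and below by multiples of exp(-2 t). The upper bound produces the
  limits, the lower one a nonzero v0.\<close>

lemma fast_of_N_nonpos:
  assumes uz: "sol u z" and T: "0 \<le> T" and small: "small_from u T"
    and neg: "\<And>t. T \<le> t \<Longrightarrow> N u z t \<le> 0" and nz: "\<exists>t\<ge>0. u t \<noteq> 0"
  shows "fast_solution \<alpha> u"
proof -
  have pz: "norm (u t + z t) \<le> norm (z t)" if "T \<le> t" for t
    by (rule power2_le_imp_le) (use neg[OF that] in \<open>auto simp: N_def\<close>)
  have uz2: "norm (u t) \<le> 2 * norm (z t)" if "T \<le> t" for t
    using pz[OF that] norm_triangle_ineq4[of "u t + z t" "z t"] by simp
  define g where "g t = norm (S (u t)) powr (2 * \<alpha>) * M\<^sup>2" for t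
  have g: "0 \<le> g t" "T \<le> t \<Longrightarrow> g t \<le> 1/4" for t
    using small by (auto simp: g_def small_from_def)
  have zf: "\<bar>z t \<bullet> f (u t)\<bar> \<le> 2 * g t * (norm (z t))\<^sup>2" if "T \<le> t" for t
  proof -
    have "\<bar>z t \<bullet> f (u t)\<bar> \<le> norm (z t) * norm (f (u t))" by (rule Cauchy_Schwarz_ineq2)
    also have "\<dots> \<le> norm (z t) * (g t * (2 * norm (z t)))"
      using norm_f_le[of "u t"] mult_left_mono[OF uz2[OF that] g(1)[of t]]
      by (intro mult_left_mono) (auto simp: g_def)
    finally show ?thesis by (simp add: power2_eq_square mult_ac)
  qed
  define Y where "Y t = (norm (z t))\<^sup>2" for t
  have Y0: "0 \<le> Y t" for t by (simp add: Y_def)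
  have Y': "(Y has_real_derivative - 2 * Y t - 2 * (z t \<bullet> f (u t))) (at t within {0..})" if "T \<le> t" for t
  proof -
    have "0 \<le> t" using T that by simp
    then show ?thesis
      using norm_sq_has_real_derivative[OF solD(2)[OF uz]]
      by (simp add: Y_def[abs_def] inner_diff_right power2_norm_eq_inner)
  qed
  \<comment> \<open>With g <= 1/4 the nonlinear term costs at most 4 g Y <= Y, half of the
    damping.\<close>
  have Y1: "Y t \<le> Y T * exp (- 1 * (t - T))" if t: "T \<le> t" for t
  proof (rule has_real_derivative_Gronwall_le[OF t T Y'])
    fix s assume s: "T \<le> s" "s \<le> t"
    have "2 * g s * Y s \<le> 1/2 * Y s" using g(2)[OF s(1)] Y0 by (intro mult_right_mono) auto
    then show "- 2 * Y s - 2 * (z s \<bullet> f (u s)) \<le> - 1 * Y s"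
      using zf[OF s(1)] unfolding Y_def by linarith
  qed auto
  define B where "B = sqrt (Y T * exp T)"
  have z1: "norm (z t) \<le> B * exp (- t / 2)" if t: "T \<le> t" for t
  proof (rule power2_le_imp_le)
    have "(B * exp (- t / 2))\<^sup>2 = Y T * exp T * exp (- t)"
      using Y0[of T] by (simp add: B_def power_mult_distrib flip: exp_double)
    also have "\<dots> = Y T * exp (- 1 * (t - T))" by (simp add: exp_diff exp_minus field_simps)
    finally show "(norm (z t))\<^sup>2 \<le> (B * exp (- t / 2))\<^sup>2" using Y1[OF t] by (simp add: Y_def)
  qed (simp add: B_def Y0)
  have Su: "norm (S (u t)) \<le> 2 * M * norm (z t)" if "T \<le> t" for t
  proof -
    have "M * norm (u t) \<le> M * (2 * norm (z t))" by (intro mult_left_mono uz2 that) (use M_pos in simp)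
    then show ?thesis using bound_S[of "u t"] by (simp add: mult_ac)
  qed
  have B0: "0 \<le> B" by (simp add: B_def Y0)
  define K where "K = (2 * M * B) powr (2 * \<alpha>) * M\<^sup>2"
  have gK: "g t \<le> K * exp (- \<alpha> * t)" if t: "T \<le> t" for t
  proof -
    have "norm (S (u t)) \<le> (2 * M * B) * exp (- t / 2)"
    proof -
      have "2 * M * norm (z t) \<le> 2 * M * (B * exp (- t / 2))" by (intro mult_left_mono z1 t) (use M_pos in simp)
      then show ?thesis using Su[OF t] by (simp add: mult_ac)
    qed
    then have "norm (S (u t)) powr (2 * \<alpha>) \<le> ((2 * M * B) * exp (- t / 2)) powr (2 * \<alpha>)"
      using \<alpha>_pos by (intro powr_mono2) auto
    also have "\<dots> = (2 * M * B) powr (2 * \<alpha>) * exp (- t / 2) powr (2 * \<alpha>)"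
      using M_pos B0 by (subst powr_mult) auto
    also have "exp (- t / 2) powr (2 * \<alpha>) = exp (- \<alpha> * t)"
      by (simp add: powr_def)
    finally have "norm (S (u t)) powr (2 * \<alpha>) * M\<^sup>2 \<le> (2 * M * B) powr (2 * \<alpha>) * exp (- \<alpha> * t) * M\<^sup>2"
      by (intro mult_right_mono) auto
    then show ?thesis by (simp add: g_def K_def mult_ac)
  qed
  \<comment> \<open>Integrating factors for \<open>\<bar>Y' + 2 Y\<bar> \<le> 4 K exp (- \<alpha> t) Y\<close>.\<close>
  define \<omega> where "\<omega> t = 4 * K / \<alpha> * exp (- \<alpha> * t)" for t
  have K0: "0 \<le> K" by (simp add: K_def)
  have \<omega>0: "0 \<le> \<omega> t" for t using K0 \<alpha>_pos by (simp add: \<omega>_def)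
  have \<omega>': "(\<omega> has_real_derivative - 4 * K * exp (- \<alpha> * t)) (at t within {0..})" for t
    unfolding \<omega>_def[abs_def] using \<alpha>_pos by (auto intro!: derivative_eq_intros)
  have Yf: "2 * \<bar>z t \<bullet> f (u t)\<bar> \<le> 4 * K * exp (- \<alpha> * t) * Y t" if "T \<le> t" for t
    using zf[OF that] mult_right_mono[OF gK[OF that] Y0[of t]] by (simp add: Y_def)
  have up: "Y t * exp (2 * t + \<omega> t) \<le> Y T * exp (2 * T + \<omega> T)" if t: "T \<le> t" for t
  proof (rule has_real_derivative_nonpos_imp_ge[OF t T])
    fix s assume s: "T \<le> s" "s \<le> t"
    show "((\<lambda>t. Y t * exp (2 * t + \<omega> t)) has_real_derivative
      (- 2 * (z s \<bullet> f (u s)) - 4 * K * exp (- \<alpha> * s) * Y s) * exp (2 * s + \<omega> s)) (at s within {0..})"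
    proof (rule DERIV_cong[OF DERIV_mult[OF Y'[OF s(1)]]])
      show "((\<lambda>t. exp (2 * t + \<omega> t)) has_real_derivative exp (2 * s + \<omega> s) * (2 - 4 * K * exp (- \<alpha> * s))) (at s within {0..})"
        by (rule derivative_eq_intros \<omega>' refl)+ simp
    qed algebra
    show "(- 2 * (z s \<bullet> f (u s)) - 4 * K * exp (- \<alpha> * s) * Y s) * exp (2 * s + \<omega> s) \<le> 0"
    proof (rule mult_nonpos_nonneg)
      show "- 2 * (z s \<bullet> f (u s)) - 4 * K * exp (- \<alpha> * s) * Y s \<le> 0" using Yf[OF s(1)] by linarith
    qed simp
  qed
  \<comment> \<open>This lower bound serves to exclude l = 0 at the end.\<close>
  have low: "Y T * exp (2 * T - \<omega> T) \<le> Y t * exp (2 * t - \<omega> t)" if t: "T \<le> t" for t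
  proof (rule has_real_derivative_nonneg_imp_le[OF t T])
    fix s assume s: "T \<le> s" "s \<le> t"
    show "((\<lambda>t. Y t * exp (2 * t - \<omega> t)) has_real_derivative
      (- 2 * (z s \<bullet> f (u s)) + 4 * K * exp (- \<alpha> * s) * Y s) * exp (2 * s - \<omega> s)) (at s within {0..})"
    proof (rule DERIV_cong[OF DERIV_mult[OF Y'[OF s(1)]]])
      show "((\<lambda>t. exp (2 * t - \<omega> t)) has_real_derivative exp (2 * s - \<omega> s) * (2 + 4 * K * exp (- \<alpha> * s))) (at s within {0..})"
        by (rule derivative_eq_intros \<omega>' refl)+ simp
    qed algebra
    show "0 \<le> (- 2 * (z s \<bullet> f (u s)) + 4 * K * exp (- \<alpha> * s) * Y s) * exp (2 * s - \<omega> s)"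
    proof (rule mult_nonneg_nonneg)
      show "0 \<le> - 2 * (z s \<bullet> f (u s)) + 4 * K * exp (- \<alpha> * s) * Y s" using Yf[OF s(1)] by linarith
    qed simp
  qed
  define A where "A = sqrt (Y T * exp (2 * T + \<omega> T))"
  have A0: "0 \<le> A" by (simp add: A_def Y0)
  have z2: "norm (z t) \<le> A * exp (- t)" if t: "T \<le> t" for t
  proof (rule power2_le_imp_le)
    have "Y t * exp (2 * t) \<le> Y t * exp (2 * t + \<omega> t)" using Y0 \<omega>0 by (intro mult_left_mono) auto
    also have "\<dots> \<le> A\<^sup>2" using up[OF t] by (simp add: A_def Y0)
    finally have "Y t * exp (2 * t) * exp (- 2 * t) \<le> A\<^sup>2 * exp (- 2 * t)" by (rule mult_right_mono) simp
    then show "(norm (z t))\<^sup>2 \<le> (A * exp (- t))\<^sup>2"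
      by (simp add: Y_def power_mult_distrib mult.assoc flip: exp_add exp_double)
  qed (simp add: A0)
  \<comment> \<open>k is the degree of homogeneity of \<open>f\<close>: u of order exp(-t) makes
    f(u) of order exp(-k t).\<close>
  define k where "k = 1 + 2 * \<alpha>"
  define C where "C = (2 * M * A) powr (2 * \<alpha>) * M\<^sup>2 * (2 * A)"
  have f_le: "norm (f (u t)) \<le> C * exp (- k * t)" if t: "T \<le> t" for t
  proof -
    have "norm (S (u t)) \<le> (2 * M * A) * exp (- t)"
    proof -
      have "2 * M * norm (z t) \<le> 2 * M * (A * exp (- t))" by (intro mult_left_mono z2 t) (use M_pos in simp)
      then show ?thesis using Su[OF t] by (simp add: mult_ac)
    qed
    then have "norm (S (u t)) powr (2 * \<alpha>) \<le> ((2 * M * A) * exp (- t)) powr (2 * \<alpha>)"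
      using \<alpha>_pos by (intro powr_mono2) auto
    also have "\<dots> = (2 * M * A) powr (2 * \<alpha>) * exp (- t) powr (2 * \<alpha>)"
      using M_pos A0 by (subst powr_mult) auto
    also have "exp (- t) powr (2 * \<alpha>) = exp (- 2 * \<alpha> * t)"
      by (simp add: powr_def)
    finally have 1: "norm (S (u t)) powr (2 * \<alpha>) \<le> (2 * M * A) powr (2 * \<alpha>) * exp (- 2 * \<alpha> * t)" .
    have 2: "norm (u t) \<le> 2 * A * exp (- t)" using uz2[OF t] z2[OF t] by simp
    have "norm (f (u t)) \<le> norm (S (u t)) powr (2 * \<alpha>) * M\<^sup>2 * norm (u t)" by (rule norm_f_le)
    also have "\<dots> \<le> (2 * M * A) powr (2 * \<alpha>) * exp (- 2 * \<alpha> * t) * M\<^sup>2 * (2 * A * exp (- t))"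
      by (intro mult_mono 1 2) auto
    also have "\<dots> = C * (exp (- 2 * \<alpha> * t) * exp (- t))" by (simp add: C_def mult_ac)
    also have "exp (- 2 * \<alpha> * t) * exp (- t) = exp (- k * t)"
      by (simp add: k_def algebra_simps flip: exp_add)
    finally show ?thesis .
  qed
  have k: "0 < k" using \<alpha>_pos by (simp add: k_def)
  obtain l1 where l1: "((\<lambda>t. u t + z t) \<longlongrightarrow> l1) at_top"
    "\<And>t. T \<le> t \<Longrightarrow> norm (u t + z t - l1) \<le> C / k * exp (- k * t)"
    by (rule exp_decay_has_limit[OF T k momentum_derivative[OF uz], of C]) (use T f_le in auto)
  have "((\<lambda>t. u t + z t) \<longlongrightarrow> 0 + 0) at_top"
    \<comment> \<open>Both u and z tend to 0, hence l1 = 0, and the rate in \<open>l1\<close>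
      becomes a decay rate of u + z itself.\<close>
    by (intro tendsto_add sol_tendsto_0[OF uz])
  then have l10: "l1 = 0" using tendsto_unique[OF trivial_limit_at_top_linorder l1(1)] by simp
  have "0 < 2 * \<alpha>" using \<alpha>_pos by simp
  then obtain l where l: "((\<lambda>t. exp t *\<^sub>R z t) \<longlongrightarrow> l) at_top"
    "\<And>t. T \<le> t \<Longrightarrow> norm (exp t *\<^sub>R z t - l) \<le> C / (2 * \<alpha>) * exp (- (2 * \<alpha>) * t)"
  proof (rule exp_decay_has_limit[OF T, where g = "\<lambda>t. exp t *\<^sub>R z t" and g' = "\<lambda>t. - exp t *\<^sub>R f (u t)" and C = C])
    fix t assume t: "T \<le> t"
    then have t0: "0 \<le> t" using T by simp
    have "((\<lambda>t. exp t *\<^sub>R z t) has_vector_derivative exp t *\<^sub>R (- z t - f (u t)) + exp t *\<^sub>R z t) (at t within {0..})"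
      by (intro has_vector_derivative_scaleR solD(2)[OF uz t0] DERIV_exp has_field_derivative_at_within)
    then show "((\<lambda>t. exp t *\<^sub>R z t) has_vector_derivative - exp t *\<^sub>R f (u t)) (at t within {0..})"
      by (simp add: scaleR_diff_right)
    have "norm (- exp t *\<^sub>R f (u t)) \<le> exp t * (C * exp (- k * t))"
      using f_le[OF t] by (simp add: mult_left_mono)
    also have "\<dots> = C * exp (- (2 * \<alpha>) * t)"
      by (simp add: k_def algebra_simps flip: exp_add)
    finally show "norm (- exp t *\<^sub>R f (u t)) \<le> C * exp (- (2 * \<alpha>) * t)" .
  qed (rule that)
  have z3: "norm (z t + exp (- t) *\<^sub>R (- l)) \<le> C / (2 * \<alpha>) * exp (- k * t)" if t: "T \<le> t" for t
  proof -
    have "z t + exp (- t) *\<^sub>R (- l) = exp (- t) *\<^sub>R (exp t *\<^sub>R z t - l)"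
      by (simp add: scaleR_diff_right flip: exp_add)
    then have "norm (z t + exp (- t) *\<^sub>R (- l)) = exp (- t) * norm (exp t *\<^sub>R z t - l)" by simp
    also have "\<dots> \<le> exp (- t) * (C / (2 * \<alpha>) * exp (- (2 * \<alpha>) * t))"
      using l(2)[OF t] by (intro mult_left_mono) auto
    also have "\<dots> = C / (2 * \<alpha>) * (exp (- t) * exp (- (2 * \<alpha>) * t))" by (simp only: mult_ac)
    also have "exp (- t) * exp (- (2 * \<alpha>) * t) = exp (- k * t)"
      by (simp add: k_def algebra_simps flip: exp_add)
    finally show ?thesis .
  qed
  \<comment> \<open>As u + z is of smaller order, u behaves like -z, so the leading coefficient is
    -l.\<close>
  have "fast_with \<alpha> (- l) u"
  proof (rule fast_withI[OF solD(1)[OF uz]])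
    fix t assume t: "T \<le> t"
    have "u t - exp (- t) *\<^sub>R (- l) = (u t + z t - l1) - (z t + exp (- t) *\<^sub>R (- l))"
      by (simp add: l10)
    then have "norm (u t - exp (- t) *\<^sub>R (- l)) \<le> norm (u t + z t - l1) + norm (z t + exp (- t) *\<^sub>R (- l))"
      by (metis norm_triangle_ineq4)
    then have "norm (z t + exp (- t) *\<^sub>R (- l)) + norm (u t - exp (- t) *\<^sub>R (- l))
        \<le> C / (2 * \<alpha>) * exp (- k * t) + (C / k * exp (- k * t) + C / (2 * \<alpha>) * exp (- k * t))"
      using z3[OF t] l1(2)[OF t] by linarith
    also have "\<dots> = (C / \<alpha> + C / k) * exp (- (1 + 2 * \<alpha>) * t)"
      unfolding k_def[symmetric] using \<alpha>_pos by (simp add: distrib_right)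
    finally show "norm (z t + exp (- t) *\<^sub>R (- l)) + norm (u t - exp (- t) *\<^sub>R (- l))
      \<le> (C / \<alpha> + C / k) * exp (- (1 + 2 * \<alpha>) * t)" .
  qed
  \<comment> \<open>If l = 0, then Y exp(2 t) tends to 0 and \<open>low\<close> forces Y T = 0.
    Since |u| <= 2 |z|, both u T and z T vanish, and backward uniqueness makes u zero from time 0
    on.\<close>
  moreover have "l \<noteq> 0"
  proof
    assume "l = 0"
    then have "((\<lambda>t. (norm (exp t *\<^sub>R z t))\<^sup>2) \<longlongrightarrow> (norm (0::'a))\<^sup>2) at_top"
      using l(1) by (intro tendsto_power tendsto_norm) simp
    then have lim: "((\<lambda>t. Y t * exp (2 * t)) \<longlongrightarrow> 0) at_top"
      by (simp add: power_mult_distrib Y_def mult.commute flip: exp_double)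
    have "Y T * exp (2 * T - \<omega> T) \<le> 0"
    proof (rule tendsto_lowerbound[OF lim])
      show "\<forall>\<^sub>F t in at_top. Y T * exp (2 * T - \<omega> T) \<le> Y t * exp (2 * t)"
        using eventually_ge_at_top[of T]
      proof eventually_elim
        case (elim t)
        have "Y t * exp (2 * t - \<omega> t) \<le> Y t * exp (2 * t)" using Y0 \<omega>0 by (intro mult_left_mono) auto
        then show ?case using low[OF elim] by linarith
      qed
    qed simp
    then have "z T = 0" using Y0[of T] by (simp add: mult_le_0_iff Y_def)
    moreover have "u T = 0" using uz2[of T] \<open>z T = 0\<close> by simp
    moreover have "sol (\<lambda>_. 0) (\<lambda>_. 0)" by (simp add: sol_def)
    ultimately have "u t = 0" if "0 \<le> t" for t
      using sol_unique[OF uz, of "\<lambda>_. 0" "\<lambda>_. 0" T t] T that by simp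
    then show False using nz by auto
  qed
  ultimately show ?thesis unfolding fast_solution_def by (intro exI[of _ "- l"]) auto
qed


text \<open>The ratio must be as small as desired, not merely below 1, because the later lower bound
  on <p, f(u)>, with p = u + z, has to tolerate the ratio M / c of the bounds on S.\<close>

lemma velocity_le_momentum:
  assumes uz: "sol u z" and T: "0 \<le> T" and small: "small_from u T" and pos: "0 < N u z T"
    and \<delta>: "0 < \<delta>"
  shows "\<forall>\<^sub>F t in at_top. norm (z t) \<le> 2 * \<delta> * norm (u t + z t)"
proof -
  have zp: "norm (z t) < norm (u t + z t)" if "T \<le> t" for t
    by (rule power2_less_imp_less) (use N_positive[OF uz T small pos that] in \<open>auto simp: N_def\<close>)
  have up: "norm (u t) \<le> 2 * norm (u t + z t)" if "T \<le> t" for t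
    using zp[OF that] norm_triangle_ineq4[of "u t + z t" "z t"] by simp
  define g where "g t = norm (S (u t)) powr (2 * \<alpha>) * M\<^sup>2" for t
  have g0: "0 \<le> g t" for t by (simp add: g_def)
  have f_le: "norm (f (u t)) \<le> 2 * g t * norm (u t + z t)" if "T \<le> t" for t
    using norm_f_le[of "u t"] mult_left_mono[OF up[OF that] g0[of t]] by (simp add: g_def)
  define Y where "Y t = (norm (u t + z t))\<^sup>2" for t
  have Y': "(Y has_real_derivative - 2 * ((u t + z t) \<bullet> f (u t))) (at t within {0..})" if "0 \<le> t" for t
    using norm_sq_has_real_derivative[OF momentum_derivative[OF uz that]] by (simp add: Y_def[abs_def])
  have pf: "\<bar>(u t + z t) \<bullet> f (u t)\<bar> \<le> 2 * g t * Y t" if "T \<le> t" for t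
  proof -
    have "\<bar>(u t + z t) \<bullet> f (u t)\<bar> \<le> norm (u t + z t) * norm (f (u t))" by (rule Cauchy_Schwarz_ineq2)
    also have "\<dots> \<le> norm (u t + z t) * (2 * g t * norm (u t + z t))"
      by (rule mult_left_mono[OF f_le[OF that]]) simp
    finally show ?thesis by (simp add: Y_def power2_eq_square mult_ac)
  qed
  have zf: "\<bar>z t \<bullet> f (u t)\<bar> \<le> 2 * g t * Y t" if "T \<le> t" for t
  proof -
    have "\<bar>z t \<bullet> f (u t)\<bar> \<le> norm (z t) * norm (f (u t))" by (rule Cauchy_Schwarz_ineq2)
    also have "\<dots> \<le> norm (u t + z t) * (2 * g t * norm (u t + z t))"
      using zp[OF that] f_le[OF that] by (intro mult_mono) auto
    finally show ?thesis by (simp add: Y_def power2_eq_square mult_ac)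
  qed
  have Y0: "0 \<le> Y t" for t by (simp add: Y_def)
  have YT: "0 < Y T" using zp[of T] norm_ge_zero[of "z T"] unfolding Y_def by (simp only: zero_less_power2) linarith
  have Ylow: "Y T * exp (- 1 * (t - T)) \<le> Y t" if t: "T \<le> t" for t
  proof (rule has_real_derivative_Gronwall_ge[OF t T Y'])
    fix s assume s: "T \<le> s" "s \<le> t"
    have "2 * g s * Y s \<le> 1/2 * Y s"
      using small s Y0 by (intro mult_right_mono) (auto simp: small_from_def g_def)
    then show "- 1 * Y s \<le> - 2 * ((u s + z s) \<bullet> f (u s))"
      using pf[OF s(1)] by simp
  qed (use T in auto)
  \<comment> \<open>\<open>Y\<close> decays at most like \<open>exp (- t)\<close>, whereas \<open>W\<close> below is damped like \<open>exp (- 2 t)\<close>.\<close>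
  define W where "W t = (norm (z t))\<^sup>2 - \<delta>\<^sup>2 * Y t" for t
  \<comment> \<open>In W' the nonlinearity costs at most 4 (1 + \<delta>^2) g Y. Below this
    threshold for g the cost is at most 2 \<delta>^2 Y, which gives W' <= -2 W.\<close>
  have "0 < \<delta>\<^sup>2 / (2 * (1 + \<delta>\<^sup>2))" using \<delta> by (simp add: add_pos_nonneg)
  then have "\<forall>\<^sub>F t in at_top. g t < \<delta>\<^sup>2 / (2 * (1 + \<delta>\<^sup>2))"
    unfolding g_def using order_tendstoD(2)[OF coefficient_tendsto_0[OF uz]] by blast
  then obtain T0 where T0: "\<And>t. T0 \<le> t \<Longrightarrow> g t < \<delta>\<^sup>2 / (2 * (1 + \<delta>\<^sup>2))"
    unfolding eventually_at_top_linorder by blast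
  define T1 where "T1 = max T T0"
  have T1: "T \<le> T1" "T0 \<le> T1" "0 \<le> T1" using T by (auto simp: T1_def)
  have W: "W t \<le> W T1 * exp (- 2 * (t - T1))" if t: "T1 \<le> t" for t
  proof (rule has_real_derivative_Gronwall_le[OF t T1(3)])
    fix s assume s: "T1 \<le> s" "s \<le> t"
    have s0: "0 \<le> s" and sT: "T \<le> s" using s T1 by auto
    have "(W has_real_derivative 2 * (z s \<bullet> (- z s - f (u s))) - \<delta>\<^sup>2 * (- 2 * ((u s + z s) \<bullet> f (u s)))) (at s within {0..})"
      unfolding W_def[abs_def]
      by (intro DERIV_diff DERIV_cmult Y' s0 norm_sq_has_real_derivative solD(2)[OF uz])
    moreover have "2 * (z s \<bullet> (- z s - f (u s))) - \<delta>\<^sup>2 * (- 2 * ((u s + z s) \<bullet> f (u s)))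
        = - 2 * (norm (z s))\<^sup>2 - 2 * (z s \<bullet> f (u s)) + 2 * (\<delta>\<^sup>2 * ((u s + z s) \<bullet> f (u s)))"
      by (simp add: inner_diff_right power2_norm_eq_inner)
    ultimately show "(W has_real_derivative - 2 * (norm (z s))\<^sup>2 - 2 * (z s \<bullet> f (u s)) + 2 * (\<delta>\<^sup>2 * ((u s + z s) \<bullet> f (u s)))) (at s within {0..})"
      by (rule DERIV_cong)
    have "\<delta>\<^sup>2 * ((u s + z s) \<bullet> f (u s)) \<le> \<delta>\<^sup>2 * (2 * g s * Y s)"
      using pf[OF sT] by (intro mult_left_mono) auto
    then have "- 2 * (norm (z s))\<^sup>2 - 2 * (z s \<bullet> f (u s)) + 2 * (\<delta>\<^sup>2 * ((u s + z s) \<bullet> f (u s)))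
        \<le> - 2 * (norm (z s))\<^sup>2 + 2 * (2 * g s * Y s) + 2 * (\<delta>\<^sup>2 * (2 * g s * Y s))"
      using zf[OF sT] by linarith
    also have "\<dots> = - 2 * (norm (z s))\<^sup>2 + 2 * ((2 * (1 + \<delta>\<^sup>2) * g s) * Y s)"
      by (simp add: algebra_simps)
    also have "\<dots> \<le> - 2 * (norm (z s))\<^sup>2 + 2 * (\<delta>\<^sup>2 * Y s)"
    proof -
      have "0 < 1 + \<delta>\<^sup>2" by (simp add: add_pos_nonneg)
      then have "2 * (1 + \<delta>\<^sup>2) * g s \<le> \<delta>\<^sup>2"
        using T0[of s] T1 s by (simp add: field_simps)
      then have "(2 * (1 + \<delta>\<^sup>2) * g s) * Y s \<le> \<delta>\<^sup>2 * Y s" by (rule mult_right_mono[OF _ Y0])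
      then show ?thesis by linarith
    qed
    finally show "- 2 * (norm (z s))\<^sup>2 - 2 * (z s \<bullet> f (u s)) + 2 * (\<delta>\<^sup>2 * ((u s + z s) \<bullet> f (u s))) \<le> - 2 * W s"
      by (simp add: W_def)
  qed
  define a where "a = Y T * exp T"
  define b where "b = \<bar>W T1\<bar> * exp (2 * T1)"
  have a: "0 < a" using YT by (simp add: a_def)
  have Ya: "a * exp (- t) \<le> Y t" if "T \<le> t" for t
  proof -
    have "a * exp (- t) = Y T * exp (- 1 * (t - T))" by (simp add: a_def flip: exp_add)
    then show ?thesis using Ylow[OF that] by simp
  qed
  have Wb: "W t \<le> b * exp (- t) * exp (- t)" if t: "T1 \<le> t" for t
  proof -
    have "W T1 * exp (- 2 * (t - T1)) \<le> \<bar>W T1\<bar> * exp (- 2 * (t - T1))" by (intro mult_right_mono) auto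
    also have "\<dots> = b * exp (- t) * exp (- t)" by (simp add: b_def mult.assoc flip: exp_add)
    finally show ?thesis using W[OF t] by linarith
  qed
  \<comment> \<open>From W <= b exp(-2 t) and Y >= a exp(-t), W is at most (b / a) exp(-t) Y, so it
    eventually drops below \<delta>^2 Y.\<close>
  have "((\<lambda>t. b / a * exp (- 1 * t)) \<longlongrightarrow> 0) at_top" by (rule exp_neg_tendsto_0) simp
  then have "\<forall>\<^sub>F t in at_top. b / a * exp (- 1 * t) < \<delta>\<^sup>2"
    by (rule order_tendstoD(2)) (use \<delta> in simp)
  then show ?thesis using eventually_ge_at_top[of T1]
  proof eventually_elim
    case (elim t)
    then have tT: "T \<le> t" using T1 by simp
    have "b * exp (- t) < \<delta>\<^sup>2 * a" using elim(1) a by (simp add: field_simps)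
    then have "b * exp (- t) * exp (- t) \<le> \<delta>\<^sup>2 * a * exp (- t)" by (intro mult_right_mono) auto
    also have "\<dots> = \<delta>\<^sup>2 * (a * exp (- t))" by (simp only: mult.assoc)
    also have "\<dots> \<le> \<delta>\<^sup>2 * Y t" by (rule mult_left_mono[OF Ya[OF tT]]) simp
    finally have "W t \<le> \<delta>\<^sup>2 * Y t" using Wb[OF elim(2)] by linarith
    then have "(norm (z t))\<^sup>2 \<le> 2 * (\<delta>\<^sup>2 * Y t)" unfolding W_def by linarith
    also have "\<dots> \<le> (2 * \<delta> * norm (u t + z t))\<^sup>2" by (simp add: Y_def power_mult_distrib)
    finally show ?case by (rule power2_le_imp_le) (use \<delta> in simp)
  qed
qed

text \<open>Once z is negligible, <p, f(u)> lies between k |p|^(2\<alpha> + 2) and K |p|^(2\<alpha>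
  + 2). The derivative of |p|^(-2\<alpha>) is then pinched between two positive constants, and |u|
  between |p| / 2 and 2 |p|.\<close>

lemma slow_of_N_pos:
  assumes uz: "sol u z" and T: "0 \<le> T" and small: "small_from u T" and pos: "0 < N u z T"
  shows "slow_solution \<alpha> u"
proof -
  define p where "p t = u t + z t" for t
  have zp: "norm (z t) < norm (p t)" if "T \<le> t" for t
    unfolding p_def
    by (rule power2_less_imp_less) (use N_positive[OF uz T small pos that] in \<open>auto simp: N_def\<close>)
  \<comment> \<open>The value 1/4 gives |z| <= |p| / 2. The value c / (4 M) gives |S z| <= |S p| /
    2, which keeps <S u, S p> at least |S p|^2 / 2.\<close>
  define \<delta> where "\<delta> = min (1/4) (c / (4 * M))"
  have \<delta>: "0 < \<delta>" "\<delta> \<le> 1/4" "\<delta> \<le> c / (4 * M)" using c_pos M_pos by (auto simp: \<delta>_def)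
  have "\<forall>\<^sub>F t in at_top. norm (z t) \<le> 2 * \<delta> * norm (p t)"
    unfolding p_def by (rule velocity_le_momentum[OF uz T small pos \<delta>(1)])
  then obtain T0 where T0: "\<And>t. T0 \<le> t \<Longrightarrow> norm (z t) \<le> 2 * \<delta> * norm (p t)"
    unfolding eventually_at_top_linorder by blast
  define T1 where "T1 = max T T0"
  have T1: "T \<le> T1" "T0 \<le> T1" "0 \<le> T1" using T by (auto simp: T1_def)
  have p0: "0 < norm (p t)" if "T1 \<le> t" for t
    using zp[of t] T1 that norm_ge_zero[of "z t"] by linarith
  have u_eq: "u t = p t - z t" for t by (simp add: p_def)
  have zh: "norm (z t) \<le> norm (p t) / 2" if "T1 \<le> t" for t
  proof -
    have "2 * \<delta> * norm (p t) \<le> 1/2 * norm (p t)" using \<delta>(2) by (intro mult_right_mono) auto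
    then show ?thesis using T0[of t] T1 that by simp
  qed
  have u_up: "norm (u t) \<le> 2 * norm (p t)" and u_low: "norm (p t) / 2 \<le> norm (u t)" if "T1 \<le> t" for t
    using zh[OF that] norm_triangle_ineq4[of "p t" "z t"] norm_triangle_ineq2[of "p t" "z t"] norm_ge_zero[of "p t"]
    unfolding u_eq by linarith+
  define k where "k = (c / 2) powr (2 * \<alpha>) * (c\<^sup>2 / 2)"
  define K where "K = (2 * M) powr (2 * \<alpha>) * (2 * M\<^sup>2)"
  have k0: "0 < k" using c_pos by (simp add: k_def)
  have K0: "0 < K" using M_pos by (simp add: K_def)
  define Y where "Y t = (norm (p t))\<^sup>2" for t
  have Y0: "0 < Y t" if "T1 \<le> t" for t using p0[OF that] by (simp add: Y_def)
  have npow: "norm (p t) powr (2 * \<alpha>) * (norm (p t))\<^sup>2 = Y t powr (\<alpha> + 1)" if "T1 \<le> t" for t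
    using Y0[OF that] by (simp add: powr_double powr_add Y_def)
  have pf_low: "k * Y t powr (\<alpha> + 1) \<le> p t \<bullet> f (u t)" if t: "T1 \<le> t" for t
  proof -
    have "norm (S (z t)) \<le> M * norm (z t)" by (rule bound_S)
    also have "\<dots> \<le> M * (2 * \<delta> * norm (p t))"
      using T0[of t] t T1 M_pos by (intro mult_left_mono) auto
    also have "\<dots> \<le> M * (2 * (c / (4 * M)) * norm (p t))"
      using \<delta>(3) M_pos by (intro mult_left_mono mult_right_mono) auto
    also have "\<dots> = c * norm (p t) / 2" using M_pos by (simp add: field_simps)
    also have "\<dots> \<le> norm (S (p t)) / 2" using coer_S[of "p t"] by simp
    finally have Sz: "norm (S (z t)) \<le> norm (S (p t)) / 2" .
    have "S (z t) \<bullet> S (p t) \<le> norm (S (z t)) * norm (S (p t))" by (rule norm_cauchy_schwarz)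
    also have "\<dots> \<le> norm (S (p t)) / 2 * norm (S (p t))" using Sz by (intro mult_right_mono) auto
    finally have "S (z t) \<bullet> S (p t) \<le> (norm (S (p t)))\<^sup>2 / 2" by (simp add: power2_eq_square)
    then have "(norm (S (p t)))\<^sup>2 / 2 \<le> S (u t) \<bullet> S (p t)"
      by (simp add: u_eq S.diff inner_diff_left power2_norm_eq_inner)
    moreover have "(c * norm (p t))\<^sup>2 \<le> (norm (S (p t)))\<^sup>2"
      using coer_S[of "p t"] c_pos by (intro power_mono) auto
    ultimately have 1: "c\<^sup>2 / 2 * (norm (p t))\<^sup>2 \<le> S (u t) \<bullet> S (p t)"
      by (simp add: power_mult_distrib)
    have "c * (norm (p t) / 2) \<le> c * norm (u t)" using u_low[OF t] c_pos by (intro mult_left_mono) auto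
    then have "c / 2 * norm (p t) \<le> norm (S (u t))" using coer_S[of "u t"] by simp
    then have "(c / 2 * norm (p t)) powr (2 * \<alpha>) \<le> norm (S (u t)) powr (2 * \<alpha>)"
      using \<alpha>_pos c_pos by (intro powr_mono2) auto
    moreover have "(c / 2 * norm (p t)) powr (2 * \<alpha>) = (c / 2) powr (2 * \<alpha>) * norm (p t) powr (2 * \<alpha>)"
      by (rule powr_mult)
    ultimately have 2: "(c / 2) powr (2 * \<alpha>) * norm (p t) powr (2 * \<alpha>) \<le> norm (S (u t)) powr (2 * \<alpha>)"
      by simp
    have "k * Y t powr (\<alpha> + 1) = ((c / 2) powr (2 * \<alpha>) * norm (p t) powr (2 * \<alpha>)) * (c\<^sup>2 / 2 * (norm (p t))\<^sup>2)"
      unfolding npow[OF t, symmetric] k_def by (simp only: mult_ac)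
    also have "\<dots> \<le> norm (S (u t)) powr (2 * \<alpha>) * (S (u t) \<bullet> S (p t))"
      by (rule mult_mono[OF 2 1]) auto
    finally show ?thesis by (simp add: inner_commute[of "p t"] inner_f)
  qed
  have pf_up: "p t \<bullet> f (u t) \<le> K * Y t powr (\<alpha> + 1)" if t: "T1 \<le> t" for t
  proof -
    have "M * norm (u t) \<le> M * (2 * norm (p t))" using u_up[OF t] M_pos by (intro mult_left_mono) auto
    then have "norm (S (u t)) \<le> 2 * M * norm (p t)" using bound_S[of "u t"] by simp
    then have "norm (S (u t)) powr (2 * \<alpha>) \<le> (2 * M * norm (p t)) powr (2 * \<alpha>)"
      using \<alpha>_pos by (intro powr_mono2) auto
    also have "\<dots> = (2 * M) powr (2 * \<alpha>) * norm (p t) powr (2 * \<alpha>)"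
      by (rule powr_mult)
    finally have 1: "norm (S (u t)) powr (2 * \<alpha>) \<le> (2 * M) powr (2 * \<alpha>) * norm (p t) powr (2 * \<alpha>)" .
    have "p t \<bullet> f (u t) \<le> norm (p t) * norm (f (u t))" by (rule norm_cauchy_schwarz)
    also have "\<dots> \<le> norm (p t) * (norm (S (u t)) powr (2 * \<alpha>) * M\<^sup>2 * norm (u t))"
      by (rule mult_left_mono[OF norm_f_le]) simp
    also have "\<dots> \<le> norm (p t) * (((2 * M) powr (2 * \<alpha>) * norm (p t) powr (2 * \<alpha>)) * M\<^sup>2 * (2 * norm (p t)))"
    proof (rule mult_left_mono)
      show "norm (S (u t)) powr (2 * \<alpha>) * M\<^sup>2 * norm (u t)
          \<le> (2 * M) powr (2 * \<alpha>) * norm (p t) powr (2 * \<alpha>) * M\<^sup>2 * (2 * norm (p t))"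
        by (rule mult_mono[OF mult_right_mono[OF 1] u_up[OF t]]) auto
    qed simp
    also have "\<dots> = K * (norm (p t) powr (2 * \<alpha>) * (norm (p t))\<^sup>2)"
      by (simp add: K_def power2_eq_square)
    finally show ?thesis unfolding npow[OF t] .
  qed
  define G where "G t = Y t powr (- \<alpha>)" for t
  define G' where "G' t = 2 * \<alpha> * (p t \<bullet> f (u t)) * Y t powr (- \<alpha> - 1)" for t
  have G': "(G has_real_derivative G' t) (at t within {0..})" if t: "T1 \<le> t" for t
  proof -
    have t0: "0 \<le> t" using t T1 by simp
    have "(Y has_real_derivative 2 * (p t \<bullet> - f (u t))) (at t within {0..})"
      unfolding Y_def[abs_def] p_def[abs_def]
      by (rule norm_sq_has_real_derivative[OF momentum_derivative[OF uz t0]])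
    moreover have "((\<lambda>y. y powr (- \<alpha>)) has_real_derivative (- \<alpha>) * Y t powr (- \<alpha> - 1)) (at (Y t))"
      by (rule has_real_derivative_powr[OF Y0[OF t]])
    ultimately have "((\<lambda>t. Y t powr (- \<alpha>)) has_real_derivative
        (- \<alpha>) * Y t powr (- \<alpha> - 1) * (2 * (p t \<bullet> - f (u t)))) (at t within {0..})"
      by (rule DERIV_chain2[rotated])
    then show ?thesis by (simp add: G_def[abs_def] G'_def mult_ac)
  qed
  have Yinv: "Y t powr (\<alpha> + 1) * Y t powr (- \<alpha> - 1) = 1" if "T1 \<le> t" for t
    using Y0[OF that] by (simp flip: powr_add)
  have G'_low: "2 * \<alpha> * k \<le> G' t" if t: "T1 \<le> t" for t
  proof -
    have "2 * \<alpha> * (k * Y t powr (\<alpha> + 1)) * Y t powr (- \<alpha> - 1) \<le> G' t"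
      unfolding G'_def using pf_low[OF t] \<alpha>_pos by (intro mult_right_mono mult_left_mono) auto
    moreover have "2 * \<alpha> * (k * Y t powr (\<alpha> + 1)) * Y t powr (- \<alpha> - 1)
        = 2 * \<alpha> * k * (Y t powr (\<alpha> + 1) * Y t powr (- \<alpha> - 1))" by (simp only: mult.assoc)
    ultimately show ?thesis using Yinv[OF t] by simp
  qed
  have G'_up: "G' t \<le> 2 * \<alpha> * K" if t: "T1 \<le> t" for t
  proof -
    have "G' t \<le> 2 * \<alpha> * (K * Y t powr (\<alpha> + 1)) * Y t powr (- \<alpha> - 1)"
      unfolding G'_def using pf_up[OF t] \<alpha>_pos by (intro mult_right_mono mult_left_mono) auto
    moreover have "2 * \<alpha> * (K * Y t powr (\<alpha> + 1)) * Y t powr (- \<alpha> - 1)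
        = 2 * \<alpha> * K * (Y t powr (\<alpha> + 1) * Y t powr (- \<alpha> - 1))" by (simp only: mult.assoc)
    ultimately show ?thesis using Yinv[OF t] by simp
  qed
  have G0: "0 < G t" if "T1 \<le> t" for t using Y0[OF that] by (simp add: G_def)
  have G_low: "2 * \<alpha> * k * (t - T1) \<le> G t" if t: "T1 \<le> t" for t
  proof -
    have "G T1 - 2 * \<alpha> * k * T1 \<le> G t - 2 * \<alpha> * k * t"
    proof (rule has_real_derivative_nonneg_imp_le[OF t T1(3)])
      fix s assume s: "T1 \<le> s" "s \<le> t"
      show "((\<lambda>t. G t - 2 * \<alpha> * k * t) has_real_derivative G' s - 2 * \<alpha> * k * 1) (at s within {0..})"
        by (intro DERIV_diff DERIV_cmult DERIV_ident G' s)
      show "0 \<le> G' s - 2 * \<alpha> * k * 1" using G'_low[OF s(1)] by simp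
    qed
    then show ?thesis using G0[of T1] by (simp add: right_diff_distrib)
  qed
  have G_up: "G t \<le> G T1 + 2 * \<alpha> * K * (t - T1)" if t: "T1 \<le> t" for t
  proof -
    have "G t - 2 * \<alpha> * K * t \<le> G T1 - 2 * \<alpha> * K * T1"
    proof (rule has_real_derivative_nonpos_imp_ge[OF t T1(3)])
      fix s assume s: "T1 \<le> s" "s \<le> t"
      show "((\<lambda>t. G t - 2 * \<alpha> * K * t) has_real_derivative G' s - 2 * \<alpha> * K * 1) (at s within {0..})"
        by (intro DERIV_diff DERIV_cmult DERIV_ident G' s)
      show "G' s - 2 * \<alpha> * K * 1 \<le> 0" using G'_up[OF s(1)] by simp
    qed
    then show ?thesis by (simp add: right_diff_distrib)
  qed
  define m where "m = - 1 / (2 * \<alpha>)"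
  have m: "m \<le> 0" using \<alpha>_pos by (simp add: m_def)
  have pG: "norm (p t) = G t powr m" if "T1 \<le> t" for t
  proof -
    have "G t = norm (p t) powr (2 * - \<alpha>)" unfolding G_def Y_def by (rule powr_double[symmetric]) simp
    then have "G t powr m = norm (p t) powr (2 * - \<alpha> * m)" by (simp add: powr_powr)
    also have "2 * - \<alpha> * m = 1" using \<alpha>_pos by (simp add: m_def)
    finally show ?thesis using p0[OF that] by simp
  qed
  define c1 where "c1 = \<alpha> * k"
  define c2 where "c2 = G T1 + 2 * \<alpha> * K"
  have c12: "0 < c1" "0 < c2" using \<alpha>_pos k0 K0 G0[of T1] by (auto simp: c1_def c2_def add_pos_pos)
  \<comment> \<open>From 2 T1 + 1 on, 1 + t <= 2 (t - T1), which turns growth in t - T1 into growth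
    in 1 + t. The exponent m is negative, so bounds on G change sides.\<close>
  have main: "c2 powr m / 2 * (1 + t) powr m \<le> norm (u t) \<and> norm (u t) \<le> 2 * c1 powr m * (1 + t) powr m"
    if t: "2 * T1 + 1 \<le> t" for t
  proof -
    have tT: "T1 \<le> t" "0 \<le> t" using t T1 by auto
    have "c1 * (1 + t) \<le> c1 * (2 * (t - T1))" using t c12 by (intro mult_left_mono) auto
    also have "\<dots> \<le> G t" using G_low[OF tT(1)] by (simp add: c1_def mult_ac)
    finally have "G t powr m \<le> (c1 * (1 + t)) powr m"
      using m c12 tT by (intro powr_mono2') auto
    also have "\<dots> = c1 powr m * (1 + t) powr m" by (rule powr_mult)
    finally have up: "norm (p t) \<le> c1 powr m * (1 + t) powr m" using pG[OF tT(1)] by simp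
    have "G T1 \<le> G T1 * (1 + t)" using G0[of T1] tT by (simp add: algebra_simps)
    moreover have "2 * \<alpha> * K * (t - T1) \<le> 2 * \<alpha> * K * (1 + t)"
      using T1 \<alpha>_pos K0 by (intro mult_left_mono) auto
    ultimately have "G t \<le> c2 * (1 + t)"
      using G_up[OF tT(1)] unfolding c2_def distrib_right by linarith
    then have "(c2 * (1 + t)) powr m \<le> G t powr m"
      using m G0[OF tT(1)] by (intro powr_mono2') auto
    moreover have "(c2 * (1 + t)) powr m = c2 powr m * (1 + t) powr m" by (rule powr_mult)
    ultimately have low: "c2 powr m * (1 + t) powr m \<le> norm (p t)" using pG[OF tT(1)] by simp
    show ?thesis using up low u_up[OF tT(1)] u_low[OF tT(1)] by simp
  qed
  have "\<forall>\<^sub>F t in at_top. c2 powr m / 2 * (1 + t) powr m \<le> norm (u t) \<and> norm (u t) \<le> 2 * c1 powr m * (1 + t) powr m"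
    using eventually_ge_at_top[of "2 * T1 + 1"] by eventually_elim (rule main)
  moreover have "0 < c2 powr m / 2" "0 < 2 * c1 powr m" using c12 by auto
  ultimately show ?thesis unfolding slow_solution_def m_def[symmetric] by blast
qed

end

section \<open>Fast solutions with prescribed leading term\<close>

context damped_wave
begin

text \<open>\<open>f\<close> is superlinear, so its Lipschitz constant on |u| <= R tends to 0 with
  R; there |S u| <= M R. The left-hand side is the contraction factor of the fixed point map for
  fast solutions.\<close>

lemma small_Lip_exists: "\<exists>R>0. 2 / (2 * \<alpha>) * Lip (M * R) \<le> 1/2"
proof -
  define D where "D = M\<^sup>2 * (1 + 2 * \<alpha>)"
  define e where "e = \<alpha> / (2 * D)"
  define R where "R = e powr (1 / (2 * \<alpha>)) / M"
  have D: "0 < D" using \<alpha>_pos M_pos by (simp add: D_def)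
  have e: "0 < e" using \<alpha>_pos D by (simp add: e_def)
  have "(M * R) powr (2 * \<alpha>) = e" using e \<alpha>_pos M_pos by (simp add: R_def powr_powr)
  then have "Lip (M * R) = D * e" by (simp add: Lip_def D_def)
  also have "\<dots> = \<alpha> / 2" using D by (simp add: e_def)
  finally have "2 / (2 * \<alpha>) * Lip (M * R) = 1/2" using \<alpha>_pos by simp
  moreover have "0 < R" using e M_pos by (simp add: R_def)
  ultimately show ?thesis by (intro exI[of _ R]) simp
qed

text \<open>The weight is largest at s = r. Pulling it out lets the prefactor r^(-b) of the fixed
  point equation cancel it, so the apparent singularity at r = 0 is harmless.\<close>

lemma norm_integral_weighted_le:
  fixes h :: "real \<Rightarrow> 'b::banach"
  assumes "0 \<le> b" "0 \<le> r" and h: "continuous_on {0..r} h" and le: "\<And>s. 0 \<le> s \<Longrightarrow> s \<le> r \<Longrightarrow> norm (h s) \<le> G"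
  shows "norm (integral {0..r} (\<lambda>s. s powr b *\<^sub>R h s)) \<le> r powr b * (G * r)"
proof (cases "b = 0")
  case True
  show ?thesis
  proof (cases "r = 0")
    case False
    \<comment> \<open>Since \<open>0 powr 0 = 0\<close>, the weight for b = 0 differs from 1 at the
      single point 0.\<close>
    have "integral {0..r} (\<lambda>s. s powr b *\<^sub>R h s) = integral {0..r} h"
      by (rule integral_spike[of "{0}"]) (auto simp: True)
    moreover have "norm (integral {0..r} h) \<le> G * (r - 0)"
      by (rule integral_bound[OF \<open>0 \<le> r\<close> h]) (use le in auto)
    ultimately show ?thesis using False \<open>0 \<le> r\<close> True by simp
  qed simp
next
  case False
  then have b: "0 < b" using assms by simp
  have "norm (integral {0..r} (\<lambda>s. s powr b *\<^sub>R h s)) \<le> (r powr b * G) * (r - 0)"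
  proof (rule integral_bound[OF \<open>0 \<le> r\<close>])
    show "continuous_on {0..r} (\<lambda>s. s powr b *\<^sub>R h s)"
      using b by (intro continuous_on_scaleR h continuous_on_powr' continuous_on_id continuous_on_const) auto
    fix s assume s: "s \<in> {0..r}"
    then have "s powr b \<le> r powr b" using b by (intro powr_mono2) auto
    then show "norm (s powr b *\<^sub>R h s) \<le> r powr b * G"
      using le[of s] s by (simp add: mult_mono)
  qed
  then show ?thesis by (simp add: mult_ac)
qed

text \<open>With u + z tending to 0 and exp(t) z to -v0, integration from infinity gives u + z as
  the integral of f(u) over [t, infinity), and exp(t) z as -v0 plus that of exp(s) f(u(s)).
  Substituting u = exp(-t) w(r), f(u) = exp(-t) r f(w(r)) and dr = -2\<alpha> r dt turns both into
  integrals over [0, r], where r^\<beta> = exp(-t) for \<beta> = 1 / (2\<alpha>).\<close>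

lemma fast_sol_exists: "\<exists>r>0. \<forall>v0. norm v0 < r \<longrightarrow> (\<exists>u z. sol u z \<and> fast_with \<alpha> v0 u)"
proof -
  obtain R where R: "0 < R" "2 / (2 * \<alpha>) * Lip (M * R) \<le> 1/2"
    using small_Lip_exists by blast
  define \<beta> where "\<beta> = 1 / (2 * \<alpha>)"
  have \<beta>: "0 < \<beta>" "2 * \<alpha> * \<beta> = 1" using \<alpha>_pos by (auto simp: \<beta>_def)
  define L where "L = Lip (M * R)"
  have L: "0 \<le> L" "2 * \<beta> * L \<le> 1/2" using Lip_nonneg R(2) by (auto simp: L_def \<beta>_def)
  have f_lip: "norm (f x - f y) \<le> L * norm (x - y)" if "norm x \<le> R" "norm y \<le> R" for x y
    unfolding L_def
  proof (rule f_Lipschitz)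
    show "0 < M * R" using R M_pos by simp
    show "norm (S x) \<le> M * R" "norm (S y) \<le> M * R"
      using bound_S[of x] bound_S[of y] mult_left_mono[OF that(1), of M] mult_left_mono[OF that(2), of M] M_pos
      by linarith+
  qed
  \<comment> \<open>Half of the radius R is left to v0, the other half to the integral
    terms.\<close>
  have "\<exists>u z. sol u z \<and> fast_with \<alpha> v0 u" if v0: "norm v0 < R / 2" for v0
  proof -
    define g where "g w s = f (apply_bcontfun w s)" for w :: "real \<Rightarrow>\<^sub>C 'a" and s
    have cg: "continuous_on A (g w)" for A w
      unfolding g_def by (rule continuous_on_compose2[OF continuous_on_f[of UNIV]]) auto
    have cpg: "continuous_on {0..r} (\<lambda>s. s powr \<beta> *\<^sub>R g w s)" for w r
      using \<beta>(1) by (intro continuous_on_scaleR cg continuous_on_powr' continuous_on_id continuous_on_const) auto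
    \<comment> \<open>P is -exp(t) z and \<beta> Q is u + z, both seen as functions of r. As
      r^(-\<beta>) = exp(t), \<open>\<Psi>\<close> is exp(t) u.\<close>
    define P where "P w r = v0 - \<beta> *\<^sub>R integral {0..r} (g w)" for w r
    define Q where "Q w r = integral {0..r} (\<lambda>s. s powr \<beta> *\<^sub>R g w s)" for w r
    define \<Psi> where "\<Psi> w r = P w r + (\<beta> * r powr (- \<beta>)) *\<^sub>R Q w r" for w r
    \<comment> \<open>Clamping to [0, 1] extends functions of r to bounded continuous functions on
      the line.\<close>
    define \<kappa> :: "real \<Rightarrow> real" where "\<kappa> r = max 0 (min 1 r)" for r
    have \<kappa>: "0 \<le> \<kappa> r" "\<kappa> r \<le> 1" for r by (auto simp: \<kappa>_def)
    have intg: "g w integrable_on {0..r}" "(\<lambda>s. s powr \<beta> *\<^sub>R g w s) integrable_on {0..r}" for w r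
      by (rule integrable_continuous_real[OF cg] integrable_continuous_real[OF cpg])+
    have kernel: "norm (\<beta> *\<^sub>R integral {0..r} h) \<le> \<beta> * (G * r)"
      "norm ((\<beta> * r powr (- \<beta>)) *\<^sub>R integral {0..r} (\<lambda>s. s powr \<beta> *\<^sub>R h s)) \<le> \<beta> * (G * r)"
      if r: "0 \<le> r" and h: "continuous_on {0..r} h" and le: "\<And>s. 0 \<le> s \<Longrightarrow> s \<le> r \<Longrightarrow> norm (h s) \<le> G"
      for r G and h :: "real \<Rightarrow> 'a"
    proof -
      have "norm (integral {0..r} h) \<le> G * (r - 0)"
        by (rule integral_bound[OF r h]) (use le in auto)
      then show "norm (\<beta> *\<^sub>R integral {0..r} h) \<le> \<beta> * (G * r)"
        using \<beta>(1) by (simp add: mult_left_mono)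
      have "norm (integral {0..r} (\<lambda>s. s powr \<beta> *\<^sub>R h s)) \<le> r powr \<beta> * (G * r)"
        by (rule norm_integral_weighted_le[OF _ r h le]) (use \<beta>(1) in auto)
      then have "(\<beta> * r powr (- \<beta>)) * norm (integral {0..r} (\<lambda>s. s powr \<beta> *\<^sub>R h s))
          \<le> (\<beta> * r powr (- \<beta>)) * (r powr \<beta> * (G * r))"
        by (rule mult_left_mono) (use \<beta>(1) in auto)
      also have "\<dots> = \<beta> * (G * r)"
        using r by (cases "r = 0") (auto simp: powr_minus)
      finally show "norm ((\<beta> * r powr (- \<beta>)) *\<^sub>R integral {0..r} (\<lambda>s. s powr \<beta> *\<^sub>R h s)) \<le> \<beta> * (G * r)"
        using \<beta>(1) by simp
    qed
    have g_le: "norm (g w s) \<le> L * R" if "norm w \<le> R" for w s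
    proof -
      have w: "norm (w s) \<le> R" using norm_bounded[of w s] that by simp
      have "norm (f (w s) - f 0) \<le> L * norm (w s - 0)" by (rule f_lip[OF w]) (use R in simp)
      also have "\<dots> \<le> L * R" using w L(1) by (simp add: mult_left_mono)
      finally show ?thesis by (simp add: g_def)
    qed
    have g_diff: "norm (g w s - g v s) \<le> L * dist w v" if "norm w \<le> R" "norm v \<le> R" for w v s
    proof -
      have "norm (g w s - g v s) \<le> L * norm (w s - v s)"
        unfolding g_def using norm_bounded[of w s] norm_bounded[of v s] that by (intro f_lip) auto
      also have "\<dots> \<le> L * dist w v"
        using L(1) dist_bounded[of w s v] by (simp add: mult_left_mono dist_norm)
      finally show ?thesis .
    qed
    have \<Psi>_le: "norm (\<Psi> w r) \<le> R" if w: "norm w \<le> R" and r: "0 \<le> r" "r \<le> 1" for w r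
    proof -
      note k = kernel[OF r(1) cg g_le[OF w]]
      have LR: "\<beta> * (L * R * r) \<le> \<beta> * (L * R)"
        using \<beta>(1) L(1) R(1) r by (intro mult_left_mono) (auto simp: mult_left_le)
      have "norm (\<Psi> w r) \<le> norm v0 + norm (\<beta> *\<^sub>R integral {0..r} (g w)) + norm ((\<beta> * r powr (- \<beta>)) *\<^sub>R Q w r)"
        unfolding \<Psi>_def P_def
        by (intro order_trans[OF norm_triangle_ineq] add_right_mono norm_triangle_ineq4)
      also have "\<dots> \<le> R / 2 + \<beta> * (L * R) + \<beta> * (L * R)"
        using v0 k LR unfolding Q_def by linarith
      also have "\<dots> = R / 2 + (2 * \<beta> * L) * R" by simp
      also have "\<dots> \<le> R / 2 + (1/2) * R" using L(2) R(1) by (intro add_left_mono mult_right_mono) auto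
      finally show ?thesis by simp
    qed
    have \<Psi>_diff: "norm (\<Psi> w r - \<Psi> v r) \<le> (1/2) * dist w v"
      if wv: "norm w \<le> R" "norm v \<le> R" and r: "0 \<le> r" "r \<le> 1" for w v r
    proof -
      let ?h = "\<lambda>s. g w s - g v s"
      have h: "continuous_on {0..r} ?h" by (intro continuous_on_diff cg)
      note k = kernel[OF r(1) h g_diff[OF wv]]
      have "integral {0..r} ?h = integral {0..r} (g w) - integral {0..r} (g v)"
        by (intro Henstock_Kurzweil_Integration.integral_diff intg)
      moreover have "integral {0..r} (\<lambda>s. s powr \<beta> *\<^sub>R ?h s) = Q w r - Q v r"
        unfolding Q_def scaleR_diff_right by (intro Henstock_Kurzweil_Integration.integral_diff intg)
      ultimately have "\<Psi> w r - \<Psi> v r = (\<beta> * r powr (- \<beta>)) *\<^sub>R integral {0..r} (\<lambda>s. s powr \<beta> *\<^sub>R ?h s)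
          - \<beta> *\<^sub>R integral {0..r} ?h"
        by (simp add: \<Psi>_def P_def scaleR_diff_right)
      then have "norm (\<Psi> w r - \<Psi> v r) \<le> norm ((\<beta> * r powr (- \<beta>)) *\<^sub>R integral {0..r} (\<lambda>s. s powr \<beta> *\<^sub>R ?h s))
          + norm (\<beta> *\<^sub>R integral {0..r} ?h)"
        by (metis norm_triangle_ineq4)
      also have "\<dots> \<le> \<beta> * (L * dist w v * r) + \<beta> * (L * dist w v * r)" using k by (intro add_mono)
      also have "\<dots> = (2 * \<beta> * L) * (dist w v * r)" by simp
      also have "\<dots> \<le> (1/2) * (dist w v * r)" using L(2) r by (intro mult_right_mono) auto
      also have "\<dots> \<le> (1/2) * dist w v" using r by (simp add: mult_left_le)
      finally show ?thesis .
    qed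
    have cont\<Psi>: "continuous_on {0..1} (\<Psi> w)" if w: "norm w \<le> R" for w
    proof -
      have cP: "continuous_on {0..1} (P w)"
        unfolding P_def by (intro continuous_intros indefinite_integral_continuous_1 intg)
      have cQ: "continuous_on {0..1} (Q w)"
        unfolding Q_def by (intro indefinite_integral_continuous_1 intg)
      have "continuous_on {0..1} (\<lambda>r. (\<beta> * r powr (- \<beta>)) *\<^sub>R Q w r)"
        unfolding continuous_on_eq_continuous_within
      proof
        fix r :: real assume r: "r \<in> {0..1}"
        show "continuous (at r within {0..1}) (\<lambda>r. (\<beta> * r powr (- \<beta>)) *\<^sub>R Q w r)"
        proof (cases "r = 0")
          case True
          \<comment> \<open>The factor r^(-\<beta>) is singular here, but the kernel estimate makes
            the whole term O(r), matching its value 0 at r = 0.\<close>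
          have "((\<lambda>s. \<beta> * (L * R * s)) \<longlongrightarrow> \<beta> * (L * R * 0)) (at 0 within {0..1})"
            by (intro tendsto_intros)
          then have lim: "((\<lambda>s. \<beta> * (L * R * s)) \<longlongrightarrow> 0) (at 0 within {0..1})" by simp
          have "((\<lambda>r. (\<beta> * r powr (- \<beta>)) *\<^sub>R Q w r) \<longlongrightarrow> 0) (at 0 within {0..1})"
          proof (rule Lim_null_comparison[OF _ lim])
            show "\<forall>\<^sub>F s in at 0 within {0..1}. norm ((\<beta> * s powr (- \<beta>)) *\<^sub>R Q w s) \<le> \<beta> * (L * R * s)"
              unfolding eventually_at_filter
            proof (intro always_eventually allI impI)
              fix s :: real assume "s \<in> {0..1}"
              then show "norm ((\<beta> * s powr (- \<beta>)) *\<^sub>R Q w s) \<le> \<beta> * (L * R * s)"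
                unfolding Q_def by (intro kernel(2) cg g_le w) auto
            qed
          qed
          then show ?thesis using True by (simp add: continuous_within)
        next
          case False
          have "continuous_on {0<..1} (\<lambda>r. (\<beta> * r powr (- \<beta>)) *\<^sub>R Q w r)"
            by (intro continuous_on_scaleR continuous_on_mult continuous_on_const continuous_on_powr
                continuous_on_id continuous_on_subset[OF cQ]) auto
          then have "continuous (at r within {0<..1}) (\<lambda>r. (\<beta> * r powr (- \<beta>)) *\<^sub>R Q w r)"
            using r False by (simp add: continuous_on_eq_continuous_within)
          moreover have "at r within {0<..1} = at r within {0..1}"
            by (rule at_within_nhd[of _ "{0<..}"]) (use r False in auto)
          ultimately show ?thesis by simp
        qed
      qed
      then show ?thesis unfolding \<Psi>_def by (intro continuous_on_add cP)
    qed
    define \<Phi> where "\<Phi> w = Bcontfun (\<lambda>r. \<Psi> w (\<kappa> r))" for w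
    have \<Phi>: "apply_bcontfun (\<Phi> w) = (\<lambda>r. \<Psi> w (\<kappa> r))" if w: "norm w \<le> R" for w
      unfolding \<Phi>_def
    proof (intro Bcontfun_inverse bcontfun_normI)
      show "continuous_on UNIV (\<lambda>r. \<Psi> w (\<kappa> r))"
        by (rule continuous_on_compose2[OF cont\<Psi>[OF w]]) (auto simp: \<kappa>_def intro!: continuous_intros)
      show "norm (\<Psi> w (\<kappa> r)) \<le> R" for r by (rule \<Psi>_le[OF w \<kappa>])
    qed
    have "\<exists>!w. w \<in> cball 0 R \<and> \<Phi> w = w"
    proof (rule Banach_fix[of _ "1/2"])
      show "complete (cball (0::real \<Rightarrow>\<^sub>C 'a) R)" by (simp add: complete_eq_closed)
      show "cball (0::real \<Rightarrow>\<^sub>C 'a) R \<noteq> {}" using R(1) by simp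
      show "\<Phi> ` cball 0 R \<subseteq> cball 0 R"
      proof
        fix v assume "v \<in> \<Phi> ` cball 0 R"
        then obtain w where w: "norm w \<le> R" "v = \<Phi> w" by auto
        have "norm v \<le> R" unfolding w(2) by (rule norm_bound) (simp add: \<Phi>[OF w(1)] \<Psi>_le[OF w(1) \<kappa>])
        then show "v \<in> cball 0 R" by simp
      qed
      show "dist (\<Phi> w) (\<Phi> v) \<le> 1 / 2 * dist w v" if "w \<in> cball 0 R" "v \<in> cball 0 R" for w v
      proof (rule dist_bound)
        have wv: "norm w \<le> R" "norm v \<le> R" using that by auto
        show "dist (\<Phi> w r) (\<Phi> v r) \<le> 1 / 2 * dist w v" for r
          unfolding \<Phi>[OF wv(1)] \<Phi>[OF wv(2)] dist_norm[of "\<Psi> _ _"] by (rule \<Psi>_diff[OF wv \<kappa>])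
      qed
    qed auto
    then obtain w where w: "norm w \<le> R" "\<Phi> w = w" by auto
    have wr: "w r = P w r + (\<beta> * r powr (- \<beta>)) *\<^sub>R Q w r" if "0 \<le> r" "r \<le> 1" for r
      using fun_cong[OF \<Phi>[OF w(1)], of r] that by (simp add: w(2) \<kappa>_def \<Psi>_def)
    define \<rho> where "\<rho> t = exp (- (2 * \<alpha>) * t)" for t
    have \<rho>: "0 < \<rho> t" "0 \<le> t \<Longrightarrow> \<rho> t \<le> 1" for t using \<alpha>_pos by (auto simp: \<rho>_def)
    have \<rho>\<beta>: "\<rho> t powr \<beta> = exp (- t)" "\<rho> t powr (- \<beta>) = exp t" for t
      using \<beta>(2) by (auto simp: \<rho>_def powr_def mult.commute)
    have \<rho>': "(\<rho> has_vector_derivative - (2 * \<alpha>) * \<rho> t) (at t within A)" for t A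
      unfolding \<rho>_def[abs_def] has_real_derivative_iff_has_vector_derivative[symmetric]
      by (auto intro!: derivative_eq_intros)
    have ftc: "((\<lambda>t. integral {0..\<rho> t} h) has_vector_derivative (- (2 * \<alpha>) * \<rho> t) *\<^sub>R h (\<rho> t)) (at t within {0..})"
      if h: "\<And>r. continuous_on {0..r} h" for h :: "real \<Rightarrow> 'a" and t
    proof -
      have "((\<lambda>r. integral {0..r} h) has_vector_derivative h (\<rho> t)) (at (\<rho> t) within {0..\<rho> t + 1})"
        by (rule integral_has_vector_derivative[OF h]) (use \<rho>(1)[of t] in auto)
      moreover have "at (\<rho> t) within {0..\<rho> t + 1} = at (\<rho> t)"
        by (rule at_within_interior) (use \<rho>(1)[of t] in auto)
      ultimately have "((\<lambda>r. integral {0..r} h) has_vector_derivative h (\<rho> t)) (at (\<rho> t) within \<rho> ` {0..})"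
        by (simp add: has_vector_derivative_at_within)
      from vector_diff_chain_within[OF \<rho>' this] show ?thesis by (simp add: o_def)
    qed
    \<comment> \<open>w is a priori only continuous, so u and z are built from the integrals P and
      Q, which are differentiable. The fixed point equation then identifies u with exp(-t) w(\<rho>
      t).\<close>
    define u where "u t = exp (- t) *\<^sub>R P w (\<rho> t) + \<beta> *\<^sub>R Q w (\<rho> t)" for t
    define z where "z t = - exp (- t) *\<^sub>R P w (\<rho> t)" for t
    have P': "((\<lambda>t. P w (\<rho> t)) has_vector_derivative \<rho> t *\<^sub>R g w (\<rho> t)) (at t within {0..})" for t
    proof -
      have "((\<lambda>t. P w (\<rho> t)) has_vector_derivative 0 - \<beta> *\<^sub>R ((- (2 * \<alpha>) * \<rho> t) *\<^sub>R g w (\<rho> t))) (at t within {0..})"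
        unfolding P_def
        by (intro has_vector_derivative_diff has_vector_derivative_const
            bounded_linear.has_vector_derivative[OF bounded_linear_scaleR_right] ftc cg)
      moreover have "0 - \<beta> *\<^sub>R ((- (2 * \<alpha>) * \<rho> t) *\<^sub>R g w (\<rho> t)) = (2 * \<alpha> * \<beta>) *\<^sub>R \<rho> t *\<^sub>R g w (\<rho> t)"
        by (simp add: mult_ac)
      ultimately show ?thesis by (simp only: \<beta>(2) scaleR_one)
    qed
    have Q': "((\<lambda>t. \<beta> *\<^sub>R Q w (\<rho> t)) has_vector_derivative - (exp (- t) * \<rho> t) *\<^sub>R g w (\<rho> t)) (at t within {0..})" for t
    proof -
      have "((\<lambda>t. \<beta> *\<^sub>R Q w (\<rho> t)) has_vector_derivative
          \<beta> *\<^sub>R ((- (2 * \<alpha>) * \<rho> t) *\<^sub>R (\<rho> t powr \<beta> *\<^sub>R g w (\<rho> t)))) (at t within {0..})"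
        unfolding Q_def
        by (intro bounded_linear.has_vector_derivative[OF bounded_linear_scaleR_right] ftc cpg)
      moreover have "\<beta> *\<^sub>R ((- (2 * \<alpha>) * \<rho> t) *\<^sub>R (\<rho> t powr \<beta> *\<^sub>R g w (\<rho> t)))
          = (2 * \<alpha> * \<beta>) *\<^sub>R (- (exp (- t) * \<rho> t)) *\<^sub>R g w (\<rho> t)"
        by (simp add: \<rho>\<beta> mult_ac)
      ultimately show ?thesis by (simp only: \<beta>(2) scaleR_one)
    qed
    have e': "((\<lambda>t. exp (- t)) has_real_derivative - exp (- t)) (at t within {0..})" for t :: real
      by (auto intro!: derivative_eq_intros)
    have eP': "((\<lambda>t. exp (- t) *\<^sub>R P w (\<rho> t)) has_vector_derivative
        exp (- t) *\<^sub>R (\<rho> t *\<^sub>R g w (\<rho> t)) + (- exp (- t)) *\<^sub>R P w (\<rho> t)) (at t within {0..})" for t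
      by (rule has_vector_derivative_scaleR[OF e' P'])
    have u': "(u has_vector_derivative z t) (at t within {0..})" for t
      using has_vector_derivative_add[OF eP' Q'] unfolding u_def[abs_def] z_def by simp
    have u_eq: "u t = exp (- t) *\<^sub>R w (\<rho> t)" if "0 \<le> t" for t
      using wr[of "\<rho> t"] \<rho>(1)[of t] \<rho>(2)[OF that]
      by (simp add: u_def \<rho>\<beta> scaleR_add_right mult.left_commute flip: exp_add)
    have f_u: "f (u t) = (exp (- t) * \<rho> t) *\<^sub>R g w (\<rho> t)" if "0 \<le> t" for t
    proof -
      have "exp (- t) powr (2 * \<alpha> + 1) = exp (- t) * \<rho> t"
        by (simp add: powr_def \<rho>_def algebra_simps flip: exp_add)
      then show ?thesis using f_scaleR[of "exp (- t)" "w (\<rho> t)"] by (simp add: u_eq[OF that] g_def)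
    qed
    have z': "(z has_vector_derivative - z t - f (u t)) (at t within {0..})" if "0 \<le> t" for t
      using has_vector_derivative_minus[OF eP'] unfolding z_def[abs_def] f_u[OF that] by simp
    have "sol u z" unfolding sol_def using u' z' by blast
    moreover have "fast_with \<alpha> v0 u"
    proof (rule fast_withI[OF u'])
      fix t :: real assume t: "0 \<le> t"
      note k = kernel[OF less_imp_le[OF \<rho>(1)] cg g_le[OF w(1)], of t]
      have "z t + exp (- t) *\<^sub>R v0 = exp (- t) *\<^sub>R \<beta> *\<^sub>R integral {0..\<rho> t} (g w)"
        by (simp add: z_def P_def scaleR_diff_right)
      then have "norm (z t + exp (- t) *\<^sub>R v0) = exp (- t) * norm (\<beta> *\<^sub>R integral {0..\<rho> t} (g w))"
        by (simp add: abs_mult)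
      also have "\<dots> \<le> exp (- t) * (\<beta> * (L * R * \<rho> t))"
        by (rule mult_left_mono[OF k(1)]) simp
      finally have 1: "norm (z t + exp (- t) *\<^sub>R v0) \<le> exp (- t) * (\<beta> * (L * R * \<rho> t))" .
      have "u t - exp (- t) *\<^sub>R v0 = exp (- t) *\<^sub>R (w (\<rho> t) - v0)"
        by (simp add: u_eq[OF t] scaleR_diff_right)
      also have "w (\<rho> t) - v0 = (\<beta> * \<rho> t powr (- \<beta>)) *\<^sub>R Q w (\<rho> t) - \<beta> *\<^sub>R integral {0..\<rho> t} (g w)"
        using wr[of "\<rho> t"] \<rho>(1)[of t] \<rho>(2)[OF t] by (simp add: P_def)
      finally have "norm (u t - exp (- t) *\<^sub>R v0) = exp (- t) * norm ((\<beta> * \<rho> t powr (- \<beta>)) *\<^sub>R Q w (\<rho> t) - \<beta> *\<^sub>R integral {0..\<rho> t} (g w))"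
        by simp
      also have "\<dots> \<le> exp (- t) * (\<beta> * (L * R * \<rho> t) + \<beta> * (L * R * \<rho> t))"
        unfolding Q_def by (intro mult_left_mono order_trans[OF norm_triangle_ineq4] add_mono k) auto
      finally have "norm (z t + exp (- t) *\<^sub>R v0) + norm (u t - exp (- t) *\<^sub>R v0)
          \<le> 3 * (\<beta> * (L * R)) * (exp (- t) * \<rho> t)"
        using 1 by (simp add: algebra_simps)
      also have "exp (- t) * \<rho> t = exp (- (1 + 2 * \<alpha>) * t)"
        by (simp add: \<rho>_def algebra_simps flip: exp_add)
      finally show "norm (z t + exp (- t) *\<^sub>R v0) + norm (u t - exp (- t) *\<^sub>R v0)
          \<le> 3 * (\<beta> * (L * R)) * exp (- (1 + 2 * \<alpha>) * t)" .
    qed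
    ultimately show ?thesis by blast
  qed
  then show ?thesis using R(1) by (intro exI[of _ "R / 2"]) auto
qed

end

section \<open>The theorem for Banach-class Hilbert spaces\<close>

context damped_wave
begin

lemma sol_slow_or_fast:
  assumes uz: "sol u z" and nz: "\<exists>t\<ge>0. u t \<noteq> 0"
  shows "slow_solution \<alpha> u \<or> fast_solution \<alpha> u"
proof -
  obtain T where T: "0 \<le> T" "small_from u T" using small_from_exists[OF uz] by blast
  show ?thesis
  proof (cases "\<exists>t\<ge>T. 0 < N u z t")
    case True
    then obtain t where t: "T \<le> t" "0 < N u z t" by blast
    have "slow_solution \<alpha> u"
      by (rule slow_of_N_pos[OF uz _ small_from_mono[OF T(2) t(1)] t(2)]) (use T t in simp)
    then show ?thesis ..
  next
    case False
    then have "fast_solution \<alpha> u"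
      by (intro fast_of_N_nonpos[OF uz T _ nz]) (meson linorder_not_less)
    then show ?thesis ..
  qed
qed

text \<open>Two open conditions suffice. Energy below e confines |S u| below r for all times, so the
  smallness regime holds from time 0, and |z| < |u + z| says that N is positive at time 0.\<close>

lemma open_slow_data:
  assumes "\<exists>x::'a. x \<noteq> 0"
  shows "\<exists>A :: ('a \<times> 'a) set. open A \<and> A \<noteq> {} \<and>
    (\<forall>(u0, u1)\<in>A. \<forall>u z. sol u z \<longrightarrow> u 0 = u0 \<longrightarrow> z 0 = u1 \<longrightarrow> slow_solution \<alpha> u)"
proof -
  \<comment> \<open>r solves r^(2\<alpha>) M^2 = 1/4, the threshold in \<open>small_from\<close>; e
    below is the potential energy at |S u| = r.\<close>
  define r where "r = (1 / (4 * M\<^sup>2)) powr (1 / (2 * \<alpha>))"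
  have r: "0 < r" using M_pos by (simp add: r_def)
  have r_powr: "r powr (2 * \<alpha>) * M\<^sup>2 = 1/4" using M_pos \<alpha>_pos by (simp add: r_def powr_powr)
  define e where "e = r powr (2 * \<alpha> + 2) / (2 * \<alpha> + 2)"
  define A where "A = {x :: 'a \<times> 'a. E (fst x) (snd x) < e} \<inter> {x. norm (snd x) < norm (fst x + snd x)}"
  have "continuous_on UNIV (\<lambda>x. norm (S (fst x)) powr (2 * \<alpha> + 2))"
    using \<alpha>_pos by (intro continuous_on_powr' continuous_on_norm S.continuous_on continuous_on_fst
        continuous_on_id continuous_on_const) auto
  then have "continuous_on UNIV (\<lambda>x. E (fst x) (snd x))"
    unfolding E_def using \<alpha>_pos
    by (intro continuous_on_add continuous_on_divide continuous_on_const continuous_on_power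
        continuous_on_norm continuous_on_snd continuous_on_id) auto
  then have "open A"
    unfolding A_def by (intro open_Int open_Collect_less continuous_intros)
  moreover have "A \<noteq> {}"
  proof -
    obtain x :: 'a where x: "x \<noteq> 0" using assms by blast
    \<comment> \<open>At zero velocity N is |u|^2 > 0; k scales x so that |S (k x)| <= r /
      2.\<close>
    define k where "k = r / (2 * (M * norm x))"
    have k: "0 < k" using x r M_pos by (simp add: k_def)
    have "norm (S (k *\<^sub>R x)) \<le> M * norm (k *\<^sub>R x)" by (rule bound_S)
    also have "\<dots> = r / 2" using k x M_pos r by (simp add: k_def)
    also have "\<dots> < r" using r by simp
    finally have "norm (S (k *\<^sub>R x)) powr (2 * \<alpha> + 2) < r powr (2 * \<alpha> + 2)"
      using \<alpha>_pos by (intro powr_less_mono2) auto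
    then have "E (k *\<^sub>R x) 0 < e" using \<alpha>_pos by (simp add: E_def e_def divide_strict_right_mono)
    then have "(k *\<^sub>R x, 0) \<in> A" using k x by (simp add: A_def)
    then show ?thesis by blast
  qed
  moreover have "slow_solution \<alpha> u" if init: "(u 0, z 0) \<in> A" and uz: "sol u z" for u z
  proof (rule slow_of_N_pos[OF uz order_refl])
    have E0: "(2 * \<alpha> + 2) * E (u 0) (z 0) < r powr (2 * \<alpha> + 2)"
      using init \<alpha>_pos by (simp add: A_def e_def field_simps)
    show "small_from u 0"
      unfolding small_from_def
    proof (intro allI impI)
      fix t :: real assume t: "0 \<le> t"
      have "(2 * \<alpha> + 2) * E (u t) (z t) \<le> (2 * \<alpha> + 2) * E (u 0) (z 0)"
        using sol_energy_decreasing[OF uz order_refl t] \<alpha>_pos by (intro mult_left_mono) auto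
      then have "norm (S (u t)) powr (2 * \<alpha> + 2) < r powr (2 * \<alpha> + 2)"
        using potential_le_E[of "u t" "z t"] E0 by linarith
      then have "norm (S (u t)) < r" by (rule potential_less_imp[OF _ r])
      then have "norm (S (u t)) powr (2 * \<alpha>) * M\<^sup>2 \<le> r powr (2 * \<alpha>) * M\<^sup>2"
        using \<alpha>_pos by (intro mult_right_mono powr_mono2) auto
      then show "norm (S (u t)) powr (2 * \<alpha>) * M\<^sup>2 \<le> 1/4" by (simp only: r_powr)
    qed
    show "0 < N u z 0"
      using init power_strict_mono[of "norm (z 0)" "norm (u 0 + z 0)" 2] by (simp add: N_def A_def)
  qed
  ultimately show ?thesis by (intro exI[of _ A]) blast
qed

text \<open>In the direction from \<open>sol\<close>, the continuity of u'' is read off from the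
  equation, because \<open>f\<close> is continuous.\<close>

lemma is_solution_iff_sol:
  assumes "op_sqrt B = S" "\<And>x. S (S x) = B x"
  shows "is_solution B \<alpha> u0 u1 u \<longleftrightarrow> (\<exists>z. sol u z \<and> u 0 = u0 \<and> z 0 = u1)"
proof
  assume "is_solution B \<alpha> u0 u1 u"
  then obtain u' u'' where
    u': "\<And>t. 0 \<le> t \<Longrightarrow> (u has_vector_derivative u' t) (at t within {0..})" and
    u'': "\<And>t. 0 \<le> t \<Longrightarrow> (u' has_vector_derivative u'' t) (at t within {0..})" and
    init: "u 0 = u0" "u' 0 = u1" and
    eq: "\<And>t. 0 \<le> t \<Longrightarrow> u'' t + u' t + f (u t) = 0"
    unfolding is_solution_def assms(1) f_def assms(2) by blast
  have "u'' t = - u' t - f (u t)" if "0 \<le> t" for t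
    using eq[OF that] by (simp add: eq_diff_eq add_eq_0_iff2 add.assoc)
  then have "sol u u'" using u' u'' by (simp add: sol_def)
  then show "\<exists>z. sol u z \<and> u 0 = u0 \<and> z 0 = u1" using init by blast
next
  assume "\<exists>z. sol u z \<and> u 0 = u0 \<and> z 0 = u1"
  then obtain z where uz: "sol u z" and init: "u 0 = u0" "z 0 = u1" by blast
  have cu: "continuous_on {0..} u" "continuous_on {0..} z"
    using solD[OF uz] by (auto intro!: continuous_on_vector_derivative)
  have "continuous_on {0..} (\<lambda>t. - z t - f (u t))"
    by (intro continuous_on_diff continuous_on_minus cu continuous_on_compose2[OF continuous_on_f[of UNIV]]) auto
  moreover have "(- z t - f (u t)) + z t + norm (S (u t)) powr (2 * \<alpha>) *\<^sub>R B (u t) = 0" for t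
    by (simp add: f_def assms(2))
  ultimately show "is_solution B \<alpha> u0 u1 u"
    unfolding is_solution_def assms(1)
    by (intro exI[of _ z] exI[of _ "\<lambda>t. - z t - f (u t)"] conjI allI impI)
      (use solD[OF uz] init in auto)
qed

end

lemma theorem5p4_banach:
  fixes B :: "'a::{real_inner, banach} \<Rightarrow> 'a" and \<alpha> :: real
  assumes bl: "bounded_linear B" and sym: "sym_op B" and coer: "coercive_op B"
    and alpha: "\<alpha> > 0" and nontriv: "\<exists>x::'a. x \<noteq> 0"
  shows "\<exists>u. is_solution B \<alpha> u0 u1 u \<and> (\<forall>v. is_solution B \<alpha> u0 u1 v \<longrightarrow> (\<forall>t\<ge>0. v t = u t))"
    and "is_solution B \<alpha> u0 u1 u \<Longrightarrow> \<exists>t\<ge>0. u t \<noteq> 0 \<Longrightarrow> slow_solution \<alpha> u \<or> fast_solution \<alpha> u"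
    and "\<exists>S :: ('a \<times> 'a) set. open S \<and> S \<noteq> {} \<and>
            (\<forall>(u0, u1)\<in>S. \<forall>u. is_solution B \<alpha> u0 u1 u \<longrightarrow> slow_solution \<alpha> u)"
    and "\<exists>r>0. \<forall>v0. norm v0 < r \<longrightarrow> (\<exists>u0 u1 u. is_solution B \<alpha> u0 u1 u \<and> fast_with \<alpha> v0 u)"
proof -
  define S where "S = op_sqrt B"
  have S: "bounded_linear S" "sym_op S" "S \<circ> S = B"
    using op_sqrt_properties[OF bl sym coer] by (auto simp: S_def)
  have SS: "S (S x) = B x" for x using fun_cong[OF S(3), of x] by simp
  obtain c where c: "0 < c" "\<And>x. c * (norm x)\<^sup>2 \<le> B x \<bullet> x"
    using coer unfolding coercive_op_def by auto
  obtain M where M: "0 < M" "\<And>x. norm (S x) \<le> norm x * M"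
    using bounded_linear.pos_bounded[OF S(1)] by blast
  interpret damped_wave S \<alpha> "sqrt c" M
  proof (rule damped_wave.intro)
    show "bounded_linear S" by (rule S)
    show sym: "S x \<bullet> y = x \<bullet> S y" for x y using S(2) by (simp add: sym_op_def)
    show "0 < sqrt c" "0 < M" "0 < \<alpha>" using c M alpha by auto
    show "norm (S x) \<le> M * norm x" for x using M(2)[of x] by (simp add: mult.commute)
    show "sqrt c * norm x \<le> norm (S x)" for x
    proof (rule power2_le_imp_le)
      have "(sqrt c * norm x)\<^sup>2 = c * (norm x)\<^sup>2" using c(1) by (simp add: power_mult_distrib)
      also have "\<dots> \<le> S (S x) \<bullet> x" using c(2)[of x] by (simp add: SS)
      also have "\<dots> = (norm (S x))\<^sup>2" by (simp add: sym power2_norm_eq_inner)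
      finally show "(sqrt c * norm x)\<^sup>2 \<le> (norm (S x))\<^sup>2" .
    qed simp
  qed
  note iff = is_solution_iff_sol[OF S_def[symmetric] SS]
  show "\<exists>u. is_solution B \<alpha> u0 u1 u \<and> (\<forall>v. is_solution B \<alpha> u0 u1 v \<longrightarrow> (\<forall>t\<ge>0. v t = u t))" for u0 u1
  proof -
    obtain u z where uz: "sol u z" "u 0 = u0" "z 0 = u1" using sol_exists by blast
    have "v t = u t" if "sol v w" "v 0 = u0" "w 0 = u1" "0 \<le> t" for v w t
      using sol_unique[OF that(1) uz(1), of 0 t] that uz by simp
    then show ?thesis unfolding iff using uz by blast
  qed
  show "slow_solution \<alpha> u \<or> fast_solution \<alpha> u"
    if "is_solution B \<alpha> u0 u1 u" "\<exists>t\<ge>0. u t \<noteq> 0" for u0 u1 u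
    using that sol_slow_or_fast unfolding iff by blast
  show "\<exists>S :: ('a \<times> 'a) set. open S \<and> S \<noteq> {} \<and>
      (\<forall>(u0, u1)\<in>S. \<forall>u. is_solution B \<alpha> u0 u1 u \<longrightarrow> slow_solution \<alpha> u)"
    using open_slow_data[OF nontriv] unfolding iff by (elim exE) (rule exI, blast)
  show "\<exists>r>0. \<forall>v0. norm v0 < r \<longrightarrow> (\<exists>u0 u1 u. is_solution B \<alpha> u0 u1 u \<and> fast_with \<alpha> v0 u)"
    using fast_sol_exists unfolding iff by blast
qed

section \<open>Removing the class \<open>banach\<close>\<close>

text \<open>A type variable of sort \<open>{real_inner, complete_space}\<close> is not known to be of class
  \<open>banach\<close>, although every instance satisfies its axioms. A copy of the type can be made an
  instance of \<open>banach\<close>, and the theorem is transported along the isometry.\<close>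

typedef 'a hilbert_copy = "UNIV :: 'a set"
  morphisms of_copy to_copy ..

lemma of_to_copy [simp]: "of_copy (to_copy x) = x"
  by (simp add: to_copy_inverse)

lemma to_of_copy [simp]: "to_copy (of_copy x) = x"
  by (rule of_copy_inverse)

lemma hilbert_copy_eq_iff: "x = y \<longleftrightarrow> of_copy x = of_copy y"
  by (simp add: of_copy_inject)

instantiation hilbert_copy :: (ab_group_add) ab_group_add
begin

definition "0 = to_copy 0"
definition "x + y = to_copy (of_copy x + of_copy y)"
definition "x - y = to_copy (of_copy x - of_copy y)"
definition "- x = to_copy (- of_copy x)"

instance
  by standard (simp_all add: zero_hilbert_copy_def plus_hilbert_copy_def minus_hilbert_copy_def
      uminus_hilbert_copy_def hilbert_copy_eq_iff add.assoc add.commute)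

end

instantiation hilbert_copy :: (real_vector) real_vector
begin

definition "r *\<^sub>R x = to_copy (r *\<^sub>R of_copy x)"

instance
  by standard (simp_all add: plus_hilbert_copy_def scaleR_hilbert_copy_def hilbert_copy_eq_iff
      scaleR_add_right scaleR_add_left)

end

instantiation hilbert_copy :: (real_inner) real_inner
begin

definition "x \<bullet> y = of_copy x \<bullet> of_copy y"
definition "norm x = norm (of_copy x)"
definition "sgn x = to_copy (sgn (of_copy x))"
definition "dist x y = dist (of_copy x) (of_copy y)"
definition uniformity_hilbert_copy :: "('a hilbert_copy \<times> 'a hilbert_copy) filter" where
  "uniformity_hilbert_copy = (INF e\<in>{0<..}. principal {(x, y). dist x y < e})"
definition open_hilbert_copy :: "'a hilbert_copy set \<Rightarrow> bool" where
  "open_hilbert_copy U \<longleftrightarrow> (\<forall>x\<in>U. \<forall>\<^sub>F (x', y) in uniformity. x' = x \<longrightarrow> y \<in> U)"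

instance
proof
  fix x y z :: "'a hilbert_copy" and a :: real
  note defs = zero_hilbert_copy_def plus_hilbert_copy_def minus_hilbert_copy_def
    scaleR_hilbert_copy_def inner_hilbert_copy_def norm_hilbert_copy_def
    sgn_hilbert_copy_def dist_hilbert_copy_def hilbert_copy_eq_iff
  show "dist x y = norm (x - y)" by (simp add: defs dist_norm)
  show "sgn x = x /\<^sub>R norm x" by (simp add: defs sgn_div_norm)
  show "uniformity = (INF e\<in>{0<..}. principal {(x :: 'a hilbert_copy, y). dist x y < e})"
    by (rule uniformity_hilbert_copy_def)
  show "open U = (\<forall>x\<in>U. \<forall>\<^sub>F (x', y) in uniformity. x' = x \<longrightarrow> y \<in> U)" for U :: "'a hilbert_copy set"
    by (rule open_hilbert_copy_def)
  show "x \<bullet> y = y \<bullet> x" by (simp add: defs inner_commute)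
  show "(x + y) \<bullet> z = x \<bullet> z + y \<bullet> z" "a *\<^sub>R x \<bullet> y = a * (x \<bullet> y)"
    "0 \<le> x \<bullet> x" "(x \<bullet> x = 0) = (x = 0)" "norm x = sqrt (x \<bullet> x)"
    by (simp_all add: defs inner_add_left norm_eq_sqrt_inner)
qed

end

instance hilbert_copy :: ("{real_inner, complete_space}") banach
proof
  fix X :: "nat \<Rightarrow> 'a hilbert_copy" assume "Cauchy X"
  then have "Cauchy (\<lambda>n. of_copy (X n))"
    unfolding Cauchy_def by (simp add: dist_hilbert_copy_def)
  then obtain l where "(\<lambda>n. of_copy (X n)) \<longlonglongrightarrow> l"
    using Cauchy_convergent_iff convergent_def by blast
  then have "X \<longlonglongrightarrow> to_copy l"
    unfolding lim_sequentially by (simp add: dist_hilbert_copy_def)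
  then show "convergent X" by (auto simp: convergent_def)
qed

section \<open>Transport of solutions along the isometry\<close>

lemma norm_of_copy [simp]: "norm (of_copy x) = norm x"
  by (simp add: norm_hilbert_copy_def)

lemma norm_to_copy [simp]: "norm (to_copy x) = norm x"
  by (simp add: norm_hilbert_copy_def)

lemma inner_to_copy_left: "to_copy x \<bullet> y = x \<bullet> of_copy y"
  by (simp add: inner_hilbert_copy_def)

lemma inner_of_copy_left: "of_copy x \<bullet> y = x \<bullet> to_copy y"
  by (simp add: inner_hilbert_copy_def)

lemma bounded_linear_of_copy: "bounded_linear of_copy"
  by (rule bounded_linear_intro[of _ 1])
    (simp_all add: plus_hilbert_copy_def scaleR_hilbert_copy_def)

lemma bounded_linear_to_copy: "bounded_linear to_copy"
  by (rule bounded_linear_intro[of _ 1])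
    (simp_all add: plus_hilbert_copy_def scaleR_hilbert_copy_def)

text \<open>J is applied to the equation term by term. Since \<open>op_sqrt\<close> is a definite
  description, invariance of |B^(1/2) u| is asked for separately.\<close>

lemma is_solution_map:
  fixes J :: "'a::real_inner \<Rightarrow> 'b::real_inner"
  assumes J: "bounded_linear J" and comm: "\<And>x. J (B x) = B' (J x)"
    and nrm: "\<And>x. norm (op_sqrt B' (J x)) = norm (op_sqrt B x)"
    and sol: "is_solution B \<alpha> u0 u1 u"
  shows "is_solution B' \<alpha> (J u0) (J u1) (\<lambda>t. J (u t))"
proof -
  interpret J: bounded_linear J by (rule J)
  obtain u' u'' where
    u': "\<And>t. 0 \<le> t \<Longrightarrow> (u has_vector_derivative u' t) (at t within {0..})" and
    u'': "\<And>t. 0 \<le> t \<Longrightarrow> (u' has_vector_derivative u'' t) (at t within {0..})" and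
    cont: "continuous_on {0..} u''" and init: "u 0 = u0" "u' 0 = u1" and
    eq: "\<And>t. 0 \<le> t \<Longrightarrow> u'' t + u' t + (norm (op_sqrt B (u t)) powr (2 * \<alpha>)) *\<^sub>R B (u t) = 0"
    using sol unfolding is_solution_def by blast
  have eq': "J (u'' t) + J (u' t) + (norm (op_sqrt B' (J (u t))) powr (2 * \<alpha>)) *\<^sub>R B' (J (u t)) = 0"
    if "0 \<le> t" for t
    using arg_cong[OF eq[OF that], of J] by (simp add: J.add J.scaleR J.zero comm nrm)
  show ?thesis
    unfolding is_solution_def
  proof (rule exI[of _ "\<lambda>t. J (u' t)"], rule exI[of _ "\<lambda>t. J (u'' t)"], intro conjI allI impI)
    show "((\<lambda>t. J (u t)) has_vector_derivative J (u' t)) (at t within {0..})" if "0 \<le> t" for t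
      by (rule J.has_vector_derivative[OF u'[OF that]])
    show "((\<lambda>t. J (u' t)) has_vector_derivative J (u'' t)) (at t within {0..})" if "0 \<le> t" for t
      by (rule J.has_vector_derivative[OF u''[OF that]])
    show "continuous_on {0..} (\<lambda>t. J (u'' t))" by (rule J.continuous_on[OF cont])
    show "J (u'' t) + J (u' t) + norm (op_sqrt B' (J (u t))) powr (2 * \<alpha>) *\<^sub>R B' (J (u t)) = 0"
      if "0 \<le> t" for t by (rule eq'[OF that])
  qed (simp_all add: init)
qed

text \<open>\<open>dt\<close> is identified with the derivative at t >= 0, so the two expressions
  agree eventually, which is enough for the limit.\<close>

lemma fast_with_map:
  fixes J :: "'a::real_inner \<Rightarrow> 'b::real_inner"
  assumes J: "bounded_linear J" and nrm: "\<And>x. norm (J x) = norm x"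
    and sol: "is_solution B \<alpha> u0 u1 u" and fast: "fast_with \<alpha> v0 u"
  shows "fast_with \<alpha> (J v0) (\<lambda>t. J (u t))"
  unfolding fast_with_def
proof (intro allI impI)
  interpret J: bounded_linear J by (rule J)
  fix \<gamma> :: real assume \<gamma>: "\<gamma> < 1 + 2 * \<alpha>"
  obtain u' where u': "\<And>t. 0 \<le> t \<Longrightarrow> (u has_vector_derivative u' t) (at t within {0..})"
    using sol unfolding is_solution_def by blast
  have dt: "dt u t = u' t" "dt (\<lambda>t. J (u t)) t = J (u' t)" if "0 \<le> t" for t
    by (rule dt_eq[OF u'[OF that] that] dt_eq[OF J.has_vector_derivative[OF u'[OF that]] that])+
  have "((\<lambda>t. (norm (dt u t + exp (- t) *\<^sub>R v0) + norm (u t - exp (- t) *\<^sub>R v0)) * exp (\<gamma> * t)) \<longlongrightarrow> 0) at_top"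
    using fast \<gamma> unfolding fast_with_def by blast
  then show "((\<lambda>t. (norm (dt (\<lambda>t. J (u t)) t + exp (- t) *\<^sub>R J v0)
      + norm (J (u t) - exp (- t) *\<^sub>R J v0)) * exp (\<gamma> * t)) \<longlongrightarrow> 0) at_top"
  proof (rule Lim_transform_eventually)
    show "\<forall>\<^sub>F t in at_top. (norm (dt u t + exp (- t) *\<^sub>R v0) + norm (u t - exp (- t) *\<^sub>R v0)) * exp (\<gamma> * t)
      = (norm (dt (\<lambda>t. J (u t)) t + exp (- t) *\<^sub>R J v0) + norm (J (u t) - exp (- t) *\<^sub>R J v0)) * exp (\<gamma> * t)"
      using eventually_ge_at_top[of 0]
    proof eventually_elim
      case (elim t)
      have "norm (J (u' t) + exp (- t) *\<^sub>R J v0) = norm (u' t + exp (- t) *\<^sub>R v0)"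
        "norm (J (u t) - exp (- t) *\<^sub>R J v0) = norm (u t - exp (- t) *\<^sub>R v0)"
        using nrm[of "u' t + exp (- t) *\<^sub>R v0"] nrm[of "u t - exp (- t) *\<^sub>R v0"]
        by (simp_all add: J.add J.diff J.scaleR)
      then show ?case by (simp only: dt[OF elim])
    qed
  qed
qed

theorem theorem5p4:
  fixes B :: "'a::{real_inner, complete_space} \<Rightarrow> 'a" and \<alpha> :: real
  assumes sep: "separable_space (euclidean :: 'a topology)"
    and bl: "bounded_linear B" and sym: "sym_op B" and coer: "coercive_op B"
    and alpha: "\<alpha> > 0" and nontriv: "\<exists>x::'a. x \<noteq> 0"
  shows "(\<forall>u0 u1. \<exists>u. is_solution B \<alpha> u0 u1 u \<and>
            (\<forall>v. is_solution B \<alpha> u0 u1 v \<longrightarrow> (\<forall>t\<ge>0. v t = u t)))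
       \<and> (\<forall>u0 u1 u. is_solution B \<alpha> u0 u1 u \<and> (\<exists>t\<ge>0. u t \<noteq> 0) \<longrightarrow>
            (slow_solution \<alpha> u \<and> \<not> fast_solution \<alpha> u) \<or>
            (fast_solution \<alpha> u \<and> \<not> slow_solution \<alpha> u))
       \<and> (\<exists>S :: ('a \<times> 'a) set. open S \<and> S \<noteq> {} \<and>
            (\<forall>(u0, u1)\<in>S. \<forall>u. is_solution B \<alpha> u0 u1 u \<longrightarrow> slow_solution \<alpha> u))
       \<and> (\<exists>r>0. \<forall>v0. v0 \<noteq> 0 \<and> norm v0 < r \<longrightarrow>
            (\<exists>u0 u1 u. is_solution B \<alpha> u0 u1 u \<and> fast_with \<alpha> v0 u))"
proof -
  interpret to: bounded_linear "to_copy :: 'a \<Rightarrow> _" by (rule bounded_linear_to_copy)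
  have conj_bl: "bounded_linear (\<lambda>x. to_copy (T (of_copy x)))" if "bounded_linear T" for T :: "'a \<Rightarrow> 'a"
    using bounded_linear_compose[OF bounded_linear_to_copy bounded_linear_compose[OF that bounded_linear_of_copy]] .
  have conj_bl': "bounded_linear (\<lambda>x. of_copy (T (to_copy x)))"
    if "bounded_linear T" for T :: "'a hilbert_copy \<Rightarrow> 'a hilbert_copy"
    using bounded_linear_compose[OF bounded_linear_of_copy bounded_linear_compose[OF that bounded_linear_to_copy]] .
  define B' where "B' = (\<lambda>x. to_copy (B (of_copy x)))"
  have bl': "bounded_linear B'" unfolding B'_def by (rule conj_bl[OF bl])
  have sym': "sym_op B'"
    using sym by (simp add: sym_op_def B'_def inner_to_copy_left flip: inner_of_copy_left)
  have coer': "coercive_op B'"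
  proof -
    obtain c where c: "0 < c" "\<And>u. c * (norm u)\<^sup>2 \<le> B u \<bullet> u" using coer unfolding coercive_op_def by auto
    have "c * (norm u)\<^sup>2 \<le> B' u \<bullet> u" for u using c(2)[of "of_copy u"] by (simp add: B'_def inner_to_copy_left)
    then show ?thesis unfolding coercive_op_def using c(1) by blast
  qed
  have to_zero: "to_copy x = 0 \<longleftrightarrow> x = 0" for x :: 'a
    using norm_to_copy[of x] by (simp flip: norm_eq_zero[of "to_copy x"])
  have nontriv': "\<exists>x::'a hilbert_copy. x \<noteq> 0"
    using nontriv to_zero by blast
  note main = theorem5p4_banach[OF bl' sym' coer' alpha nontriv']
  \<comment> \<open>Conjugation by the isometry sends roots to roots in both directions: the root of
    B' yields one of B, and any root of B yields one of B', where uniqueness is known.\<close>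
  have sqrt_eq: "op_sqrt B = (\<lambda>x. of_copy (op_sqrt B' (to_copy x)))"
    unfolding op_sqrt_def[of B]
  proof (rule the_equality)
    note S' = op_sqrt_properties[OF bl' sym' coer']
    have "op_sqrt B' (op_sqrt B' x) = B' x" for x using fun_cong[OF S'(4), of x] by simp
    then show "bounded_linear (\<lambda>x. of_copy (op_sqrt B' (to_copy x))) \<and> sym_op (\<lambda>x. of_copy (op_sqrt B' (to_copy x))) \<and>
      nonneg_op (\<lambda>x. of_copy (op_sqrt B' (to_copy x))) \<and>
      (\<lambda>x. of_copy (op_sqrt B' (to_copy x))) \<circ> (\<lambda>x. of_copy (op_sqrt B' (to_copy x))) = B"
      using conj_bl'[OF S'(1)] S'(2,3)
      by (auto simp: sym_op_def nonneg_op_def inner_of_copy_left B'_def fun_eq_iff simp flip: inner_to_copy_left)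
    fix S assume S: "bounded_linear S \<and> sym_op S \<and> nonneg_op S \<and> S \<circ> S = B"
    then have SS: "S (S x) = B x" for x by (auto simp: fun_eq_iff)
    have "bounded_linear (\<lambda>x. to_copy (S (of_copy x))) \<and> sym_op (\<lambda>x. to_copy (S (of_copy x))) \<and>
      nonneg_op (\<lambda>x. to_copy (S (of_copy x))) \<and>
      (\<lambda>x. to_copy (S (of_copy x))) \<circ> (\<lambda>x. to_copy (S (of_copy x))) = B'"
      using conj_bl[of S] S
      by (auto simp: sym_op_def nonneg_op_def inner_to_copy_left B'_def fun_eq_iff SS simp flip: inner_of_copy_left)
    then have "op_sqrt B' = (\<lambda>x. to_copy (S (of_copy x)))"
      using op_sqrt_ex1[OF bl' sym' coer'] S'(1-4) by blast
    then show "S = (\<lambda>x. of_copy (op_sqrt B' (to_copy x)))" by simp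
  qed
  have to_sol: "is_solution B' \<alpha> (to_copy u0) (to_copy u1) (\<lambda>t. to_copy (u t))"
    if "is_solution B \<alpha> u0 u1 u" for u0 u1 u
    by (rule is_solution_map[OF bounded_linear_to_copy _ _ that]) (simp_all add: B'_def sqrt_eq)
  have of_sol: "is_solution B \<alpha> (of_copy u0) (of_copy u1) (\<lambda>t. of_copy (u t))"
    if "is_solution B' \<alpha> u0 u1 u" for u0 u1 u
    by (rule is_solution_map[OF bounded_linear_of_copy _ _ that]) (simp_all add: B'_def sqrt_eq)
  have slow_iff: "slow_solution \<alpha> (\<lambda>t. to_copy (u t)) \<longleftrightarrow> slow_solution \<alpha> u" for u :: "real \<Rightarrow> 'a"
    by (simp add: slow_solution_def)

  have "\<exists>u. is_solution B \<alpha> u0 u1 u \<and> (\<forall>v. is_solution B \<alpha> u0 u1 v \<longrightarrow> (\<forall>t\<ge>0. v t = u t))" for u0 u1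
  proof -
    obtain u where u: "is_solution B' \<alpha> (to_copy u0) (to_copy u1) u"
      and uniq: "\<And>v t. is_solution B' \<alpha> (to_copy u0) (to_copy u1) v \<Longrightarrow> 0 \<le> t \<Longrightarrow> v t = u t"
      using main(1) by blast
    have "v t = of_copy (u t)" if "is_solution B \<alpha> u0 u1 v" "0 \<le> t" for v t
      using uniq[OF to_sol[OF that(1)] that(2)] by (metis of_to_copy)
    then show ?thesis using of_sol[OF u] by (intro exI[of _ "\<lambda>t. of_copy (u t)"]) auto
  qed
  moreover have "slow_solution \<alpha> u \<or> fast_solution \<alpha> u"
    if u: "is_solution B \<alpha> u0 u1 u" and nz: "\<exists>t\<ge>0. u t \<noteq> 0" for u0 u1 u
  proof -
    have "slow_solution \<alpha> (\<lambda>t. to_copy (u t)) \<or> fast_solution \<alpha> (\<lambda>t. to_copy (u t))"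
      by (rule main(2)[OF to_sol[OF u]]) (use nz in \<open>simp add: to_zero\<close>)
    then show ?thesis
    proof
      assume "fast_solution \<alpha> (\<lambda>t. to_copy (u t))"
      then obtain v0 where v0: "v0 \<noteq> 0" "fast_with \<alpha> v0 (\<lambda>t. to_copy (u t))"
        unfolding fast_solution_def by blast
      have "fast_with \<alpha> (of_copy v0) u"
        using fast_with_map[OF bounded_linear_of_copy norm_of_copy to_sol[OF u] v0(2)] by simp
      moreover have "of_copy v0 \<noteq> 0" using v0(1) to_zero[of "of_copy v0"] by simp
      ultimately show ?thesis unfolding fast_solution_def by blast
    qed (simp add: slow_iff)
  qed
  moreover have "\<exists>S :: ('a \<times> 'a) set. open S \<and> S \<noteq> {} \<and>
      (\<forall>(u0, u1)\<in>S. \<forall>u. is_solution B \<alpha> u0 u1 u \<longrightarrow> slow_solution \<alpha> u)"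
  proof -
    obtain A :: "('a hilbert_copy \<times> 'a hilbert_copy) set" where A: "open A" "A \<noteq> {}"
      "\<And>u0 u1 u. (u0, u1) \<in> A \<Longrightarrow> is_solution B' \<alpha> u0 u1 u \<Longrightarrow> slow_solution \<alpha> u"
      using main(3) by blast
    \<comment> \<open>The slow data are pulled back, since preimages under the continuous map remain
      open.\<close>
    define A' where "A' = (\<lambda>x :: 'a \<times> 'a. (to_copy (fst x), to_copy (snd x))) -` A"
    have "open A'"
      unfolding A'_def using A(1)
      by (rule open_vimage) (intro continuous_on_Pair to.continuous_on continuous_on_fst continuous_on_snd continuous_on_id)
    moreover obtain a b where "(a, b) \<in> A" using A(2) by auto
    then have "(of_copy a, of_copy b) \<in> A'" by (simp add: A'_def)
    moreover have "slow_solution \<alpha> u" if "(u0, u1) \<in> A'" "is_solution B \<alpha> u0 u1 u" for u0 u1 u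
      using A(3)[OF _ to_sol[OF that(2)]] that(1) by (simp add: A'_def slow_iff)
    ultimately show ?thesis by (intro exI[of _ A']) blast
  qed
  moreover have "\<exists>r>0. \<forall>v0. v0 \<noteq> 0 \<and> norm v0 < r \<longrightarrow>
      (\<exists>u0 u1 u. is_solution B \<alpha> u0 u1 u \<and> fast_with \<alpha> v0 u)"
  proof -
    obtain r where r: "0 < r" "\<And>v0. norm v0 < r \<Longrightarrow> \<exists>u0 u1 u. is_solution B' \<alpha> u0 u1 u \<and> fast_with \<alpha> v0 u"
      using main(4) by blast
    have "\<exists>u0 u1 u. is_solution B \<alpha> u0 u1 u \<and> fast_with \<alpha> v0 u" if "norm v0 < r" for v0 :: 'a
    proof -
      have "norm (to_copy v0) < r" using that by simp
      then obtain u0 u1 u where u: "is_solution B' \<alpha> u0 u1 u" "fast_with \<alpha> (to_copy v0) u"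
        using r(2) by blast
      show ?thesis
        using of_sol[OF u(1)] fast_with_map[OF bounded_linear_of_copy norm_of_copy u] by auto
    qed
    then show ?thesis using r(1) by blast
  qed
  ultimately show ?thesis using not_slow_and_fast[OF _ _ alpha] by blast
qed

end
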